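(* Let $R$ be a Noetherian reduced commutative ring of prime characteristic $p>0$. Then the following are equivalent: (1) $R$ is regular. (2) Finite intersection of ideals commutes with taking bracket powers; that is, for every finite collection $I_1,\dots,I_k$ of ideals of $R$ and every power $q=p^n$ of $p$, we have $\bigcap_{j=1}^k I_j^{[q]} = \left(\bigcap_{j=1}^k I_j\right)^{[q]}$. (3) For any ideal $I$ of $R$ and any $x\in R$, we have $I^{[p]} \cap (x^p) = (I \cap (x))^{[p]}$. (4) For any ideal $I$ of $R$ and any $x\in R$, we have $(I : x)^{[p]} = (I^{[p]} : x^p)$.
   Context: All rings are unital and associative. For an ideal $I$ of a commutative ring $R$ of prime characteristic $p>0$ and a power $p^n$ of $p$, the $p^n$th bracket power $I^{[p^n]}$ is the ideal of $R$ generated by $\{x^{p^n} : x\in I\}$. For $x\in R$, $(x)$ denotes the principal ideal generated by $x$, and $(I:x)=\{r\in R : rx\in I\}$. A Noetherian commutative ring is regular if its localization at every maximal ideal (equivalently, every prime ideal) is a regular local ring. *)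

theory Defs
  imports "HOL-Algebra.Algebra" "HOL-Library.Extended_Nat"
begin

text \<open>The order of an element is \<open>0\<close> when it is infinite.\<close>

definition ring_char :: "('a, 'b) ring_scheme \<Rightarrow> nat" where
  "ring_char R = group.ord (add_monoid R) \<one>\<^bsub>R\<^esub>"

definition reduced_ring :: "('a, 'b) ring_scheme \<Rightarrow> bool" where
  "reduced_ring R \<longleftrightarrow>
     ring R \<and> (\<forall>x \<in> carrier R. \<forall>n::nat. x [^]\<^bsub>R\<^esub> n = \<zero>\<^bsub>R\<^esub> \<longrightarrow> x = \<zero>\<^bsub>R\<^esub>)"


subsection \<open>Localization\<close>

definition frac_rel :: "('a, 'b) ring_scheme \<Rightarrow> 'a set \<Rightarrow> (('a \<times> 'a) \<times> ('a \<times> 'a)) set" where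
  "frac_rel R S =
     {((a, s), (b, t)) | a s b t. a \<in> carrier R \<and> s \<in> S \<and> b \<in> carrier R \<and> t \<in> S \<and>
        (\<exists>u \<in> S. u \<otimes>\<^bsub>R\<^esub> (a \<otimes>\<^bsub>R\<^esub> t \<ominus>\<^bsub>R\<^esub> b \<otimes>\<^bsub>R\<^esub> s) = \<zero>\<^bsub>R\<^esub>)}"

definition loc_frac :: "('a, 'b) ring_scheme \<Rightarrow> 'a set \<Rightarrow> 'a \<Rightarrow> 'a \<Rightarrow> ('a \<times> 'a) set" where
  "loc_frac R S a s = frac_rel R S `` {(a, s)}"

text \<open>
  The operations take the union over all representatives; this union is the expected single class,
  see \<open>localization_add\<close> and \<open>localization_mult\<close> below.
\<close>

definition localization :: "('a, 'b) ring_scheme \<Rightarrow> 'a set \<Rightarrow> ('a \<times> 'a) set ring" where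
  "localization R S =
     \<lparr> carrier = (carrier R \<times> S) // frac_rel R S,
       monoid.mult = (\<lambda>A B. \<Union>x \<in> A. \<Union>y \<in> B.
                loc_frac R S (fst x \<otimes>\<^bsub>R\<^esub> fst y) (snd x \<otimes>\<^bsub>R\<^esub> snd y)),
       monoid.one = loc_frac R S \<one>\<^bsub>R\<^esub> \<one>\<^bsub>R\<^esub>,
       ring.zero = loc_frac R S \<zero>\<^bsub>R\<^esub> \<one>\<^bsub>R\<^esub>,
       ring.add = (\<lambda>A B. \<Union>x \<in> A. \<Union>y \<in> B.
                loc_frac R S (fst x \<otimes>\<^bsub>R\<^esub> snd y \<oplus>\<^bsub>R\<^esub> fst y \<otimes>\<^bsub>R\<^esub> snd x)
                       (snd x \<otimes>\<^bsub>R\<^esub> snd y)) \<rparr>"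

locale mult_closed = cring R for R (structure) +
  fixes S
  assumes S_sub: "S \<subseteq> carrier R"
    and S_one: "\<one> \<in> S"
    and S_mult: "\<lbrakk>s \<in> S; t \<in> S\<rbrakk> \<Longrightarrow> s \<otimes> t \<in> S"
begin

lemma S_carr: "s \<in> S \<Longrightarrow> s \<in> carrier R"
  using S_sub by blast

lemma frac_rel_iff:
  "((a, s), (b, t)) \<in> frac_rel R S \<longleftrightarrow>
     a \<in> carrier R \<and> s \<in> S \<and> b \<in> carrier R \<and> t \<in> S \<and>
     (\<exists>u \<in> S. u \<otimes> (a \<otimes> t) = u \<otimes> (b \<otimes> s))"
proof -
  have "(u \<otimes> (a \<otimes> t \<ominus> b \<otimes> s) = \<zero>) = (u \<otimes> (a \<otimes> t) = u \<otimes> (b \<otimes> s))"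
    if "a \<in> carrier R" "s \<in> S" "b \<in> carrier R" "t \<in> S" "u \<in> S" for u
  proof -
    have "u \<otimes> (a \<otimes> t \<ominus> b \<otimes> s) = u \<otimes> (a \<otimes> t) \<ominus> u \<otimes> (b \<otimes> s)"
      using that by (simp add: S_carr r_distr r_minus a_minus_def)
    then show ?thesis
      using that by (simp add: S_carr)
  qed
  then show ?thesis
    unfolding frac_rel_def by auto
qed

lemma equiv_frac_rel: "equiv (carrier R \<times> S) (frac_rel R S)"
proof (rule equivI)
  show "frac_rel R S \<subseteq> (carrier R \<times> S) \<times> (carrier R \<times> S)"
    by (auto simp: frac_rel_def)
  show "refl_on (carrier R \<times> S) (frac_rel R S)"
    using S_one by (auto simp: refl_on_def frac_rel_iff)
  show "sym (frac_rel R S)"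
    by (rule symI) (auto simp: frac_rel_iff, metis)
  show "trans (frac_rel R S)"
  proof (rule transI)
    fix x y z
    assume xy: "(x, y) \<in> frac_rel R S" and yz: "(y, z) \<in> frac_rel R S"
    obtain a s b t c r where [simp]: "x = (a, s)" "y = (b, t)" "z = (c, r)"
      by (cases x, cases y, cases z) auto
    from xy obtain u where u: "u \<in> S" "u \<otimes> (a \<otimes> t) = u \<otimes> (b \<otimes> s)"
      and S: "a \<in> carrier R" "s \<in> S" "b \<in> carrier R" "t \<in> S"
      by (auto simp: frac_rel_iff)
    from yz obtain v where v: "v \<in> S" "v \<otimes> (b \<otimes> r) = v \<otimes> (c \<otimes> t)"
      and S': "c \<in> carrier R" "r \<in> S"
      by (auto simp: frac_rel_iff)
    note C = u(1) v(1) S S'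
    have "(u \<otimes> v \<otimes> t) \<otimes> (a \<otimes> r) = (v \<otimes> r) \<otimes> (u \<otimes> (a \<otimes> t))"
      using C by (simp add: S_carr m_ac)
    also have "\<dots> = (u \<otimes> s) \<otimes> (v \<otimes> (b \<otimes> r))"
      unfolding u(2) using C by (simp add: S_carr m_ac)
    also have "\<dots> = (u \<otimes> v \<otimes> t) \<otimes> (c \<otimes> s)"
      unfolding v(2) using C by (simp add: S_carr m_ac)
    finally show "(x, z) \<in> frac_rel R S"
      using C S_mult by (auto simp: frac_rel_iff)
  qed
qed

lemma frac_eq_iff:
  assumes "a \<in> carrier R" "s \<in> S" "b \<in> carrier R" "t \<in> S"
  shows "loc_frac R S a s = loc_frac R S b t \<longleftrightarrow> (\<exists>u \<in> S. u \<otimes> (a \<otimes> t) = u \<otimes> (b \<otimes> s))"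
  unfolding loc_frac_def using assms
  by (subst eq_equiv_class_iff[OF equiv_frac_rel]) (auto simp: frac_rel_iff)

lemma carrier_localization:
  "carrier (localization R S) = {loc_frac R S a s | a s. a \<in> carrier R \<and> s \<in> S}"
  by (auto simp: localization_def loc_frac_def quotient_def)

lemma localization_mult:
  assumes "a \<in> carrier R" "s \<in> S" "b \<in> carrier R" "t \<in> S"
  shows "loc_frac R S a s \<otimes>\<^bsub>localization R S\<^esub> loc_frac R S b t = loc_frac R S (a \<otimes> b) (s \<otimes> t)"
proof -
  have "(\<lambda>(a, s) (b, t). loc_frac R S (a \<otimes> b) (s \<otimes> t)) respects2 frac_rel R S"
  proof (rule congruent2I', clarify)
    fix a s a' s' b t b' t'
    assume 1: "((a, s), (a', s')) \<in> frac_rel R S" and 2: "((b, t), (b', t')) \<in> frac_rel R S"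
    then obtain u v where u: "u \<in> S" "u \<otimes> (a \<otimes> s') = u \<otimes> (a' \<otimes> s)"
      and v: "v \<in> S" "v \<otimes> (b \<otimes> t') = v \<otimes> (b' \<otimes> t)"
      and C: "a \<in> carrier R" "a' \<in> carrier R" "b \<in> carrier R" "b' \<in> carrier R"
        "s \<in> S" "s' \<in> S" "t \<in> S" "t' \<in> S"
      by (auto simp: frac_rel_iff)
    have "(u \<otimes> v) \<otimes> ((a \<otimes> b) \<otimes> (s' \<otimes> t')) = (u \<otimes> (a \<otimes> s')) \<otimes> (v \<otimes> (b \<otimes> t'))"
      using C u(1) v(1) by (simp add: S_carr m_ac)
    also have "\<dots> = (u \<otimes> v) \<otimes> ((a' \<otimes> b') \<otimes> (s \<otimes> t))"
      unfolding u(2) v(2) using C u(1) v(1) by (simp add: S_carr m_ac)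
    finally show "loc_frac R S (a \<otimes> b) (s \<otimes> t) = loc_frac R S (a' \<otimes> b') (s' \<otimes> t')"
      using C u(1) v(1) by (subst frac_eq_iff) (auto intro: S_mult)
  qed
  from UN_equiv_class2[OF equiv_frac_rel equiv_frac_rel this, of "(a, s)" "(b, t)"] assms
  show ?thesis
    by (simp add: localization_def loc_frac_def[of R S a s] loc_frac_def[of R S b t] case_prod_unfold)
qed

lemma localization_add:
  assumes "a \<in> carrier R" "s \<in> S" "b \<in> carrier R" "t \<in> S"
  shows "loc_frac R S a s \<oplus>\<^bsub>localization R S\<^esub> loc_frac R S b t
       = loc_frac R S (a \<otimes> t \<oplus> b \<otimes> s) (s \<otimes> t)"
proof -
  have "(\<lambda>(a, s) (b, t). loc_frac R S (a \<otimes> t \<oplus> b \<otimes> s) (s \<otimes> t)) respects2 frac_rel R S"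
  proof (rule congruent2I', clarify)
    fix a s a' s' b t b' t'
    assume 1: "((a, s), (a', s')) \<in> frac_rel R S" and 2: "((b, t), (b', t')) \<in> frac_rel R S"
    then obtain u v where u: "u \<in> S" "u \<otimes> (a \<otimes> s') = u \<otimes> (a' \<otimes> s)"
      and v: "v \<in> S" "v \<otimes> (b \<otimes> t') = v \<otimes> (b' \<otimes> t)"
      and C: "a \<in> carrier R" "a' \<in> carrier R" "b \<in> carrier R" "b' \<in> carrier R"
        "s \<in> S" "s' \<in> S" "t \<in> S" "t' \<in> S"
      by (auto simp: frac_rel_iff)
    have "(u \<otimes> v) \<otimes> ((a \<otimes> t \<oplus> b \<otimes> s) \<otimes> (s' \<otimes> t'))
        = (v \<otimes> t \<otimes> t') \<otimes> (u \<otimes> (a \<otimes> s')) \<oplus> (u \<otimes> s \<otimes> s') \<otimes> (v \<otimes> (b \<otimes> t'))"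
      using C u(1) v(1) by (simp add: S_carr m_ac l_distr r_distr)
    also have "\<dots> = (u \<otimes> v) \<otimes> ((a' \<otimes> t' \<oplus> b' \<otimes> s') \<otimes> (s \<otimes> t))"
      unfolding u(2) v(2) using C u(1) v(1) by (simp add: S_carr m_ac l_distr r_distr)
    finally show "loc_frac R S (a \<otimes> t \<oplus> b \<otimes> s) (s \<otimes> t) = loc_frac R S (a' \<otimes> t' \<oplus> b' \<otimes> s') (s' \<otimes> t')"
      using C u(1) v(1) by (subst frac_eq_iff) (auto intro: S_mult S_carr)
  qed
  from UN_equiv_class2[OF equiv_frac_rel equiv_frac_rel this, of "(a, s)" "(b, t)"] assms
  show ?thesis
    by (simp add: localization_def loc_frac_def[of R S a s] loc_frac_def[of R S b t] case_prod_unfold)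
qed

lemma localization_cring: "cring (localization R S)"
proof -
  let ?L = "localization R S"
  have one: "\<one>\<^bsub>?L\<^esub> = loc_frac R S \<one> \<one>" and zero: "\<zero>\<^bsub>?L\<^esub> = loc_frac R S \<zero> \<one>"
    by (simp_all add: localization_def)
  have cancel: "loc_frac R S a s = loc_frac R S b t"
    if "a \<in> carrier R" "s \<in> S" "b \<in> carrier R" "t \<in> S" "a \<otimes> t = b \<otimes> s" for a s b t
    using that S_one by (auto simp: frac_eq_iff)
  have in_carrier: "loc_frac R S a s \<in> carrier ?L" if "a \<in> carrier R" "s \<in> S" for a s
    using that by (auto simp: carrier_localization)
  note simps = one zero localization_add localization_mult S_one S_mult S_carr
  have ag: "abelian_group ?L"
  proof (rule abelian_groupI)
    fix x y assume "x \<in> carrier ?L" "y \<in> carrier ?L"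
    then obtain a s b t where C: "a \<in> carrier R" "s \<in> S" "b \<in> carrier R" "t \<in> S"
      and xy: "x = loc_frac R S a s" "y = loc_frac R S b t"
      by (auto simp: carrier_localization)
    show "x \<oplus>\<^bsub>?L\<^esub> y \<in> carrier ?L"
      using C by (simp add: xy simps in_carrier)
    show "x \<oplus>\<^bsub>?L\<^esub> y = y \<oplus>\<^bsub>?L\<^esub> x"
      using C by (simp add: xy simps a_comm m_comm)
    fix z assume "z \<in> carrier ?L"
    then obtain c r where D: "c \<in> carrier R" "r \<in> S" and z: "z = loc_frac R S c r"
      by (auto simp: carrier_localization)
    show "(x \<oplus>\<^bsub>?L\<^esub> y) \<oplus>\<^bsub>?L\<^esub> z = x \<oplus>\<^bsub>?L\<^esub> (y \<oplus>\<^bsub>?L\<^esub> z)"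
      using C D by (simp add: xy z simps a_ac m_ac l_distr r_distr)
  next
    show "\<zero>\<^bsub>?L\<^esub> \<in> carrier ?L"
      using S_one by (simp add: simps in_carrier)
  next
    fix x assume "x \<in> carrier ?L"
    then obtain a s where C: "a \<in> carrier R" "s \<in> S" and x: "x = loc_frac R S a s"
      by (auto simp: carrier_localization)
    show "\<zero>\<^bsub>?L\<^esub> \<oplus>\<^bsub>?L\<^esub> x = x"
      using C by (simp add: x simps)
    have "loc_frac R S (\<ominus> a) s \<in> carrier ?L"
      using C by (simp add: in_carrier)
    moreover have "loc_frac R S (\<ominus> a) s \<oplus>\<^bsub>?L\<^esub> x = \<zero>\<^bsub>?L\<^esub>"
      using C by (simp add: x simps) (rule cancel, simp_all add: simps l_minus l_neg)
    ultimately show "\<exists>y \<in> carrier ?L. y \<oplus>\<^bsub>?L\<^esub> x = \<zero>\<^bsub>?L\<^esub>"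
      by blast
  qed
  have cm: "comm_monoid ?L"
  proof (rule comm_monoidI)
    fix x y assume "x \<in> carrier ?L" "y \<in> carrier ?L"
    then obtain a s b t where C: "a \<in> carrier R" "s \<in> S" "b \<in> carrier R" "t \<in> S"
      and xy: "x = loc_frac R S a s" "y = loc_frac R S b t"
      by (auto simp: carrier_localization)
    show "x \<otimes>\<^bsub>?L\<^esub> y \<in> carrier ?L"
      using C by (simp add: xy simps in_carrier)
    show "x \<otimes>\<^bsub>?L\<^esub> y = y \<otimes>\<^bsub>?L\<^esub> x"
      using C by (simp add: xy simps m_comm)
    fix z assume "z \<in> carrier ?L"
    then obtain c r where D: "c \<in> carrier R" "r \<in> S" and z: "z = loc_frac R S c r"
      by (auto simp: carrier_localization)
    show "(x \<otimes>\<^bsub>?L\<^esub> y) \<otimes>\<^bsub>?L\<^esub> z = x \<otimes>\<^bsub>?L\<^esub> (y \<otimes>\<^bsub>?L\<^esub> z)"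
      using C D by (simp add: xy z simps m_assoc)
  next
    show "\<one>\<^bsub>?L\<^esub> \<in> carrier ?L"
      using S_one by (simp add: simps in_carrier)
  next
    fix x assume "x \<in> carrier ?L"
    then show "\<one>\<^bsub>?L\<^esub> \<otimes>\<^bsub>?L\<^esub> x = x"
      by (auto simp: carrier_localization simps)
  qed
  show ?thesis
  proof (rule cringI[OF ag cm])
    fix x y z assume "x \<in> carrier ?L" "y \<in> carrier ?L" "z \<in> carrier ?L"
    then obtain a s b t c r where C: "a \<in> carrier R" "s \<in> S" "b \<in> carrier R" "t \<in> S"
        "c \<in> carrier R" "r \<in> S"
      and xyz: "x = loc_frac R S a s" "y = loc_frac R S b t" "z = loc_frac R S c r"
      by (auto simp: carrier_localization)
    show "(x \<oplus>\<^bsub>?L\<^esub> y) \<otimes>\<^bsub>?L\<^esub> z = x \<otimes>\<^bsub>?L\<^esub> z \<oplus>\<^bsub>?L\<^esub> y \<otimes>\<^bsub>?L\<^esub> z"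
      using C by (simp add: xyz simps)
        (rule cancel, simp_all add: simps m_ac l_distr r_distr)
  qed
qed

end

lemma (in primeideal) mult_closed_compl: "mult_closed R (carrier R - I)"
proof unfold_locales
  show "carrier R - I \<subseteq> carrier R"
    by blast
  show "\<one> \<in> carrier R - I"
    using I_notcarr one_imp_carrier by auto
  show "s \<otimes> t \<in> carrier R - I" if "s \<in> carrier R - I" "t \<in> carrier R - I" for s t
    using that I_prime by auto
qed


subsection \<open>Regular rings\<close>

text \<open>The supremum is taken in \<^typ>\<open>enat\<close>, so the zero ring gets dimension \<open>0\<close>.\<close>

definition krull_dim :: "('a, 'b) ring_scheme \<Rightarrow> enat" where
  "krull_dim R =
     Sup {enat n | n. \<exists>P :: nat \<Rightarrow> 'a set.
            (\<forall>i \<le> n. primeideal (P i) R) \<and> (\<forall>i < n. P i \<subset> P (Suc i))}"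

definition local_ring :: "('a, 'b) ring_scheme \<Rightarrow> bool" where
  "local_ring R \<longleftrightarrow> cring R \<and> (\<exists>!M. maximalideal M R)"

definition regular_local_ring :: "('a, 'b) ring_scheme \<Rightarrow> bool" where
  "regular_local_ring R \<longleftrightarrow>
     noetherian_ring R \<and> local_ring R \<and>
     (\<exists>M A. maximalideal M R \<and> A \<subseteq> carrier R \<and> finite A \<and> M = Idl\<^bsub>R\<^esub> A \<and>
            enat (card A) = krull_dim R)"

definition regular_ring :: "('a, 'b) ring_scheme \<Rightarrow> bool" where
  "regular_ring R \<longleftrightarrow>
     cring R \<and> noetherian_ring R \<and>
     (\<forall>M. maximalideal M R \<longrightarrow> regular_local_ring (localization R (carrier R - M)))"


subsection \<open>Bracket powers and colon ideals\<close>

definition bracket_power :: "('a, 'b) ring_scheme \<Rightarrow> 'a set \<Rightarrow> nat \<Rightarrow> 'a set" where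
  "bracket_power R I q = Idl\<^bsub>R\<^esub> ((\<lambda>x. x [^]\<^bsub>R\<^esub> q) ` I)"

definition colon :: "('a, 'b) ring_scheme \<Rightarrow> 'a set \<Rightarrow> 'a \<Rightarrow> 'a set" where
  "colon R I x = {r \<in> carrier R. r \<otimes>\<^bsub>R\<^esub> x \<in> I}"

end

theory Submission
  imports Defs
begin

text \<open>
  The pivot is the colon identity (I : u)^{[q]} = (I^{[q]} : u^q), an elementary form of the flatness
  of the Frobenius map. It yields the intersection identities by induction on the number of generators
  of one of the two ideals (\<open>colon_imp_inter_fg\<close>). In a reduced local ring it is recovered from the
  intersections with principal ideals (\<open>principal_inter_imp_colon\<close>): if x y = 0, the intersection of
  (x + y) and (x) and Nakayama's lemma force x = 0 or y = 0, and in a domain x^p can be cancelled.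
  These identities pass to localizations at maximal ideals, and the colon identity also passes
  back, so that what remains is to compare it with regularity in a Noetherian local ring R with
  maximal ideal M.

  There the link is a count of lengths. Suppose that M is generated by an ideal J and n elements, and
  that the product of the (q - 1)-st powers of these elements is not in J + M^{[q]}, for every power q
  of p. Then R/(J + M^{[q]}) has the greatest possible length q^n (\<open>monomial_length\<close>). For an M-primary
  ideal I, Frobenius turns each factor of a composition series of R/I into a cyclic module killed by
  J + M^{[p]}, hence of length at most p^n. As R/(J + M^{[q]}) and R/(J + M^{[pq]}) have lengths q^n
  and (pq)^n, nothing is lost at any factor (\<open>frob_length_step\<close>), and this gives the colon identity
  modulo J for M-primary ideals. A weak form of the Artin-Rees lemma (\<open>weak_Artin_Rees\<close>) and Krull's
  intersection theorem extend it to all ideals that contain J (\<open>colon_frob\<close>). In particular J is a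
  prime ideal (\<open>colon_imp_prime\<close>).

  The condition on the monomials is inherited when one of the n elements is moved into J. If the
  colon identity holds in R, then a minimal system of n generators of M satisfies the condition with
  J = 0 (\<open>independent_imp_full_parameters\<close>); therefore each subset generates a prime ideal, which gives
  a chain of primes of length n, and R is regular because the height of M is at most n. Conversely, if R is
  regular, then Krull's height theorem implies that each subset of a system of n generators of M
  generates a prime ideal (\<open>parameters_prime\<close>). So the generators form a regular sequence in any
  order, and so do their q-th powers; hence the condition on the monomials holds and with it the colon
  identity. The principal ideal theorem behind the height theorem is proved by a count of lengths, too.
\<close>

section \<open>Ideals, colon ideals and bracket powers\<close>

context cring begin

lemma idl_add: "ideal I R \<Longrightarrow> x \<in> I \<Longrightarrow> y \<in> I \<Longrightarrow> x \<oplus> y \<in> I"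
  by (simp add: ideal_def additive_subgroup.a_closed)

lemma idl_zero: "ideal I R \<Longrightarrow> \<zero> \<in> I"
  by (simp add: ideal_def additive_subgroup.zero_closed)

lemma idl_neg: "ideal I R \<Longrightarrow> x \<in> I \<Longrightarrow> \<ominus> x \<in> I"
  by (simp add: ideal_def additive_subgroup.a_inv_closed)

lemma idl_carr: "ideal I R \<Longrightarrow> x \<in> I \<Longrightarrow> x \<in> carrier R"
  by (rule ideal.Icarr)

lemma idl_sub: "ideal I R \<Longrightarrow> I \<subseteq> carrier R"
  by (auto intro: idl_carr)

lemma idl_diff: "ideal I R \<Longrightarrow> x \<in> I \<Longrightarrow> y \<in> I \<Longrightarrow> x \<ominus> y \<in> I"
  by (simp add: a_minus_def idl_add idl_neg)

lemma idl_lmult: "ideal I R \<Longrightarrow> x \<in> I \<Longrightarrow> r \<in> carrier R \<Longrightarrow> r \<otimes> x \<in> I"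
  by (rule ideal.I_l_closed)

lemma idl_rmult: "ideal I R \<Longrightarrow> x \<in> I \<Longrightarrow> r \<in> carrier R \<Longrightarrow> x \<otimes> r \<in> I"
  by (rule ideal.I_r_closed)

lemma idl_addD: "ideal I R \<Longrightarrow> x \<oplus> y \<in> I \<Longrightarrow> y \<in> I \<Longrightarrow> x \<in> carrier R \<Longrightarrow> x \<in> I"
  using idl_diff[of I "x \<oplus> y" y] idl_carr[of I y]
  by (simp add: a_minus_def a_assoc r_neg)

lemma idl_pow: "ideal I R \<Longrightarrow> x \<in> I \<Longrightarrow> 0 < n \<Longrightarrow> x [^] (n::nat) \<in> I"
  by (cases n) (auto simp: idl_carr idl_lmult)

lemma add_diff_cancel:
  "a \<in> carrier R \<Longrightarrow> b \<in> carrier R \<Longrightarrow> (a \<oplus> b) \<ominus> a = b"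
  by (simp add: a_minus_def a_comm[of a b] a_assoc r_neg)

lemma pow_pred: "x \<in> carrier R \<Longrightarrow> 0 < q \<Longrightarrow> x [^] q = x \<otimes> x [^] (q - 1 :: nat)"
  by (cases q) (auto simp: m_comm)

lemma idl_pow_le:
  assumes "ideal I R" "x \<in> carrier R" "x [^] (n::nat) \<in> I" "n \<le> k" shows "x [^] k \<in> I"
proof -
  have "x [^] k = x [^] (k - n) \<otimes> x [^] n" using assms by (simp add: nat_pow_mult)
  thus ?thesis using assms by (simp add: idl_lmult)
qed

lemma ring_idealI:
  assumes "I \<subseteq> carrier R" "\<zero> \<in> I" "\<And>x y. x \<in> I \<Longrightarrow> y \<in> I \<Longrightarrow> x \<oplus> y \<in> I"
    "\<And>x r. x \<in> I \<Longrightarrow> r \<in> carrier R \<Longrightarrow> r \<otimes> x \<in> I"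
  shows "ideal I R"
proof (rule idealI[OF ring_axioms])
  have neg: "\<ominus> x \<in> I" if "x \<in> I" for x
  proof -
    have "\<ominus> x = (\<ominus> \<one>) \<otimes> x" using assms(1) that by (simp add: l_minus subset_iff)
    thus ?thesis using assms(4)[OF that] by simp
  qed
  show "subgroup I (add_monoid R)"
    by (rule subgroup.intro) (use assms neg in \<open>auto simp: a_inv_def[symmetric]\<close>)
  show "\<And>a x. a \<in> I \<Longrightarrow> x \<in> carrier R \<Longrightarrow> x \<otimes> a \<in> I" by (rule assms(4))
  show "\<And>a x. a \<in> I \<Longrightarrow> x \<in> carrier R \<Longrightarrow> a \<otimes> x \<in> I"
    using assms(1,4) m_comm by (metis subsetD)
qed

lemma PIdl_iff: "z \<in> PIdl u \<longleftrightarrow> (\<exists>r\<in>carrier R. z = r \<otimes> u)"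
  by (auto simp: cgenideal_def)

text \<open>The ideal I + E u. Chains of ideals from (I : u) up to R are transported along E \<open>\<mapsto>\<close> I + E u to
  chains from I up to I + (u).\<close>
definition scaled_sum :: "'a set \<Rightarrow> 'a set \<Rightarrow> 'a \<Rightarrow> 'a set"
  where "scaled_sum I E u = {i \<oplus> e \<otimes> u | i e. i \<in> I \<and> e \<in> E}"

lemma scaled_sumE:
  assumes "z \<in> scaled_sum I E u"
  obtains i e where "i \<in> I" "e \<in> E" "z = i \<oplus> e \<otimes> u"
  using assms by (auto simp: scaled_sum_def)

lemma scaled_sumI: "i \<in> I \<Longrightarrow> e \<in> E \<Longrightarrow> i \<oplus> e \<otimes> u \<in> scaled_sum I E u"
  by (auto simp: scaled_sum_def)

lemma scaled_sum_ideal: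
  assumes I: "ideal I R" and E: "ideal E R" and u: "u \<in> carrier R" shows "ideal (scaled_sum I E u) R"
proof (rule ring_idealI)
  note cI = idl_carr[OF I] and cE = idl_carr[OF E]
  show "scaled_sum I E u \<subseteq> carrier R" using u cI cE by (auto simp: scaled_sum_def)
  show "\<zero> \<in> scaled_sum I E u" using scaled_sumI[of \<zero> I \<zero> E u] u I E by (simp add: idl_zero)
  fix x assume "x \<in> scaled_sum I E u"
  then obtain i t where x: "i \<in> I" "t \<in> E" "x = i \<oplus> t \<otimes> u" by (rule scaled_sumE)
  { fix y assume "y \<in> scaled_sum I E u"
    then obtain j s where y: "j \<in> I" "s \<in> E" "y = j \<oplus> s \<otimes> u" by (rule scaled_sumE)
    have "x \<oplus> y = (i \<oplus> j) \<oplus> (t \<oplus> s) \<otimes> u" using x y u cI cE by (simp add: l_distr a_ac)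
    thus "x \<oplus> y \<in> scaled_sum I E u" using x y I E by (simp add: scaled_sumI idl_add) }
  fix r assume r: "r \<in> carrier R"
  have "r \<otimes> x = r \<otimes> i \<oplus> (r \<otimes> t) \<otimes> u" using x r u cI cE by (simp add: r_distr m_assoc)
  thus "r \<otimes> x \<in> scaled_sum I E u" using x r I E by (simp add: scaled_sumI idl_lmult)
qed

lemma scaled_sum_sub: "ideal I R \<Longrightarrow> ideal E R \<Longrightarrow> u \<in> carrier R \<Longrightarrow> I \<subseteq> scaled_sum I E u"
  using scaled_sumI[of _ I \<zero> E u] by (auto simp: idl_carr idl_zero)

lemma scaled_sum_mult: "ideal I R \<Longrightarrow> ideal E R \<Longrightarrow> u \<in> carrier R \<Longrightarrow> e \<in> E \<Longrightarrow> e \<otimes> u \<in> scaled_sum I E u"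
  using scaled_sumI[of \<zero> I e E u] by (auto simp: idl_carr idl_zero)

definition adjoin :: "'a set \<Rightarrow> 'a \<Rightarrow> 'a set"
  where "adjoin I u = scaled_sum I (carrier R) u"

lemma adjoinE:
  assumes "z \<in> adjoin I u"
  obtains i r where "i \<in> I" "r \<in> carrier R" "z = i \<oplus> r \<otimes> u"
  using assms unfolding adjoin_def by (rule scaled_sumE)

lemma adjoinI: "i \<in> I \<Longrightarrow> r \<in> carrier R \<Longrightarrow> i \<oplus> r \<otimes> u \<in> adjoin I u"
  by (simp add: adjoin_def scaled_sumI)

lemma adjoin_ideal: "ideal I R \<Longrightarrow> u \<in> carrier R \<Longrightarrow> ideal (adjoin I u) R"
  by (simp add: adjoin_def scaled_sum_ideal oneideal)

lemma adjoin_sub: "ideal I R \<Longrightarrow> u \<in> carrier R \<Longrightarrow> I \<subseteq> adjoin I u"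
  using adjoinI[of _ I \<zero> u] by (auto simp: idl_carr)

lemma adjoin_self: "ideal I R \<Longrightarrow> u \<in> carrier R \<Longrightarrow> u \<in> adjoin I u"
  using adjoinI[of \<zero> I \<one> u] by (auto simp: idl_zero)

lemma adjoin_mult: "ideal I R \<Longrightarrow> u \<in> carrier R \<Longrightarrow> r \<in> carrier R \<Longrightarrow> r \<otimes> u \<in> adjoin I u"
  by (simp add: adjoin_ideal adjoin_self idl_lmult)

lemma adjoin_least: "ideal K R \<Longrightarrow> I \<subseteq> K \<Longrightarrow> u \<in> K \<Longrightarrow> adjoin I u \<subseteq> K"
  by (auto elim!: adjoinE intro!: idl_add idl_lmult)

lemma scaled_sum_sub_adjoin: "ideal E R \<Longrightarrow> scaled_sum I E u \<subseteq> adjoin I u"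
  by (auto simp: adjoin_def scaled_sum_def intro: idl_carr)

lemma adjoin_absorb: "ideal I R \<Longrightarrow> u \<in> I \<Longrightarrow> adjoin I u = I"
  by (intro equalityI adjoin_least adjoin_sub) (auto intro: idl_carr)

lemma adjoin_mono: "I \<subseteq> K \<Longrightarrow> adjoin I u \<subseteq> adjoin K u"
  by (auto simp: adjoin_def scaled_sum_def)

lemma adjoin_commute:
  assumes "ideal I R" "u \<in> carrier R" "v \<in> carrier R"
  shows "adjoin (adjoin I u) v = adjoin (adjoin I v) u"
proof -
  have "adjoin (adjoin I u) v \<subseteq> adjoin (adjoin I v) u" if "u \<in> carrier R" "v \<in> carrier R" for u v
    using that assms(1) adjoin_sub[of "adjoin I v" u] adjoin_sub[of I v] adjoin_self[of I v] adjoin_self[of "adjoin I v" u]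
    by (intro adjoin_least) (auto simp: adjoin_ideal)
  thus ?thesis using assms by blast
qed

lemma scaled_sum_adjoin:
  assumes "ideal I R" "ideal E R" "u \<in> carrier R" "w \<in> carrier R"
  shows "scaled_sum I (adjoin E w) u = adjoin (scaled_sum I E u) (w \<otimes> u)"
proof -
  have e: "i \<oplus> (e \<oplus> r \<otimes> w) \<otimes> u = (i \<oplus> e \<otimes> u) \<oplus> r \<otimes> (w \<otimes> u)"
    if "i \<in> I" "e \<in> E" "r \<in> carrier R" for i e r
    using that assms idl_carr[OF assms(1)] idl_carr[OF assms(2)] by (simp add: l_distr m_assoc a_assoc)
  show ?thesis
  proof
    show "scaled_sum I (adjoin E w) u \<subseteq> adjoin (scaled_sum I E u) (w \<otimes> u)"
      by (auto elim!: scaled_sumE adjoinE simp: e intro!: adjoinI scaled_sumI)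
    show "adjoin (scaled_sum I E u) (w \<otimes> u) \<subseteq> scaled_sum I (adjoin E w) u"
      by (auto elim!: scaled_sumE adjoinE simp: e[symmetric] intro!: adjoinI scaled_sumI)
  qed
qed

lemma scaled_sum_absorb:
  assumes "ideal I R" "ideal E R" "u \<in> carrier R" "\<And>e. e \<in> E \<Longrightarrow> e \<otimes> u \<in> I" shows "scaled_sum I E u = I"
  using scaled_sum_sub[OF assms(1-3)] assms by (auto elim!: scaled_sumE intro: idl_add)

lemma Idl_insert:
  assumes "G \<subseteq> carrier R" "u \<in> carrier R" shows "Idl (insert u G) = adjoin (Idl G) u"
proof
  have i: "ideal (Idl G) R" using assms by (simp add: genideal_ideal)
  show "Idl (insert u G) \<subseteq> adjoin (Idl G) u"
    using i assms genideal_self[of G] adjoin_sub[OF i]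
    by (intro genideal_minimal) (auto simp: adjoin_ideal adjoin_self)
  show "adjoin (Idl G) u \<subseteq> Idl (insert u G)"
    using assms genideal_self[of "insert u G"]
    by (intro adjoin_least genideal_ideal subset_Idl_subset) auto
qed

lemma Idl_ideal: "ideal I R \<Longrightarrow> Idl I = I"
  by (intro equalityI genideal_minimal genideal_self) (auto intro: idl_carr)

lemma Idl_empty: "Idl {} = {\<zero>}"
  by (intro equalityI genideal_minimal zeroideal) (auto intro!: idl_zero genideal_ideal)

lemma set_add_absorb: "ideal A R \<Longrightarrow> ideal B R \<Longrightarrow> A \<subseteq> B \<Longrightarrow> A <+>\<^bsub>R\<^esub> B = B \<and> B <+>\<^bsub>R\<^esub> A = B"
  by (metis union_genideal Un_absorb1 Un_absorb2 Idl_ideal)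

lemma colon_ideal:
  assumes "ideal I R" "u \<in> carrier R" shows "ideal (colon R I u) R"
  by (rule ring_idealI)
    (use assms in \<open>auto simp: colon_def l_distr m_assoc idl_add idl_zero idl_lmult\<close>)

lemma colonI: "r \<in> carrier R \<Longrightarrow> r \<otimes> u \<in> I \<Longrightarrow> r \<in> colon R I u" by (simp add: colon_def)

lemma colonD: "r \<in> colon R I u \<Longrightarrow> r \<otimes> u \<in> I" by (simp add: colon_def)

lemma colon_sup: "ideal I R \<Longrightarrow> u \<in> carrier R \<Longrightarrow> I \<subseteq> colon R I u"
  by (auto simp: colon_def idl_rmult idl_carr)

lemma colon_scaled_sum_notin:
  assumes "ideal I R" "ideal E R" "u \<in> carrier R" "colon R I u \<subseteq> E" "w \<in> carrier R" "w \<notin> E"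
  shows "w \<otimes> u \<notin> scaled_sum I E u"
proof
  assume "w \<otimes> u \<in> scaled_sum I E u"
  then obtain i e where ie: "i \<in> I" "e \<in> E" "w \<otimes> u = i \<oplus> e \<otimes> u" by (rule scaled_sumE)
  have c: "i \<in> carrier R" "e \<in> carrier R" using ie idl_carr assms by blast+
  have "(w \<ominus> e) \<otimes> u = w \<otimes> u \<ominus> e \<otimes> u" using c assms by (simp add: a_minus_def l_distr l_minus)
  also have "\<dots> = i" using c assms ie by (simp add: a_minus_def a_assoc r_neg)
  finally have "w \<ominus> e \<in> colon R I u" using c assms ie by (simp add: colon_def)
  hence "w \<oplus> \<ominus> e \<in> E" using assms by (auto simp: a_minus_def)
  hence "w \<in> E" using idl_addD[OF assms(2)] ie assms idl_neg[OF assms(2)] by blast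
  thus False using assms by simp
qed

lemma Idl_mult_in:
  assumes "G \<subseteq> carrier R" "ideal Y R" "t \<in> carrier R" "\<And>g. g \<in> G \<Longrightarrow> g \<otimes> t \<in> Y" "r \<in> Idl G"
  shows "r \<otimes> t \<in> Y"
proof -
  have "Idl G \<subseteq> colon R Y t" using assms by (intro genideal_minimal colon_ideal) (auto intro: colonI)
  thus ?thesis using assms(5) colonD by blast
qed

lemma primeideal_ideal: "primeideal P R \<Longrightarrow> ideal P R"
  by (simp add: primeideal_def)

lemma prime_one: "primeideal P R \<Longrightarrow> \<one> \<notin> P"
  using ideal.one_imp_carrier[of P R] primeideal.I_notcarr[of P R] primeideal_ideal by blast

lemma prime_cancel:
  "primeideal P R \<Longrightarrow> x \<in> carrier R \<Longrightarrow> x \<notin> P \<Longrightarrow> r \<in> carrier R \<Longrightarrow> r \<otimes> x \<in> P \<Longrightarrow> r \<in> P"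
  using primeideal.I_prime[of P R r x] by blast

lemma prime_pow:
  assumes "primeideal Q R" "x \<in> carrier R" "x [^] (k::nat) \<in> Q" shows "x \<in> Q"
  using assms(3)
proof (induction k)
  case 0
  thus ?case using ideal.one_imp_carrier[of Q R] primeideal.I_notcarr[OF assms(1)] assms(1)
    by (auto simp: primeideal_def)
next
  case (Suc k)
  thus ?case using primeideal.I_prime[OF assms(1), of "x [^] k" x] assms(2) by auto
qed

text \<open>Additivity of the q-th power passes to localizations at once, so as a hypothesis it is more
  convenient than the characteristic; 0 < q makes ideals stable under q-th powers.\<close>
definition frob_exp :: "nat \<Rightarrow> bool"
  where "frob_exp q \<longleftrightarrow> 0 < q \<and>
    (\<forall>x\<in>carrier R. \<forall>y\<in>carrier R. (x \<oplus> y) [^] q = x [^] q \<oplus> y [^] q)"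

lemma frob_exp_mult: "frob_exp q \<Longrightarrow> frob_exp r \<Longrightarrow> frob_exp (q * r)"
  by (simp add: frob_exp_def nat_pow_pow[symmetric])

lemma frob_exp_one: "frob_exp 1"
  by (simp add: frob_exp_def)

lemma frob_exp_power: "frob_exp q \<Longrightarrow> frob_exp (q ^ n)"
  by (induction n) (auto simp: frob_exp_mult frob_exp_one[simplified])

lemma frob_exp_pos: "frob_exp q \<Longrightarrow> 0 < q" by (simp add: frob_exp_def)

lemma frob_exp_add:
  "frob_exp q \<Longrightarrow> x \<in> carrier R \<Longrightarrow> y \<in> carrier R \<Longrightarrow> (x \<oplus> y) [^] q = x [^] q \<oplus> y [^] q"
  by (simp add: frob_exp_def)

lemma binomial:
  assumes x: "x \<in> carrier R" and y: "y \<in> carrier R"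
  shows "(x \<oplus> y) [^] n = (\<Oplus>k\<in>{..n}. add_pow R (n choose k) (x [^] k \<otimes> y [^] (n - k)))"
proof (induction n)
  case 0
  thus ?case by simp
next
  case (Suc n)
  define f where "f k = add_pow R (n choose k) (x [^] k \<otimes> y [^] (Suc n - k))" for k
  define g where "g k = add_pow R (n choose k) (x [^] Suc k \<otimes> y [^] (n - k))" for k
  have fc: "f k \<in> carrier R" and gc: "g k \<in> carrier R" for k using x y by (auto simp: f_def g_def)
  let ?S = "\<lambda>k. add_pow R (n choose k) (x [^] k \<otimes> y [^] (n - k))"
  have Sc: "?S \<in> {..n} \<rightarrow> carrier R" using x y by auto
  have yS: "(\<Oplus>k\<in>{..n}. ?S k) \<otimes> y = (\<Oplus>k\<in>{..n}. f k)"
  proof -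
    have "?S k \<otimes> y = f k" if "k \<le> n" for k
      using that x y by (simp add: f_def add_pow_ldistr m_assoc Suc_diff_le)
    hence "(\<Oplus>k\<in>{..n}. ?S k \<otimes> y) = (\<Oplus>k\<in>{..n}. f k)" using fc by (intro finsum_cong') auto
    thus ?thesis using finsum_ldistr[OF _ y Sc] by simp
  qed
  have xS: "(\<Oplus>k\<in>{..n}. ?S k) \<otimes> x = (\<Oplus>k\<in>{..n}. g k)"
  proof -
    have "?S k \<otimes> x = g k" for k
      using x y by (simp add: g_def add_pow_ldistr add_pow_rdistr m_ac)
    thus ?thesis using finsum_ldistr[OF _ x Sc] by simp
  qed
  have "(x \<oplus> y) [^] Suc n = (\<Oplus>k\<in>{..n}. g k) \<oplus> (\<Oplus>k\<in>{..n}. f k)"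
    using Suc xS yS x y Sc by (simp add: r_distr)
  also have "(\<Oplus>k\<in>{..n}. f k) = (\<Oplus>k\<in>{..Suc n}. f k)"
    using finsum_Suc[of f n] fc x y by (simp add: f_def Pi_def binomial_eq_0)
  also have "\<dots> = (\<Oplus>k\<in>{..n}. f (Suc k)) \<oplus> f 0"
    using finsum_Suc2[of f n] fc by (simp add: Pi_def)
  also have "(\<Oplus>k\<in>{..n}. g k) \<oplus> ((\<Oplus>k\<in>{..n}. f (Suc k)) \<oplus> f 0)
      = (\<Oplus>k\<in>{..n}. g k \<oplus> f (Suc k)) \<oplus> f 0"
    using fc gc finsum_addf[of g "{..n}" "\<lambda>k. f (Suc k)"] by (simp add: a_assoc Pi_def)
  also have "(\<Oplus>k\<in>{..n}. g k \<oplus> f (Suc k)) = (\<Oplus>k\<in>{..n}. add_pow R (Suc n choose Suc k) (x [^] Suc k \<otimes> y [^] (Suc n - Suc k)))"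
    using x y by (intro finsum_cong') (auto simp: f_def g_def add.nat_pow_mult)
  also have "f 0 = add_pow R (Suc n choose 0) (x [^] (0::nat) \<otimes> y [^] (Suc n - 0))" by (simp add: f_def)
  also have "(\<Oplus>k\<in>{..n}. add_pow R (Suc n choose Suc k) (x [^] Suc k \<otimes> y [^] (Suc n - Suc k)))
       \<oplus> add_pow R (Suc n choose 0) (x [^] (0::nat) \<otimes> y [^] (Suc n - 0))
     = (\<Oplus>k\<in>{..Suc n}. add_pow R (Suc n choose k) (x [^] k \<otimes> y [^] (Suc n - k)))"
    using finsum_Suc2[of "\<lambda>k. add_pow R (Suc n choose k) (x [^] k \<otimes> y [^] (Suc n - k))" n] x y
    by (simp add: Pi_def del: binomial_Suc_Suc nat_pow_Suc)
  finally show ?case .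
qed

lemma char_frob_exp:
  assumes p: "Factorial_Ring.prime p" and c: "ring_char R = p" shows "frob_exp p"
  unfolding frob_exp_def
proof (intro conjI ballI)
  show "0 < p" using p prime_gt_0_nat by simp
  fix x y assume x: "x \<in> carrier R" and y: "y \<in> carrier R"
  have one: "add_pow R (p) \<one> = \<zero>"
    using group.pow_ord_eq_1[OF a_group, of \<one>] c by (simp add: ring_char_def add_pow_def)
  have pz: "add_pow R (p) z = \<zero>" if "z \<in> carrier R" for z
    using add_pow_ldistr[OF one_closed that, of p] one that by simp
  define f where "f k = add_pow R (p choose k) (x [^] k \<otimes> y [^] (p - k))" for k
  have fc: "f k \<in> carrier R" for k using x y by (simp add: f_def)
  have f0: "f k = \<zero>" if "0 < k" "k < p" for k
  proof -
    have "p dvd p choose k" by (rule dvd_choose_prime) (use p that in auto)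
    then obtain m where "p choose k = p * m" by (auto simp: dvd_def)
    thus ?thesis unfolding f_def using x y pz
      by (simp add: add.nat_pow_pow[symmetric])
  qed
  obtain m where m: "p = Suc m" using p prime_gt_0_nat gr0_implies_Suc by blast
  have "(x \<oplus> y) [^] p = (\<Oplus>k\<in>{..p}. f k)" unfolding f_def by (rule binomial[OF x y])
  also have "\<dots> = f p \<oplus> (\<Oplus>k\<in>{..m}. f k)" using finsum_Suc[of f m] fc m by (simp add: Pi_def)
  also have "(\<Oplus>k\<in>{..m}. f k) = (\<Oplus>k\<in>{..m}. if 0 = k then f k else \<zero>)"
    using f0 m fc by (intro finsum_cong') auto
  also have "\<dots> = f 0" using add.finprod_singleton[of 0 "{..m}" f] fc by (simp add: Pi_def)
  also have "f p \<oplus> f 0 = x [^] p \<oplus> y [^] p" using x y by (simp add: f_def)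
  finally show "(x \<oplus> y) [^] p = x [^] p \<oplus> y [^] p" .
qed

text \<open>This is why bracket powers may be computed on generators.\<close>
lemma frob_vimage_ideal:
  assumes "ideal Y R" "frob_exp q" shows "ideal {r \<in> carrier R. r [^] q \<in> Y} R"
  by (rule ring_idealI)
    (use assms in \<open>auto simp: frob_exp_add nat_pow_distrib idl_add idl_zero idl_lmult nat_pow_zero frob_exp_pos\<close>)

text \<open>The ideal J + I^{[q]}, that is, the bracket power of the image of I in R/J. Keeping it as an ideal
  of R allows inductions that enlarge J without changing the ring.\<close>
definition rbracket :: "'a set \<Rightarrow> nat \<Rightarrow> 'a set \<Rightarrow> 'a set"
  where "rbracket J q I = Idl (J \<union> (\<lambda>x. x [^] q) ` I)"

lemma rbracket_ideal: "J \<subseteq> carrier R \<Longrightarrow> I \<subseteq> carrier R \<Longrightarrow> ideal (rbracket J q I) R"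
  unfolding rbracket_def by (rule genideal_ideal) auto

lemma rbracket_base: "J \<subseteq> carrier R \<Longrightarrow> I \<subseteq> carrier R \<Longrightarrow> J \<subseteq> rbracket J q I"
  unfolding rbracket_def by (rule order.trans[OF _ genideal_self]) auto

lemma rbracket_pow: "J \<subseteq> carrier R \<Longrightarrow> I \<subseteq> carrier R \<Longrightarrow> x \<in> I \<Longrightarrow> x [^] q \<in> rbracket J q I"
  unfolding rbracket_def by (rule subsetD[OF genideal_self]) auto

lemma rbracket_least: "ideal K R \<Longrightarrow> J \<subseteq> K \<Longrightarrow> (\<And>x. x \<in> I \<Longrightarrow> x [^] q \<in> K) \<Longrightarrow> rbracket J q I \<subseteq> K"
  unfolding rbracket_def by (rule genideal_minimal) auto

lemma rbracket_mono: "J \<subseteq> carrier R \<Longrightarrow> I' \<subseteq> carrier R \<Longrightarrow> I \<subseteq> I' \<Longrightarrow> rbracket J q I \<subseteq> rbracket J q I'"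
  unfolding rbracket_def by (rule subset_Idl_subset) auto

lemma rbracket_zero: assumes "ideal I R" shows "rbracket {\<zero>} q I = bracket_power R I q"
proof -
  have i: "(\<lambda>x. x [^] q) ` I \<subseteq> carrier R" using idl_carr[OF assms] by auto
  show ?thesis unfolding rbracket_def bracket_power_def
    using i genideal_self[OF i] idl_zero[OF genideal_ideal[OF i]]
    by (intro equalityI genideal_minimal genideal_ideal) (auto intro: genideal_self[THEN subsetD])
qed

lemma rbracket_Idl:
  assumes "J \<subseteq> carrier R" "G \<subseteq> carrier R" "frob_exp q"
  shows "rbracket J q (Idl G) = Idl (J \<union> (\<lambda>x. x [^] q) ` G)" (is "_ = Idl ?H")
proof
  have H: "?H \<subseteq> carrier R" using assms by auto
  have "Idl G \<subseteq> {r \<in> carrier R. r [^] q \<in> Idl ?H}"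
    using H assms genideal_self[OF H] by (intro genideal_minimal frob_vimage_ideal genideal_ideal) auto
  thus "rbracket J q (Idl G) \<subseteq> Idl ?H"
    using genideal_self[OF H] H by (intro rbracket_least genideal_ideal) auto
  show "Idl ?H \<subseteq> rbracket J q (Idl G)"
    unfolding rbracket_def using assms genideal_self[of G] genideal_ideal[of G]
    by (intro subset_Idl_subset) (auto intro: idl_carr)
qed

lemma rbracket_adjoin:
  assumes "J \<subseteq> carrier R" "ideal I R" "u \<in> carrier R" "frob_exp q"
  shows "rbracket J q (adjoin I u) = adjoin (rbracket J q I) (u [^] q)"
proof -
  have I: "I \<subseteq> carrier R" using assms idl_carr by auto
  have "adjoin I u = Idl (insert u I)" using Idl_insert[OF I assms(3)] by (simp add: Idl_ideal assms)
  hence "rbracket J q (adjoin I u) = Idl (insert (u [^] q) (J \<union> (\<lambda>x. x [^] q) ` I))"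
    using rbracket_Idl[of J "insert u I" q] assms I by simp
  also have "\<dots> = adjoin (rbracket J q I) (u [^] q)"
    unfolding rbracket_def using assms I by (intro Idl_insert) auto
  finally show ?thesis .
qed

lemma rbracket_brk:
  assumes "ideal J R" "I \<subseteq> carrier R" "frob_exp q"
  shows "rbracket J q (rbracket J r I) = rbracket J (r * q) I"
proof -
  note J = idl_sub[OF assms(1)]
  have "rbracket J q (rbracket J r I) = Idl (J \<union> (\<lambda>x. x [^] q) ` (J \<union> (\<lambda>x. x [^] r) ` I))"
    unfolding rbracket_def[of J r I] using J assms by (intro rbracket_Idl) auto
  also have "\<dots> = rbracket J (r * q) I" unfolding rbracket_def
  proof -
    have "J \<union> (\<lambda>x. x [^] q) ` (J \<union> (\<lambda>x. x [^] r) ` I) = J \<union> (\<lambda>x. x [^] (r * q)) ` I"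
    proof -
      have "(\<lambda>x. x [^] q) ` J \<subseteq> J" using assms(1,3) by (auto intro: idl_pow frob_exp_pos)
      moreover have "(\<lambda>x. x [^] q) ` (\<lambda>x. x [^] r) ` I = (\<lambda>x. x [^] (r * q)) ` I"
        unfolding image_image using assms(2) by (intro image_cong) (auto simp: nat_pow_pow)
      ultimately show ?thesis by (auto simp: image_Un)
    qed
    thus "Idl (J \<union> (\<lambda>x. x [^] q) ` (J \<union> (\<lambda>x. x [^] r) ` I)) = Idl (J \<union> (\<lambda>x. x [^] (r * q)) ` I)" by simp
  qed
  finally show ?thesis .
qed

lemma rbracket_mult_in:
  assumes "J \<subseteq> carrier R" "E \<subseteq> carrier R" "ideal Y R" "J \<subseteq> Y" "t \<in> carrier R"
    "\<And>x. x \<in> E \<Longrightarrow> x [^] q \<otimes> t \<in> Y" "r \<in> rbracket J q E"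
  shows "r \<otimes> t \<in> Y"
proof (rule Idl_mult_in[OF _ assms(3,5)])
  show "r \<in> Idl (J \<union> (\<lambda>x. x [^] q) ` E)" using assms(7) by (simp add: rbracket_def)
qed (use assms in \<open>auto intro: idl_rmult\<close>)

lemma rbracket_colon_sub:
  assumes "J \<subseteq> carrier R" "ideal I R" "u \<in> carrier R"
  shows "rbracket J q (colon R I u) \<subseteq> colon R (rbracket J q I) (u [^] q)"
proof
  fix r assume r: "r \<in> rbracket J q (colon R I u)"
  note I = idl_sub[OF assms(2)]
  have c: "colon R I u \<subseteq> carrier R" by (auto simp: colon_def)
  have "r \<otimes> u [^] q \<in> rbracket J q I"
  proof (rule rbracket_mult_in[OF assms(1) c _ _ _ _ r])
    fix x assume "x \<in> colon R I u"
    thus "x [^] q \<otimes> u [^] q \<in> rbracket J q I"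
      using rbracket_pow[OF assms(1) I, of "x \<otimes> u" q] assms by (simp add: colon_def nat_pow_distrib)
  qed (use assms I in \<open>auto intro: rbracket_ideal subsetD[OF rbracket_base]\<close>)
  moreover have "r \<in> carrier R" using r idl_carr[OF rbracket_ideal[OF assms(1) c]] by blast
  ultimately show "r \<in> colon R (rbracket J q I) (u [^] q)" by (simp add: colon_def)
qed

lemma rbracket_carrier: "J \<subseteq> carrier R \<Longrightarrow> rbracket J q (carrier R) = carrier R"
  using rbracket_pow[of J "carrier R" "\<one>" q] rbracket_ideal[of J "carrier R" q]
  by (auto intro!: ideal.one_imp_carrier)

lemma bracket_ideal: "ideal I R \<Longrightarrow> ideal (bracket_power R I q) R"
  by (metis rbracket_ideal rbracket_zero empty_subsetI idl_sub insert_subset zero_closed)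

lemma bracket_mono: "ideal K R \<Longrightarrow> I \<subseteq> K \<Longrightarrow> bracket_power R I q \<subseteq> bracket_power R K q"
  unfolding bracket_power_def by (rule subset_Idl_subset) (use idl_carr in auto)

lemma bracket_pow: "ideal I R \<Longrightarrow> x \<in> I \<Longrightarrow> x [^] q \<in> bracket_power R I q"
  unfolding bracket_power_def by (rule subsetD[OF genideal_self]) (use idl_carr in auto)

lemma bracket_least: "ideal K R \<Longrightarrow> (\<And>x. x \<in> I \<Longrightarrow> x [^] q \<in> K) \<Longrightarrow> bracket_power R I q \<subseteq> K"
  unfolding bracket_power_def by (rule genideal_minimal) auto

lemma bracket_mult_in:
  assumes "ideal E R" "ideal Y R" "t \<in> carrier R" "\<And>x. x \<in> E \<Longrightarrow> x [^] q \<otimes> t \<in> Y" "r \<in> bracket_power R E q"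
  shows "r \<otimes> t \<in> Y"
  using Idl_mult_in[of "(\<lambda>x. x [^] q) ` E" Y t r] assms idl_carr[OF assms(1)]
  by (auto simp: bracket_power_def)

lemma bracket_adjoin:
  "ideal I R \<Longrightarrow> u \<in> carrier R \<Longrightarrow> frob_exp q \<Longrightarrow>
    bracket_power R (adjoin I u) q = adjoin (bracket_power R I q) (u [^] q)"
  using rbracket_adjoin[of "{\<zero>}" I u q] by (simp add: rbracket_zero adjoin_ideal)

lemma bracket_PIdl:
  assumes "x \<in> carrier R" shows "bracket_power R (PIdl x) q = PIdl (x [^] q)"
proof
  have "(r \<otimes> x) [^] q \<in> PIdl (x [^] q)" if "r \<in> carrier R" for r
    using assms that by (auto simp: nat_pow_distrib PIdl_iff)
  thus "bracket_power R (PIdl x) q \<subseteq> PIdl (x [^] q)"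
    using assms by (intro bracket_least cgenideal_ideal) (auto simp: PIdl_iff)
  show "PIdl (x [^] q) \<subseteq> bracket_power R (PIdl x) q"
    using assms by (intro cgenideal_minimal bracket_ideal bracket_pow cgenideal_ideal cgenideal_self)
qed

lemma bracket_bracket:
  "ideal I R \<Longrightarrow> frob_exp q \<Longrightarrow> bracket_power R (bracket_power R I r) q = bracket_power R I (r * q)"
  using rbracket_brk[OF zeroideal idl_sub, of I q r] by (simp add: rbracket_zero bracket_ideal)

definition top_monomial :: "nat \<Rightarrow> 'a set \<Rightarrow> 'a"
  where "top_monomial q A = finprod R (\<lambda>x. x [^] (q - 1)) A"

lemma top_monomial_closed: "A \<subseteq> carrier R \<Longrightarrow> top_monomial q A \<in> carrier R"
  unfolding top_monomial_def by (rule finprod_closed) auto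

lemma top_monomial_empty: "top_monomial q {} = \<one>" by (simp add: top_monomial_def)

lemma top_monomial_insert:
  "finite A \<Longrightarrow> x \<notin> A \<Longrightarrow> x \<in> carrier R \<Longrightarrow> A \<subseteq> carrier R \<Longrightarrow>
    top_monomial q (insert x A) = x [^] (q - 1) \<otimes> top_monomial q A"
  unfolding top_monomial_def by (subst finprod_insert) auto

lemma top_monomial_Un:
  "finite A \<Longrightarrow> finite B \<Longrightarrow> A \<inter> B = {} \<Longrightarrow> A \<subseteq> carrier R \<Longrightarrow> B \<subseteq> carrier R \<Longrightarrow>
    top_monomial q (A \<union> B) = top_monomial q A \<otimes> top_monomial q B"
  unfolding top_monomial_def by (rule finprod_Un_disjoint) auto

text \<open>Multiplication by the monomial turns each generator d in D into a multiple of d^q.\<close>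
lemma top_monomial_mult:
  assumes "finite D" "D \<subseteq> carrier R" "G \<subseteq> carrier R" "0 < q" "t \<in> Idl (G \<union> D)"
  shows "t \<otimes> top_monomial q D \<in> Idl (G \<union> (\<lambda>x. x [^] q) ` D)"
proof (rule Idl_mult_in[OF _ _ top_monomial_closed[OF assms(2)] _ assms(5)])
  have H: "G \<union> (\<lambda>x. x [^] q) ` D \<subseteq> carrier R" using assms by auto
  show id: "ideal (Idl (G \<union> (\<lambda>x. x [^] q) ` D)) R" by (rule genideal_ideal[OF H])
  fix g assume "g \<in> G \<union> D"
  thus "g \<otimes> top_monomial q D \<in> Idl (G \<union> (\<lambda>x. x [^] q) ` D)"
  proof
    assume "g \<in> G" thus ?thesis using genideal_self[OF H] id top_monomial_closed[OF assms(2)] by (auto intro: idl_rmult)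
  next
    assume g: "g \<in> D"
    hence "D = insert g (D - {g})" by auto
    hence "top_monomial q D = g [^] (q - 1) \<otimes> top_monomial q (D - {g})"
      using top_monomial_insert[of "D - {g}" g q] assms g by auto
    moreover have gc: "g \<in> carrier R" and tc: "top_monomial q (D - {g}) \<in> carrier R"
      using g assms top_monomial_closed[of "D - {g}" q] by auto
    moreover have "g [^] q = g \<otimes> g [^] (q - 1)" using nat_pow_Suc2[OF gc, of "q - 1"] assms by simp
    ultimately have "g \<otimes> top_monomial q D = g [^] q \<otimes> top_monomial q (D - {g})" by (simp add: m_assoc)
    also have "\<dots> \<in> Idl (G \<union> (\<lambda>x. x [^] q) ` D)"
      using g genideal_self[OF H] id tc by (auto intro!: idl_rmult)
    finally show ?thesis .
  qed
qed (use assms in auto)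

definition regular_mod :: "'a set \<Rightarrow> 'a \<Rightarrow> bool"
  where "regular_mod J x \<longleftrightarrow> (\<forall>r\<in>carrier R. r \<otimes> x \<in> J \<longrightarrow> r \<in> J)"

lemma regular_mod_power:
  assumes "x \<in> carrier R" "regular_mod J x" "r \<in> carrier R" "r \<otimes> x [^] (n::nat) \<in> J" shows "r \<in> J"
  using assms(4)
proof (induction n)
  case (Suc n)
  hence "(r \<otimes> x [^] n) \<otimes> x \<in> J" using assms by (simp add: m_assoc)
  hence "r \<otimes> x [^] n \<in> J" using assms unfolding regular_mod_def by blast
  thus ?case by (rule Suc.IH)
qed (use assms in simp)

text \<open>If y, x is a regular sequence modulo J, so is y^a, x: from r x in J + (y^{a+1}), induction gives
  r = j + s y^a, and cancelling y^a leaves s x in J + (y), hence s in J + (y).\<close>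
lemma regular_mod_adjoin_power:
  assumes J: "ideal J R" and x: "x \<in> carrier R" and y: "y \<in> carrier R"
    and ny: "regular_mod J y" and nx: "regular_mod (adjoin J y) x"
  shows "regular_mod (adjoin J (y [^] (a::nat))) x"
proof (induction a)
  case 0
  have "\<one> \<in> adjoin J (y [^] (0::nat))" using adjoin_self[OF J one_closed] by simp
  hence "adjoin J (y [^] (0::nat)) = carrier R"
    using ideal.one_imp_carrier[OF adjoin_ideal[OF J nat_pow_closed[OF y]]] by blast
  thus ?case by (simp add: regular_mod_def)
next
  case (Suc a)
  show ?case unfolding regular_mod_def
  proof (intro ballI impI)
    let ?y = "y [^] a"
    note Jc = idl_carr[OF J]
    fix r assume r: "r \<in> carrier R" "r \<otimes> x \<in> adjoin J (y [^] Suc a)"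
    have yc: "?y \<in> carrier R" "y [^] Suc a = y \<otimes> ?y" using y nat_pow_Suc2[OF y, of a] by (simp_all del: nat_pow_Suc)
    have "adjoin J (y [^] Suc a) \<subseteq> adjoin J ?y"
      unfolding yc(2) using yc(1) y J by (intro adjoin_least) (auto intro: adjoin_ideal adjoin_sub[THEN subsetD] adjoin_mult)
    hence "r \<in> adjoin J ?y" using Suc r by (auto simp: regular_mod_def)
    then obtain j s where js: "j \<in> J" "s \<in> carrier R" "r = j \<oplus> s \<otimes> ?y" by (rule adjoinE)
    obtain i v where iv: "i \<in> J" "v \<in> carrier R" "r \<otimes> x = i \<oplus> v \<otimes> y [^] Suc a" using r(2) by (rule adjoinE)
    have c: "j \<in> carrier R" "i \<in> carrier R" using js iv Jc by auto
    have e1: "r \<otimes> x = j \<otimes> x \<oplus> (s \<otimes> x) \<otimes> ?y"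
      unfolding js(3) using js(2) c x yc(1) m_comm[of x ?y] by (simp add: l_distr m_assoc)
    have "(s \<otimes> x \<ominus> v \<otimes> y) \<otimes> ?y = (s \<otimes> x) \<otimes> ?y \<ominus> v \<otimes> y [^] Suc a"
      unfolding yc(2) using js(2) iv(2) x y yc(1) by (simp add: a_minus_def l_distr l_minus m_assoc)
    also have "(s \<otimes> x) \<otimes> ?y = r \<otimes> x \<ominus> j \<otimes> x"
      unfolding e1 using js(2) c x yc(1) add_diff_cancel[of "j \<otimes> x" "(s \<otimes> x) \<otimes> ?y"] by simp
    also have "r \<otimes> x \<ominus> j \<otimes> x \<ominus> v \<otimes> y [^] Suc a = i \<ominus> j \<otimes> x"
    proof -
      have "(a \<oplus> b) \<ominus> d \<ominus> b = a \<ominus> d" if "a \<in> carrier R" "b \<in> carrier R" "d \<in> carrier R" for a b d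
        using that add_diff_cancel[of b "a \<ominus> d"] by (simp add: a_minus_def a_ac)
      from this[of i "v \<otimes> y [^] Suc a" "j \<otimes> x"] show ?thesis
        unfolding iv(3) using iv(2) c x y by simp
    qed
    also have "\<dots> \<in> J" using iv js x J by (simp add: idl_diff idl_rmult)
    finally have "s \<otimes> x \<ominus> v \<otimes> y \<in> J"
      using regular_mod_power[OF y ny, of "s \<otimes> x \<ominus> v \<otimes> y" a] js iv x y by simp
    hence "(s \<otimes> x \<ominus> v \<otimes> y) \<oplus> v \<otimes> y \<in> adjoin J y" using iv by (intro adjoinI)
    hence "s \<otimes> x \<in> adjoin J y" using js(2) iv(2) x y by (simp add: a_minus_def a_assoc l_neg)
    hence "s \<in> adjoin J y" using nx js by (auto simp: regular_mod_def)
    then obtain k w where kw: "k \<in> J" "w \<in> carrier R" "s = k \<oplus> w \<otimes> y" by (rule adjoinE)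
    have "r = (j \<oplus> k \<otimes> ?y) \<oplus> w \<otimes> y [^] Suc a"
      unfolding js(3) kw(3) yc(2) using kw(1,2) Jc c y yc(1) by (simp add: l_distr m_assoc a_assoc)
    thus "r \<in> adjoin J (y [^] Suc a)" using kw js J yc(1) by (simp del: nat_pow_Suc add: adjoinI idl_add idl_rmult)
  qed
qed

end

section \<open>Noetherian rings and a weak form of the Artin-Rees lemma\<close>

locale noeth_cring = cring R + noetherian_ring R for R (structure)
begin

lemma noeth_max:
  assumes "F \<noteq> {}" "\<And>I. I \<in> F \<Longrightarrow> ideal I R"
  obtains I where "I \<in> F" "\<And>K. K \<in> F \<Longrightarrow> I \<subseteq> K \<Longrightarrow> K = I"
proof -
  have "\<exists>I\<in>F. \<forall>K\<in>F. I \<subseteq> K \<longrightarrow> K = I"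
  proof (rule subset_Zorn_nonempty[OF assms(1)])
    fix C assume C: "C \<noteq> {}" "subset.chain F C"
    hence "subset.chain {I. ideal I R} C" using assms(2) by (auto simp: subset_chain_def)
    hence "\<Union>C \<in> C" using ideal_chain_is_trivial C by blast
    thus "\<Union>C \<in> F" using C(2) by (auto simp: subset_chain_def)
  qed
  thus thesis using that by blast
qed

lemma noeth_induct [consumes 1, case_names ideal]:
  assumes "ideal I R" and step: "\<And>I. ideal I R \<Longrightarrow> (\<And>K. ideal K R \<Longrightarrow> I \<subset> K \<Longrightarrow> P K) \<Longrightarrow> P I"
  shows "P I"
proof (rule ccontr)
  assume "\<not> P I"
  hence ne: "{K. ideal K R \<and> \<not> P K} \<noteq> {}" using assms by auto
  obtain K where "K \<in> {K. ideal K R \<and> \<not> P K}"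
    "\<And>L. L \<in> {K. ideal K R \<and> \<not> P K} \<Longrightarrow> K \<subseteq> L \<Longrightarrow> L = K"
    by (rule noeth_max[OF ne]) auto
  thus False using step[of K] by auto
qed

lemma exists_maximal:
  assumes "ideal I R" "\<one> \<notin> I"
  obtains N where "maximalideal N R" "I \<subseteq> N"
proof -
  let ?F = "{K. ideal K R \<and> I \<subseteq> K \<and> \<one> \<notin> K}"
  have "?F \<noteq> {}" using assms by auto
  then obtain N where N: "N \<in> ?F" "\<And>K. K \<in> ?F \<Longrightarrow> N \<subseteq> K \<Longrightarrow> K = N"
    by (rule noeth_max) auto
  have "maximalideal N R"
  proof (rule maximalidealI)
    show "ideal N R" using N by auto
    show "carrier R \<noteq> N" using N by auto
    fix K assume "ideal K R" "N \<subseteq> K" "K \<subseteq> carrier R"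
    thus "K = N \<or> K = carrier R" using N ideal.one_imp_carrier[of K] by blast
  qed
  thus thesis using that N by auto
qed

text \<open>An ideal that is maximal among those containing I and no power of a is prime.\<close>
lemma exists_prime_avoiding:
  assumes "ideal I R" "a \<in> carrier R" "\<And>n::nat. a [^] n \<notin> I"
  obtains P where "primeideal P R" "I \<subseteq> P" "a \<notin> P"
proof -
  let ?F = "{K. ideal K R \<and> I \<subseteq> K \<and> (\<forall>n::nat. a [^] n \<notin> K)}"
  have "?F \<noteq> {}" using assms by auto
  then obtain P where P: "P \<in> ?F" "\<And>K. K \<in> ?F \<Longrightarrow> P \<subseteq> K \<Longrightarrow> K = P"
    by (rule noeth_max) auto
  have id: "ideal P R" using P by auto
  have hit: "\<exists>n::nat. a [^] n \<in> adjoin P x" if x: "x \<in> carrier R" "x \<notin> P" for x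
  proof (rule ccontr)
    assume "\<not> ?thesis"
    hence "adjoin P x \<in> ?F" using adjoin_ideal[OF id x(1)] adjoin_sub[OF id x(1)] P(1) by auto
    hence "adjoin P x = P" using P(2) adjoin_sub[OF id x(1)] by blast
    thus False using adjoin_self[OF id x(1)] x by simp
  qed
  have "primeideal P R"
  proof (rule primeidealI[OF id is_cring])
    have "a [^] (0::nat) \<notin> P" using P by blast
    thus "carrier R \<noteq> P" by auto
    fix x y assume xy: "x \<in> carrier R" "y \<in> carrier R" "x \<otimes> y \<in> P"
    show "x \<in> P \<or> y \<in> P"
    proof (rule ccontr)
      assume "\<not> ?thesis"
      then obtain n k :: nat where "a [^] n \<in> adjoin P x" "a [^] k \<in> adjoin P y"
        using hit xy by blast
      then obtain i r j s where *: "i \<in> P" "r \<in> carrier R" "a [^] n = i \<oplus> r \<otimes> x"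
         "j \<in> P" "s \<in> carrier R" "a [^] k = j \<oplus> s \<otimes> y" by (meson adjoinE)
      note c = idl_carr[OF id]
      have "a [^] (n + k) = a [^] n \<otimes> a [^] k" using assms by (simp add: nat_pow_mult)
      also have "\<dots> = (j \<oplus> s \<otimes> y) \<otimes> i \<oplus> ((r \<otimes> x) \<otimes> j \<oplus> (r \<otimes> s) \<otimes> (x \<otimes> y))"
        using * c xy by (simp add: l_distr r_distr m_ac a_ac)
      also have "\<dots> \<in> P" using * c xy id by (simp add: idl_add idl_lmult)
      finally show False using P by blast
    qed
  qed
  moreover have "a [^] (1::nat) \<notin> P" using P by blast
  ultimately show thesis using that P assms by auto
qed

text \<open>A substitute for the Artin-Rees lemma that needs no Rees algebra. Take L maximal among the ideals
  that meet I + (u) exactly in I + T u. If a^n is in T and j is so large that the colon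
  ideals (L : a^j) have become stationary, then L + (a^j) still meets I + (u) in I + T u, because
  a^n maps I + (u) into L. Hence a^j is in L. So L is large, whereas (L : u) is contained in
  (I : u) + T.\<close>
lemma weak_Artin_Rees:
  assumes I: "ideal I R" and u: "u \<in> carrier R" and T: "ideal T R"
  obtains L where "ideal L R" "I \<subseteq> L"
    "\<And>a n::nat. a \<in> carrier R \<Longrightarrow> a [^] n \<in> T \<Longrightarrow> \<exists>j::nat. a [^] j \<in> L"
    "\<And>r. r \<in> carrier R \<Longrightarrow> r \<otimes> u \<in> L \<Longrightarrow> \<exists>t\<in>T. (r \<ominus> t) \<otimes> u \<in> I"
proof -
  define W where "W = scaled_sum I T u"
  note cI = idl_carr[OF I] and cT = idl_carr[OF T]
  have WI: "i \<oplus> t \<otimes> u \<in> W" if "i \<in> I" "t \<in> T" for i t using that by (simp add: W_def scaled_sumI)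
  have IW: "I \<subseteq> W" and W: "ideal W R" and WA: "W \<subseteq> adjoin I u"
    unfolding W_def using I T u by (auto simp: scaled_sum_ideal dest: subsetD[OF scaled_sum_sub] subsetD[OF scaled_sum_sub_adjoin])
  let ?F = "{L. ideal L R \<and> W \<subseteq> L \<and> L \<inter> adjoin I u \<subseteq> W}"
  have "?F \<noteq> {}" using W by auto
  then obtain L where L: "L \<in> ?F" "\<And>K. K \<in> ?F \<Longrightarrow> L \<subseteq> K \<Longrightarrow> K = L"
    by (rule noeth_max) auto
  have id: "ideal L R" and WL: "W \<subseteq> L" and LW: "L \<inter> adjoin I u \<subseteq> W" using L(1) by auto
  note cL = idl_carr[OF id]
  have pow: "\<exists>j::nat. a [^] j \<in> L" if a: "a \<in> carrier R" and n: "a [^] n \<in> T" for a and n :: nat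
  proof -
    let ?G = "range (\<lambda>j::nat. colon R L (a [^] j))"
    obtain K where K: "K \<in> ?G" "\<And>K'. K' \<in> ?G \<Longrightarrow> K \<subseteq> K' \<Longrightarrow> K' = K"
      by (rule noeth_max[of ?G]) (use a id in \<open>auto intro: colon_ideal\<close>)
    then obtain j :: nat where j: "K = colon R L (a [^] j)" by auto
    have st: "w \<otimes> a [^] j \<in> L" if w: "w \<in> carrier R" "w \<otimes> a [^] (j + n) \<in> L" for w
    proof -
      have "K \<subseteq> colon R L (a [^] (j + n))"
        unfolding j using a id
        by (auto simp: colon_def nat_pow_mult[symmetric] m_assoc[symmetric] idl_rmult)
      hence "colon R L (a [^] (j + n)) = K" using K(2) by auto
      thus ?thesis using w by (auto simp: j colon_def)
    qed
    let ?L = "adjoin L (a [^] j)"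
    have "?L \<inter> adjoin I u \<subseteq> W"
    proof
      fix z assume z: "z \<in> ?L \<inter> adjoin I u"
      then obtain l w where lw: "l \<in> L" "w \<in> carrier R" "z = l \<oplus> w \<otimes> a [^] j" by (auto elim: adjoinE)
      obtain i r where ir: "i \<in> I" "r \<in> carrier R" "z = i \<oplus> r \<otimes> u" using z by (auto elim: adjoinE)
      have "a [^] n \<otimes> z = a [^] n \<otimes> i \<oplus> (r \<otimes> a [^] n) \<otimes> u"
        using ir a u cI by (simp add: r_distr m_ac)
      also have "\<dots> \<in> W" using ir a n I T by (intro WI idl_lmult) auto
      finally have "a [^] n \<otimes> z \<in> L" using WL by auto
      moreover have "a [^] n \<otimes> z = w \<otimes> a [^] (j + n) \<oplus> a [^] n \<otimes> l"
        using lw a cL by (simp add: r_distr m_ac nat_pow_mult[symmetric] a_comm)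
      ultimately have "w \<otimes> a [^] (j + n) \<in> L"
        using lw a by (auto intro: idl_addD[OF id, of _ "a [^] n \<otimes> l"] idl_lmult[OF id])
      hence "w \<otimes> a [^] j \<in> L" using st lw by blast
      hence "z \<in> L" using lw id by (simp add: idl_add)
      thus "z \<in> W" using z LW by auto
    qed
    hence "?L = L" using L(2)[of ?L] WL a id adjoin_sub[OF id, of "a [^] j"] by (auto intro!: adjoin_ideal)
    thus ?thesis using adjoin_self[OF id, of "a [^] j"] a by auto
  qed
  have fin: "\<exists>t\<in>T. (r \<ominus> t) \<otimes> u \<in> I" if r: "r \<in> carrier R" "r \<otimes> u \<in> L" for r
  proof -
    have "r \<otimes> u \<in> W" using LW r adjoin_mult[OF I u r(1)] by auto
    then obtain i t where it: "i \<in> I" "t \<in> T" "r \<otimes> u = i \<oplus> t \<otimes> u" by (auto simp: W_def elim: scaled_sumE)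
    have "(r \<ominus> t) \<otimes> u = r \<otimes> u \<ominus> t \<otimes> u"
      using it r u cT by (simp add: a_minus_def l_distr l_minus)
    also have "\<dots> = i" using it u cT cI by (simp add: a_minus_def a_assoc r_neg)
    finally show ?thesis using it by auto
  qed
  show thesis by (rule that[OF id _ pow fin]) (use IW WL in auto)
qed

end

section \<open>Noetherian local rings and lengths\<close>

locale local_noeth = noeth_cring +
  fixes M assumes max: "maximalideal M R" and uniq: "\<And>N. maximalideal N R \<Longrightarrow> N = M"
begin

lemma M_ideal: "ideal M R" using max by (simp add: maximalideal_def)

lemma M_carr: "x \<in> M \<Longrightarrow> x \<in> carrier R" using M_ideal by (rule idl_carr)

lemma M_sub: "M \<subseteq> carrier R" using M_carr by auto

lemma M_prime: "primeideal M R" using max by (rule maximalideal_prime)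

lemma one_notin_M: "\<one> \<notin> M"
  using max ideal.one_imp_carrier[OF M_ideal] by (auto simp: maximalideal_def maximalideal_axioms_def)

lemma proper_sub_M: "ideal I R \<Longrightarrow> \<one> \<notin> I \<Longrightarrow> I \<subseteq> M"
  using exists_maximal uniq by metis

lemma unit_outside:
  assumes "a \<in> carrier R" "a \<notin> M" obtains b where "b \<in> carrier R" "b \<otimes> a = \<one>"
proof -
  have "\<one> \<in> PIdl a"
    using proper_sub_M[OF cgenideal_ideal[OF assms(1)]] cgenideal_self[OF assms(1)] assms by blast
  thus thesis using that by (auto simp: PIdl_iff)
qed

lemma cancel_outside:
  assumes "a \<in> carrier R" "a \<notin> M" "ideal I R" "z \<in> carrier R" "a \<otimes> z \<in> I" shows "z \<in> I"
proof -
  obtain b where b: "b \<in> carrier R" "b \<otimes> a = \<one>" using unit_outside assms by blast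
  have "z = b \<otimes> (a \<otimes> z)" using b assms by (simp add: m_assoc[symmetric])
  thus ?thesis using idl_lmult[OF assms(3,5) b(1)] by simp
qed

lemma one_minus_notin_M: "t \<in> M \<Longrightarrow> \<one> \<ominus> t \<notin> M"
  using idl_add[OF M_ideal, of "\<one> \<ominus> t" t] one_notin_M M_carr[of t]
  by (auto simp: a_minus_def a_assoc l_neg)

lemma cancel_one_minus:
  assumes "t \<in> M" "ideal I R" "z \<in> carrier R" "(\<one> \<ominus> t) \<otimes> z \<in> I" shows "z \<in> I"
  using cancel_outside[OF _ one_minus_notin_M] assms M_carr by simp

text \<open>The hypothesis expresses N \<open>\<subseteq>\<close> J + M N without products of ideals. Suppose that K contains J and
  is maximal among such ideals that do not contain N. If a z is not in K, then K + (a z) contains z,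
  so a unit 1 - r a multiplies z into K. Thus K contains M N, and then N.\<close>
lemma Nakayama:
  assumes N: "ideal N R" and J: "ideal J R"
    and NK: "\<And>K. ideal K R \<Longrightarrow> J \<subseteq> K \<Longrightarrow> (\<And>a z. a \<in> M \<Longrightarrow> z \<in> N \<Longrightarrow> a \<otimes> z \<in> K) \<Longrightarrow> N \<subseteq> K"
  shows "N \<subseteq> J"
proof (rule ccontr)
  assume "\<not> N \<subseteq> J"
  hence "{K. ideal K R \<and> J \<subseteq> K \<and> \<not> N \<subseteq> K} \<noteq> {}" (is "?F \<noteq> _") using J by auto
  then obtain K where K: "K \<in> ?F" "\<And>K'. K' \<in> ?F \<Longrightarrow> K \<subseteq> K' \<Longrightarrow> K' = K"
    by (rule noeth_max) auto
  hence id: "ideal K R" by auto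
  have "a \<otimes> z \<in> K" if a: "a \<in> M" and z: "z \<in> N" for a z
  proof (rule ccontr)
    assume nin: "a \<otimes> z \<notin> K"
    have c: "a \<in> carrier R" "z \<in> carrier R" using a z M_carr idl_carr[OF N] by auto
    have s: "K \<subseteq> adjoin K (a \<otimes> z)" "a \<otimes> z \<in> adjoin K (a \<otimes> z)"
      using adjoin_sub[OF id] adjoin_self[OF id] c by auto
    have "N \<subseteq> adjoin K (a \<otimes> z)"
      using K(2)[of "adjoin K (a \<otimes> z)"] s nin K(1) c adjoin_ideal[OF id, of "a \<otimes> z"] by blast
    then obtain k r where kr: "k \<in> K" "r \<in> carrier R" "z = k \<oplus> r \<otimes> (a \<otimes> z)"
      using z by (meson adjoinE subsetD)
    have kc: "k \<in> carrier R" using kr idl_carr[OF id] by auto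
    have "(\<one> \<ominus> r \<otimes> a) \<otimes> z = z \<ominus> r \<otimes> (a \<otimes> z)"
      using kr c by (simp add: a_minus_def l_distr l_minus m_assoc)
    also have "\<dots> = (k \<oplus> r \<otimes> (a \<otimes> z)) \<ominus> r \<otimes> (a \<otimes> z)" using kr(3) by simp
    also have "\<dots> = k" using kr(2) kc c by (simp add: a_minus_def a_assoc r_neg)
    finally have "z \<in> K" using cancel_one_minus[of "r \<otimes> a" K z] a kr id c
      by (simp add: idl_lmult[OF M_ideal])
    thus False using nin id c by (simp add: idl_lmult)
  qed
  hence "N \<subseteq> K" using NK[OF id] K(1) by auto
  thus False using K(1) by auto
qed

text \<open>A simple step is an extension with factor R/M. A weak step may be trivial; weak steps
  survive sums and multiplication by an element, and chains of them bound lengths from above.\<close>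
definition weak_step :: "'a set \<Rightarrow> 'a set \<Rightarrow> bool"
  where "weak_step I K \<longleftrightarrow> ideal I R \<and> (\<exists>u\<in>carrier R. (\<forall>a\<in>M. a \<otimes> u \<in> I) \<and> K = adjoin I u)"

definition simple_step :: "'a set \<Rightarrow> 'a set \<Rightarrow> bool"
  where "simple_step I K \<longleftrightarrow> ideal I R \<and> (\<exists>u\<in>carrier R. u \<notin> I \<and> (\<forall>a\<in>M. a \<otimes> u \<in> I) \<and> K = adjoin I u)"

lemma weak_step_cases: "weak_step I K \<Longrightarrow> K = I \<or> simple_step I K"
  unfolding weak_step_def simple_step_def using adjoin_absorb by blast

lemma simple_step_weak_step: "simple_step I K \<Longrightarrow> weak_step I K"
  unfolding weak_step_def simple_step_def by blast

lemma simple_step_psub: "simple_step I K \<Longrightarrow> ideal I R \<and> ideal K R \<and> I \<subset> K"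
  unfolding simple_step_def using adjoin_ideal adjoin_sub adjoin_self by blast

lemma steps_collapse: "(weak_step ^^ n) I K \<Longrightarrow> \<exists>j\<le>n. (simple_step ^^ j) I K"
proof (induction n arbitrary: K)
  case 0 thus ?case by auto
next
  case (Suc n)
  then obtain L where L: "(weak_step ^^ n) I L" "weak_step L K" by auto
  then obtain j where j: "j \<le> n" "(simple_step ^^ j) I L" using Suc by blast
  from weak_step_cases[OF L(2)] show ?case
  proof
    assume "K = L" thus ?thesis using j by (auto intro: exI[of _ j])
  next
    assume "simple_step L K" thus ?thesis using j by (intro exI[of _ "Suc j"]) auto
  qed
qed

lemma steps_sub: "(simple_step ^^ n) I K \<Longrightarrow> I \<subseteq> K"
  by (induction n arbitrary: K) (use simple_step_psub in \<open>force+\<close>)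

lemma steps_psub: "(simple_step ^^ n) I K \<Longrightarrow> 0 < n \<Longrightarrow> I \<subset> K"
proof (cases n)
  case (Suc k)
  assume "(simple_step ^^ n) I K"
  then obtain L where "(simple_step ^^ k) I L" "simple_step L K" using Suc by auto
  thus ?thesis using steps_sub[of k I L] simple_step_psub[of L K] by blast
qed auto

lemma steps_weak_steps: "(simple_step ^^ n) I K \<Longrightarrow> (weak_step ^^ n) I K"
  by (induction n arbitrary: K) (use simple_step_weak_step in \<open>force+\<close>)

lemma simple_step_minimal:
  assumes "simple_step I I'" "ideal K R" "I \<subseteq> K" "K \<subseteq> I'" shows "K = I \<or> K = I'"
proof (cases "K \<subseteq> I")
  case False
  obtain u where I: "ideal I R" and u: "u \<in> carrier R" "\<And>a. a \<in> M \<Longrightarrow> a \<otimes> u \<in> I" "I' = adjoin I u"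
    using assms(1) by (auto simp: simple_step_def)
  obtain v where v: "v \<in> K" "v \<notin> I" using False by auto
  then obtain i r where ir: "i \<in> I" "r \<in> carrier R" "v = i \<oplus> r \<otimes> u"
    using assms u by (meson adjoinE subsetD)
  have "r \<notin> M" using v ir u I by (auto simp: idl_add)
  moreover have "r \<otimes> u \<in> K"
    using idl_addD[OF assms(2), of "r \<otimes> u" i] v ir u assms(3) idl_carr[OF I] a_comm[of i "r \<otimes> u"] by auto
  ultimately have "u \<in> K" using cancel_outside[of r K u] ir u assms by auto
  hence "I' \<subseteq> K" using u assms by (auto intro: adjoin_least[THEN subsetD])
  thus ?thesis using assms by auto
qed (use assms in auto)

text \<open>The simple extensions A and B of I meet in I only, so A + B is simple over each of them.\<close>
lemma diamond:
  assumes "simple_step I A" "simple_step I B" "A \<noteq> B"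
  obtains C where "simple_step A C" "simple_step B C" "\<And>T. ideal T R \<Longrightarrow> A \<subseteq> T \<Longrightarrow> B \<subseteq> T \<Longrightarrow> C \<subseteq> T"
proof -
  obtain u where I: "ideal I R" and u: "u \<in> carrier R" "u \<notin> I" "\<And>a. a \<in> M \<Longrightarrow> a \<otimes> u \<in> I" "A = adjoin I u"
    using assms(1) by (auto simp: simple_step_def)
  obtain v where v: "v \<in> carrier R" "v \<notin> I" "\<And>a. a \<in> M \<Longrightarrow> a \<otimes> v \<in> I" "B = adjoin I v"
    using assms(2) by (auto simp: simple_step_def)
  have iA: "ideal A R" "I \<subseteq> A" "A \<noteq> I" and iB: "ideal B R" "I \<subseteq> B" "B \<noteq> I" using assms simple_step_psub by blast+
  have "v \<notin> A" using simple_step_minimal[OF assms(1) iB(1,2)] iB(3) assms(3) adjoin_least[OF iA(1,2)] v(4) by blast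
  moreover have "u \<notin> B" using simple_step_minimal[OF assms(2) iA(1,2)] iA(3) assms(3) adjoin_least[OF iB(1,2)] u(4) by blast
  moreover have "adjoin A v = adjoin B u" using adjoin_commute I u v by simp
  ultimately have "simple_step A (adjoin A v)" "simple_step B (adjoin A v)"
    unfolding simple_step_def using iA iB u v by blast+
  moreover have "adjoin A v \<subseteq> T" if "ideal T R" "A \<subseteq> T" "B \<subseteq> T" for T
    using that adjoin_self[OF I v(1)] v(4) by (intro adjoin_least) auto
  ultimately show thesis by (rule that)
qed

lemma weak_step_push:
  assumes "weak_step I I'" "ideal K R" shows "weak_step (I <+>\<^bsub>R\<^esub> K) (I' <+>\<^bsub>R\<^esub> K)"
proof -
  obtain u where I: "ideal I R" and u: "u \<in> carrier R" "\<And>a. a \<in> M \<Longrightarrow> a \<otimes> u \<in> I" "I' = adjoin I u"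
    using assms(1) by (auto simp: weak_step_def)
  have I': "ideal I' R" using I u by (simp add: adjoin_ideal)
  have sub: "A \<subseteq> A <+>\<^bsub>R\<^esub> B" "B \<subseteq> A <+>\<^bsub>R\<^esub> B" if "ideal A R" "ideal B R" for A B
    using genideal_self[of "A \<union> B"] union_genideal[OF that] idl_sub[OF that(1)] idl_sub[OF that(2)] by auto
  have "I' <+>\<^bsub>R\<^esub> K = adjoin (I <+>\<^bsub>R\<^esub> K) u"
  proof
    have id: "ideal (adjoin (I <+>\<^bsub>R\<^esub> K) u) R" using I u assms by (intro adjoin_ideal add_ideals)
    have "I' \<subseteq> adjoin (I <+>\<^bsub>R\<^esub> K) u" unfolding u(3) by (rule adjoin_mono[OF sub(1)[OF I assms(2)]])
    moreover have "K \<subseteq> adjoin (I <+>\<^bsub>R\<^esub> K) u"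
      using sub(2)[OF I assms(2)] adjoin_sub[OF add_ideals[OF I assms(2)] u(1)] by auto
    ultimately have "Idl (I' \<union> K) \<subseteq> adjoin (I <+>\<^bsub>R\<^esub> K) u" using id by (intro genideal_minimal) auto
    thus "I' <+>\<^bsub>R\<^esub> K \<subseteq> adjoin (I <+>\<^bsub>R\<^esub> K) u" using union_genideal[OF I' assms(2)] by simp
    show "adjoin (I <+>\<^bsub>R\<^esub> K) u \<subseteq> I' <+>\<^bsub>R\<^esub> K"
    proof (rule adjoin_least[OF add_ideals[OF I' assms(2)]])
      show "I <+>\<^bsub>R\<^esub> K \<subseteq> I' <+>\<^bsub>R\<^esub> K"
        unfolding union_genideal[OF I' assms(2), symmetric] union_genideal[OF I assms(2), symmetric]
        using adjoin_sub[OF I u(1)] u(3) idl_sub[OF I'] idl_sub[OF assms(2)] by (intro subset_Idl_subset) auto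
      show "u \<in> I' <+>\<^bsub>R\<^esub> K" using sub(1)[OF I' assms(2)] u adjoin_self[OF I] by auto
    qed
  qed
  thus ?thesis unfolding weak_step_def using u sub(1)[OF I assms(2)] add_ideals[OF I assms(2)] by blast
qed

lemma steps_mono:
  assumes "(simple_step ^^ n) A T" "ideal A R" "ideal T R" "ideal C R" "A \<subseteq> C" "C \<subseteq> T"
  shows "\<exists>j\<le>n. (simple_step ^^ j) C T"
proof -
  have "(weak_step ^^ k) (A <+>\<^bsub>R\<^esub> C) (B <+>\<^bsub>R\<^esub> C)" if "(simple_step ^^ k) A B" for k B
    using that by (induction k arbitrary: B) (use simple_step_weak_step weak_step_push[OF _ assms(4)] in \<open>force+\<close>)
  from this[OF assms(1)] show ?thesis
    using steps_collapse set_add_absorb[OF assms(2,4,5)] set_add_absorb[OF assms(4,3,6)] by auto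
qed

text \<open>The length of R/I is the number n with \<open>(simple_step ^^ n) I (carrier R)\<close>; here it is shown to be unique.
  The first members of two chains are completed to a diamond, whose top has a chain to T of some
  length, and the induction hypothesis compares all chains with it.\<close>
lemma Jordan_Hoelder: "(simple_step ^^ n) I T \<Longrightarrow> (simple_step ^^ k) I T \<Longrightarrow> n = k"
proof (induction n arbitrary: I k)
  case 0
  thus ?case using steps_psub[of k I T] by auto
next
  case (Suc n)
  hence "I \<subset> T" using steps_psub[OF Suc.prems(1)] by auto
  then obtain k' where k: "k = Suc k'" using Suc.prems by (cases k) auto
  obtain A where A: "simple_step I A" "(simple_step ^^ n) A T" using Suc.prems(1) by (meson relpowp_Suc_D2)
  obtain B where B: "simple_step I B" "(simple_step ^^ k') B T" using Suc.prems(2) k by (meson relpowp_Suc_D2)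
  show ?case
  proof (cases "A = B")
    case True thus ?thesis using Suc.IH A B k by auto
  next
    case False
    have T: "ideal T R" using A(1,2) simple_step_psub by (cases n) auto
    from False obtain C where C: "simple_step A C" "simple_step B C" "C \<subseteq> T"
      using diamond[OF A(1) B(1)] T steps_sub[OF A(2)] steps_sub[OF B(2)] by metis
    then obtain j where j: "(simple_step ^^ j) C T"
      using steps_mono[OF A(2), of C] T simple_step_psub[of A C] by blast
    have 1: "(simple_step ^^ Suc j) A T" "(simple_step ^^ Suc j) B T" using C j by (meson relpowp_Suc_I2)+
    have n: "n = Suc j" using Suc.IH[OF A(2) 1(1)] .
    have "n = k'" using Suc.IH[of B k'] 1(2) B(2) n by simp
    thus ?thesis using k by simp
  qed
qed

lemma weak_step_scaled_sum:
  assumes "ideal I R" "u \<in> carrier R" "weak_step E E'" shows "weak_step (scaled_sum I E u) (scaled_sum I E' u)"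
proof -
  obtain w where w: "ideal E R" "w \<in> carrier R" "\<And>a. a \<in> M \<Longrightarrow> a \<otimes> w \<in> E" "E' = adjoin E w"
    using assms(3) by (auto simp: weak_step_def)
  have "a \<otimes> (w \<otimes> u) \<in> scaled_sum I E u" if "a \<in> M" for a
    using scaled_sum_mult[OF assms(1) w(1) assms(2) w(3)[OF that]] that M_carr w(2) assms by (simp add: m_assoc)
  thus ?thesis unfolding weak_step_def using scaled_sum_adjoin[OF assms(1) w(1) assms(2) w(2)] w assms scaled_sum_ideal
    by (intro conjI bexI[of _ "w \<otimes> u"]) auto
qed

lemma simple_step_scaled_sum:
  assumes "ideal I R" "u \<in> carrier R" "simple_step E E'" "colon R I u \<subseteq> E"
  shows "simple_step (scaled_sum I E u) (scaled_sum I E' u)"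
proof -
  obtain w where w: "ideal E R" "w \<in> carrier R" "w \<notin> E" "E' = adjoin E w"
    using assms(3) by (auto simp: simple_step_def)
  have "scaled_sum I E' u \<noteq> scaled_sum I E u"
    using scaled_sum_adjoin[OF assms(1) w(1) assms(2) w(2)] w
      adjoin_self[OF scaled_sum_ideal[OF assms(1) w(1) assms(2)], of "w \<otimes> u"]
      colon_scaled_sum_notin[OF assms(1) w(1) assms(2,4) w(2,3)] assms(2) by auto
  thus ?thesis using weak_step_cases weak_step_scaled_sum[OF assms(1,2)] simple_step_weak_step[OF assms(3)] by blast
qed

lemma weak_steps_adjoin:
  assumes "ideal I R" "ideal E R" "u \<in> carrier R" "\<And>e. e \<in> E \<Longrightarrow> e \<otimes> u \<in> I" "(weak_step ^^ c) E (carrier R)"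
  shows "(weak_step ^^ c) I (adjoin I u)"
proof -
  have "(weak_step ^^ c) (scaled_sum I E u) (scaled_sum I E' u)" if "(weak_step ^^ c) E E'" for E'
    using that by (induction c arbitrary: E') (use weak_step_scaled_sum[OF assms(1,3)] in \<open>force+\<close>)
  from this[OF assms(5)] show ?thesis using scaled_sum_absorb[OF assms(1-4)] by (simp add: adjoin_def)
qed

text \<open>The isomorphism of R/(I : u) with (I + (u))/I, at the level of chains.\<close>
lemma steps_adjoin:
  assumes "ideal I R" "u \<in> carrier R" "(simple_step ^^ c) (colon R I u) (carrier R)"
  shows "(simple_step ^^ c) I (adjoin I u)"
proof -
  let ?E = "colon R I u"
  have "(simple_step ^^ c) (scaled_sum I ?E u) (scaled_sum I E' u)" if "(simple_step ^^ c) ?E E'" for E'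
    using that
  proof (induction c arbitrary: E')
    case (Suc c)
    then obtain F where F: "(simple_step ^^ c) ?E F" "simple_step F E'" by auto
    show ?case using Suc.IH[OF F(1)] simple_step_scaled_sum[OF assms(1,2) F(2) steps_sub[OF F(1)]] by auto
  qed auto
  from this[OF assms(3)] show ?thesis
    using scaled_sum_absorb[OF assms(1) colon_ideal[OF assms(1,2)] assms(2)] colonD by (simp add: adjoin_def)
qed

definition M_primary :: "'a set \<Rightarrow> bool"
  where "M_primary I \<longleftrightarrow> (\<forall>a\<in>M. \<exists>n::nat. a [^] n \<in> I)"

lemma M_primary_mono: "M_primary I \<Longrightarrow> I \<subseteq> K \<Longrightarrow> M_primary K"
  unfolding M_primary_def by blast

text \<open>Take u in V - I with (I : u) maximal. If a u were outside I, then (I : a u) = (I : u), so that no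
  power of a could lie in I.\<close>
lemma exists_killed:
  assumes I: "ideal I R" and V: "ideal V R" and "\<not> V \<subseteq> I" and pr: "M_primary I"
  obtains u where "u \<in> V" "u \<notin> I" "\<And>a. a \<in> M \<Longrightarrow> a \<otimes> u \<in> I"
proof -
  let ?F = "(\<lambda>u. colon R I u) ` (V - I)"
  have Vc: "\<And>u. u \<in> V \<Longrightarrow> u \<in> carrier R" using idl_carr V by blast
  obtain K where K: "K \<in> ?F" "\<And>K'. K' \<in> ?F \<Longrightarrow> K \<subseteq> K' \<Longrightarrow> K' = K"
    by (rule noeth_max[of ?F]) (use assms Vc in \<open>auto intro: colon_ideal\<close>)
  then obtain u where u: "u \<in> V" "u \<notin> I" "K = colon R I u" by auto
  have "a \<otimes> u \<in> I" if a: "a \<in> M" for a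
  proof (rule ccontr)
    assume n: "a \<otimes> u \<notin> I"
    have c: "a \<in> carrier R" "u \<in> carrier R" using a u M_carr Vc by auto
    have "z \<otimes> (a \<otimes> u) = a \<otimes> (z \<otimes> u)" if "z \<in> carrier R" for z using that c by (simp add: m_lcomm)
    hence "K \<subseteq> colon R I (a \<otimes> u)" using u c I by (auto simp: colon_def idl_lmult)
    moreover have "a \<otimes> u \<in> V" using u c V by (simp add: idl_lmult)
    ultimately have eq: "colon R I (a \<otimes> u) = K" using K(2) n by auto
    have "a [^] k \<otimes> u \<notin> I" for k :: nat
    proof (induction k)
      case 0 thus ?case using u c by simp
    next
      case (Suc k)
      have "a [^] k \<notin> colon R I (a \<otimes> u)" unfolding eq u(3) using Suc c by (simp add: colon_def)
      thus ?case using c by (simp add: colon_def m_assoc)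
    qed
    moreover obtain k :: nat where "a [^] k \<in> I" using pr a by (auto simp: M_primary_def)
    ultimately show False using idl_rmult[OF I] c by blast
  qed
  thus thesis using that u by auto
qed

lemma exists_steps:
  assumes "ideal I R" "ideal V R" "I \<subseteq> V" "M_primary I"
  shows "\<exists>c. (simple_step ^^ c) I V"
  using assms(1,3,4)
proof (induction I rule: noeth_induct)
  case (ideal I)
  show ?case
  proof (cases "V \<subseteq> I")
    case True
    thus ?thesis using ideal by (intro exI[of _ 0]) auto
  next
    case False
    obtain u where u: "u \<in> V" "u \<notin> I" "\<And>a. a \<in> M \<Longrightarrow> a \<otimes> u \<in> I"
      by (rule exists_killed[OF ideal(1) assms(2) False ideal(4)]) blast
    hence uc: "u \<in> carrier R" using idl_carr assms(2) by blast
    have st: "simple_step I (adjoin I u)" using u uc ideal(1) by (auto simp: simple_step_def)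
    have "\<exists>c. (simple_step ^^ c) (adjoin I u) V"
      using ideal simple_step_psub[OF st] u adjoin_least[OF assms(2) ideal(3) u(1)] M_primary_mono by blast
    thus ?thesis using st by (meson relpowp_Suc_I2)
  qed
qed

lemma steps_less:
  assumes "(simple_step ^^ n) I (carrier R)" "ideal I R" "ideal V R" "I \<subset> V" "M_primary I"
  shows "\<exists>j<n. (simple_step ^^ j) V (carrier R)"
proof -
  obtain c where c: "(simple_step ^^ c) I V" using exists_steps assms by blast
  hence "0 < c" using assms by (cases c) auto
  moreover obtain j where j: "(simple_step ^^ j) V (carrier R)"
    using exists_steps[OF assms(3) oneideal] idl_sub M_primary_mono assms by blast
  moreover have "(simple_step ^^ (c + j)) I (carrier R)" using c j by (auto simp: relpowp_add)
  ultimately show ?thesis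
    using Jordan_Hoelder[OF assms(1), of "c + j"] j by (intro exI[of _ j]) auto
qed

lemma simple_step_top: "simple_step M (carrier R)"
proof -
  have "adjoin M \<one> = carrier R"
    using ideal.one_imp_carrier[OF adjoin_ideal[OF M_ideal one_closed]] adjoin_self[OF M_ideal one_closed] by simp
  thus ?thesis unfolding simple_step_def using M_ideal one_notin_M M_carr by (intro conjI bexI[of _ \<one>]) auto
qed

text \<open>Here s spans the socle modulo K + (x). The colon ideal of x^a in K + (x^{a+1}) is K + (x): an
  element r outside would have s among its multiples modulo K + (x), and x^{q-1} s would lie in K + (x^q). So each
  of the q steps from K + (x^q) up to R contributes n to the length, and x^{q-1} s spans the
  socle modulo K + (x^q).\<close>
lemma length_power_step:
  assumes K: "ideal K R" and x: "x \<in> carrier R" and q: "0 < q" and s: "s \<in> carrier R"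
    and len: "(simple_step ^^ n) (adjoin K x) (carrier R)"
    and soc: "\<And>r. r \<in> carrier R \<Longrightarrow> r \<notin> adjoin K x \<Longrightarrow> s \<in> adjoin (adjoin K x) r"
    and nin: "x [^] (q - 1) \<otimes> s \<notin> adjoin K (x [^] q)"
  shows "(simple_step ^^ (q * n)) (adjoin K (x [^] q)) (carrier R)"
    and "\<And>r. r \<in> carrier R \<Longrightarrow> r \<notin> adjoin K (x [^] q) \<Longrightarrow> x [^] (q - 1) \<otimes> s \<in> adjoin (adjoin K (x [^] q)) r"
proof -
  define L where "L a = adjoin K (x [^] a)" for a :: nat
  have id: "ideal (L a) R" for a unfolding L_def using K x by (simp add: adjoin_ideal)
  have L1: "L 1 = adjoin K x" using x by (simp add: L_def)
  have KL: "K \<subseteq> L a" for a unfolding L_def using K x by (simp add: adjoin_sub)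
  have self: "x [^] a \<in> L a" for a unfolding L_def using K x by (simp add: adjoin_self)
  have dec: "L (Suc a) \<subseteq> L a" for a
    unfolding L_def[of "Suc a"] using id self x KL by (intro adjoin_least) (auto simp: idl_rmult)
  have shift: "x [^] b \<otimes> z \<in> L (a + b)" if z: "z \<in> L a" for z a b
  proof -
    obtain k c where kc: "k \<in> K" "c \<in> carrier R" "z = k \<oplus> c \<otimes> x [^] a"
      using z by (auto simp: L_def elim: adjoinE)
    have kcc: "k \<in> carrier R" using kc idl_carr K by blast
    have "x [^] b \<otimes> z = x [^] b \<otimes> k \<oplus> c \<otimes> x [^] (a + b)"
      using kc kcc x by (simp add: r_distr nat_pow_mult[symmetric] m_ac)
    thus ?thesis unfolding L_def using kc x K by (simp add: adjoinI idl_lmult)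
  qed
  have col: "colon R (L (Suc a)) (x [^] a) = L 1" if a: "a < q" for a
  proof
    show "L 1 \<subseteq> colon R (L (Suc a)) (x [^] a)"
      using shift[of _ 1 a] x idl_carr[OF id[of 1]] by (auto simp: colon_def m_comm)
    show "colon R (L (Suc a)) (x [^] a) \<subseteq> L 1"
    proof
      fix r assume "r \<in> colon R (L (Suc a)) (x [^] a)"
      hence r: "r \<in> carrier R" "r \<otimes> x [^] a \<in> L (Suc a)" by (auto simp: colon_def)
      show "r \<in> L 1"
      proof (rule ccontr)
        assume "r \<notin> L 1"
        hence "s \<in> adjoin (L 1) r" using soc r unfolding L1 by blast
        then obtain k d where kd: "k \<in> L 1" "d \<in> carrier R" "s = k \<oplus> d \<otimes> r" by (auto elim: adjoinE)
        have kc: "k \<in> carrier R" using kd idl_carr id by blast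
        have "x [^] (q - 1) = x [^] (q - 1 - a) \<otimes> x [^] a" using a x by (simp add: nat_pow_mult)
        hence "x [^] (q - 1) \<otimes> s = x [^] (q - 1) \<otimes> k \<oplus> d \<otimes> (x [^] (q - 1 - a) \<otimes> (r \<otimes> x [^] a))"
          using kd kc r x by (simp add: r_distr m_ac)
        also have "\<dots> \<in> L q"
          using shift[OF kd(1), of "q - 1"] shift[OF r(2), of "q - 1 - a"] a q kd id
          by (simp add: idl_add idl_lmult)
        finally show False using nin by (simp add: L_def)
      qed
    qed
  qed
  have adj: "adjoin (L (Suc a)) (x [^] a) = L a" for a
  proof
    show "adjoin (L (Suc a)) (x [^] a) \<subseteq> L a" using id self dec by (intro adjoin_least)
    show "L a \<subseteq> adjoin (L (Suc a)) (x [^] a)" unfolding L_def[of a] by (rule adjoin_mono[OF KL])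
  qed
  have "L 0 = carrier R" using self[of 0] ideal.one_imp_carrier[OF id] by simp
  have "a \<le> q \<Longrightarrow> (simple_step ^^ (a * n)) (L a) (carrier R)" for a
  proof (induction a)
    case 0 thus ?case using \<open>L 0 = carrier R\<close> by simp
  next
    case (Suc a)
    have "(simple_step ^^ n) (L (Suc a)) (L a)"
      using steps_adjoin[OF id, of "x [^] a" n "Suc a"] col[of a] adj[of a] len L1 Suc x by simp
    thus ?case using Suc by (auto simp: relpowp_add)
  qed
  from this[of q] show "(simple_step ^^ (q * n)) (adjoin K (x [^] q)) (carrier R)" by (simp add: L_def)
  fix r assume r: "r \<in> carrier R" "r \<notin> adjoin K (x [^] q)"
  have "\<exists>a<q. r \<in> L a \<and> r \<notin> L (Suc a)"
  proof (rule ccontr)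
    assume "\<not> ?thesis"
    hence "a \<le> q \<Longrightarrow> r \<in> L a" for a by (induction a) (use r \<open>L 0 = carrier R\<close> in auto)
    thus False using r by (simp add: L_def)
  qed
  then obtain a where a: "a < q" "r \<in> L a" "r \<notin> L (Suc a)" by blast
  then obtain k c where kc: "k \<in> K" "c \<in> carrier R" "r = k \<oplus> c \<otimes> x [^] a" by (auto simp: L_def elim: adjoinE)
  have kcc: "k \<in> carrier R" using kc idl_carr K by blast
  have "c \<notin> L 1"
  proof
    assume "c \<in> L 1"
    hence "c \<otimes> x [^] a \<in> L (Suc a)" using col[OF a(1)] by (auto simp: colon_def)
    hence "r \<in> L (Suc a)" using kc KL idl_add[OF id] by blast
    thus False using a by simp
  qed
  hence "s \<in> adjoin (L 1) c" using soc kc unfolding L1 by blast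
  then obtain k1 d where kd: "k1 \<in> L 1" "d \<in> carrier R" "s = k1 \<oplus> d \<otimes> c" by (auto elim: adjoinE)
  have k1c: "k1 \<in> carrier R" using kd idl_carr id by blast
  let ?x = "x [^] (q - 1 - a)"
  have "x [^] (q - 1) = ?x \<otimes> x [^] a" using a x by (simp add: nat_pow_mult)
  hence "x [^] (q - 1) \<otimes> s = x [^] (q - 1) \<otimes> k1 \<oplus> (d \<otimes> ?x) \<otimes> (c \<otimes> x [^] a)"
    using kd k1c kc x by (simp add: r_distr m_ac)
  also have "c \<otimes> x [^] a = \<ominus> k \<oplus> r"
    using kc kcc x by (simp add: a_assoc[symmetric] l_neg)
  also have "x [^] (q - 1) \<otimes> k1 \<oplus> (d \<otimes> ?x) \<otimes> (\<ominus> k \<oplus> r)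
     = (x [^] (q - 1) \<otimes> k1 \<oplus> (d \<otimes> ?x) \<otimes> (\<ominus> k)) \<oplus> (d \<otimes> ?x) \<otimes> r"
    using kd k1c kcc x r by (simp add: r_distr a_assoc)
  also have "\<dots> \<in> adjoin (L q) r"
  proof (rule adjoinI)
    show "x [^] (q - 1) \<otimes> k1 \<oplus> (d \<otimes> ?x) \<otimes> (\<ominus> k) \<in> L q"
      using shift[OF kd(1), of "q - 1"] q kd(2) x subsetD[OF KL kc(1), of q] id
      by (simp add: idl_add idl_lmult idl_neg)
  qed (use kd x in auto)
  finally show "x [^] (q - 1) \<otimes> s \<in> adjoin (adjoin K (x [^] q)) r" by (simp add: L_def)
qed

text \<open>Starting from M, replace the elements of A by their q-th powers one at a time. Each replacement
  multiplies the length by q as long as the socle element stays outside the ideal, and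
  \<open>top_monomial_mult\<close> reduces this to the hypothesis.\<close>
lemma monomial_length:
  assumes J: "J \<subseteq> carrier R" and A: "finite A" "A \<subseteq> carrier R" "M = Idl (J \<union> A)" and q: "0 < q"
    and nin: "top_monomial q A \<notin> Idl (J \<union> (\<lambda>x. x [^] q) ` A)"
  shows "(simple_step ^^ (q ^ card A)) (Idl (J \<union> (\<lambda>x. x [^] q) ` A)) (carrier R)"
proof -
  define H where "H = (\<lambda>C. J \<union> (\<lambda>x. x [^] q) ` C \<union> (A - C))"
  have Hc: "H C \<subseteq> carrier R" if "C \<subseteq> A" for C unfolding H_def using that J A by auto
  have n: "top_monomial q C \<notin> Idl (H C)" if C: "C \<subseteq> A" for C
  proof
    assume "top_monomial q C \<in> Idl (H C)"
    hence "top_monomial q C \<otimes> top_monomial q (A - C) \<in> Idl (J \<union> (\<lambda>x. x [^] q) ` C \<union> (\<lambda>x. x [^] q) ` (A - C))"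
      unfolding H_def using A J C q by (intro top_monomial_mult) auto
    moreover have "top_monomial q C \<otimes> top_monomial q (A - C) = top_monomial q A"
    proof -
      have "finite C" "finite (A - C)" "C \<subseteq> carrier R" "A - C \<subseteq> carrier R" using A C finite_subset by blast+
      from top_monomial_Un[OF this(1,2) _ this(3,4)] show ?thesis using C by (simp add: Un_absorb1)
    qed
    moreover have "J \<union> (\<lambda>x. x [^] q) ` C \<union> (\<lambda>x. x [^] q) ` (A - C) = J \<union> (\<lambda>x. x [^] q) ` A"
      using C by auto
    ultimately show False using nin by simp
  qed
  have "(simple_step ^^ (q ^ card C)) (Idl (H C)) (carrier R) \<and>
      (\<forall>r\<in>carrier R. r \<notin> Idl (H C) \<longrightarrow> top_monomial q C \<in> adjoin (Idl (H C)) r)" if "C \<subseteq> A" for C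
    using finite_subset[OF that A(1)] that
  proof (induction C rule: finite_induct)
    case empty
    have "Idl (H {}) = M" by (simp add: H_def A)
    moreover have "\<one> \<in> adjoin M r" if "r \<in> carrier R" "r \<notin> M" for r
      using simple_step_minimal[OF simple_step_top, of "adjoin M r"] that adjoin_ideal[OF M_ideal that(1)]
        adjoin_sub[OF M_ideal that(1)] adjoin_self[OF M_ideal that(1)] idl_sub by blast
    ultimately show ?case using simple_step_top by (simp add: top_monomial_empty eq_OO)
  next
    case (insert x C)
    let ?K = "Idl (J \<union> (\<lambda>x. x [^] q) ` C \<union> (A - insert x C))"
    have c: "J \<union> (\<lambda>x. x [^] q) ` C \<union> (A - insert x C) \<subseteq> carrier R" using insert J A by auto
    have x: "x \<in> carrier R" "x \<in> A" using insert A by auto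
    have K: "ideal ?K R" by (rule genideal_ideal[OF c])
    have "H C = insert x (J \<union> (\<lambda>x. x [^] q) ` C \<union> (A - insert x C))"
      "H (insert x C) = insert (x [^] q) (J \<union> (\<lambda>x. x [^] q) ` C \<union> (A - insert x C))"
      unfolding H_def using insert by auto
    hence 1: "Idl (H C) = adjoin ?K x" and 2: "Idl (H (insert x C)) = adjoin ?K (x [^] q)"
      using Idl_insert[OF c] x by auto
    have cc: "C \<subseteq> carrier R" "finite C" using insert A by auto
    have 3: "top_monomial q (insert x C) = x [^] (q - 1) \<otimes> top_monomial q C"
      using insert x cc by (intro top_monomial_insert)
    note ov = length_power_step[OF K x(1) q top_monomial_closed[OF cc(1)], of "q ^ card C"]
    have IH: "(simple_step ^^ (q ^ card C)) (Idl (H C)) (carrier R)"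
      "\<And>r. r \<in> carrier R \<Longrightarrow> r \<notin> Idl (H C) \<Longrightarrow> top_monomial q C \<in> adjoin (Idl (H C)) r" using insert by auto
    have nn: "x [^] (q - 1) \<otimes> top_monomial q C \<notin> adjoin ?K (x [^] q)" using n[OF insert.prems] 2 3 by simp
    show ?case using ov(1)[OF IH[unfolded 1] nn] ov(2)[OF IH[unfolded 1] nn] 2 3 insert(1,2) by simp
  qed
  from this[of A] show ?thesis by (simp add: H_def)
qed

end

section \<open>Lengths of Frobenius powers and the colon identity\<close>

locale local_frob = local_noeth +
  fixes p :: nat
  assumes p_gt1: "1 < p" and frob_p: "frob_exp p"
begin

lemma frob_pe: "frob_exp (p ^ e)" using frob_p by (rule frob_exp_power)

lemma pe_pos: "0 < p ^ e" using p_gt1 by simp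

lemma rbracket_M_primary: "I \<subseteq> carrier R \<Longrightarrow> M_primary (rbracket I (p ^ e) M)"
  unfolding M_primary_def using rbracket_pow[OF _ M_sub] by blast

lemma cofinal:
  assumes L: "ideal L R" "I \<subseteq> L" "\<And>a. a \<in> M \<Longrightarrow> \<exists>j::nat. a [^] j \<in> L"
  shows "\<exists>e. rbracket I (p ^ e) M \<subseteq> L"
proof -
  obtain A where A: "A \<subseteq> carrier R" "finite A" "M = Idl A" using finetely_gen[OF M_ideal] by blast
  have "A \<subseteq> M" using A genideal_self by blast
  then obtain j where j: "\<And>a. a \<in> A \<Longrightarrow> a [^] (j a :: nat) \<in> L" using L(3) by (metis subsetD)
  \<comment> \<open>The sum bounds all exponents j a, and it is at most p^e.\<close>
  define e where "e = (\<Sum>a\<in>A. j a)"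
  have "a [^] (p ^ e) \<in> L" if a: "a \<in> A" for a
  proof (rule idl_pow_le[OF L(1) _ j[OF a]])
    have "j a \<le> e" unfolding e_def using A a by (intro member_le_sum) auto
    also have "e \<le> p ^ e" using power_gt_expt[of p e] p_gt1 by simp
    finally show "j a \<le> p ^ e" .
  qed (use a A in auto)
  hence "M \<subseteq> {r \<in> carrier R. r [^] (p ^ e) \<in> L}"
    unfolding A(3) using A L frob_pe by (intro genideal_minimal frob_vimage_ideal) auto
  thus ?thesis using L by (intro exI[of _ e] rbracket_least) auto
qed

text \<open>With T = M, \<open>weak_Artin_Rees\<close> yields t in M such that (1 - t) z is in J.\<close>
lemma Krull_intersection:
  assumes J: "ideal J R" and z: "\<And>e. z \<in> rbracket J (p ^ e) M" shows "z \<in> J"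
proof -
  have zc: "z \<in> carrier R" using z[of 0] idl_carr[OF rbracket_ideal[OF idl_sub[OF J] M_sub]] by blast
  obtain L where L: "ideal L R" "J \<subseteq> L"
    "\<And>a n::nat. a \<in> carrier R \<Longrightarrow> a [^] n \<in> M \<Longrightarrow> \<exists>j::nat. a [^] j \<in> L"
    "\<And>r. r \<in> carrier R \<Longrightarrow> r \<otimes> z \<in> L \<Longrightarrow> \<exists>t\<in>M. (r \<ominus> t) \<otimes> z \<in> J"
    by (rule weak_Artin_Rees[OF J zc M_ideal]) blast
  have "\<exists>j::nat. a [^] j \<in> L" if "a \<in> M" for a
    using L(3)[of a 1] that M_carr by simp
  then obtain e where "rbracket J (p ^ e) M \<subseteq> L" using cofinal[OF L(1,2)] by blast
  hence "\<one> \<otimes> z \<in> L" using z zc by auto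
  then obtain t where "t \<in> M" "(\<one> \<ominus> t) \<otimes> z \<in> J" using L(4) by blast
  thus ?thesis using cancel_one_minus J zc by blast
qed

text \<open>By \<open>monomial_length\<close>, these are the generators A of M modulo J for which R/(J + M^{[q]}) has the
  greatest length that card A generators permit.\<close>
definition full_parameters :: "'a set \<Rightarrow> 'a set \<Rightarrow> bool"
  where "full_parameters J A \<longleftrightarrow> ideal J R \<and> finite A \<and> A \<subseteq> carrier R \<and> M = Idl (J \<union> A) \<and>
    (\<forall>e. top_monomial (p ^ e) A \<notin> rbracket J (p ^ e) M)"

lemma rbracket_M_gen:
  assumes "ideal J R" "A \<subseteq> carrier R" "M = Idl (J \<union> A)" "frob_exp q"
  shows "rbracket J q M = Idl (J \<union> (\<lambda>x. x [^] q) ` A)"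
proof -
  have "(\<lambda>x. x [^] q) ` J \<subseteq> J" using assms by (auto intro: idl_pow frob_exp_pos)
  hence "J \<union> (\<lambda>x. x [^] q) ` (J \<union> A) = J \<union> (\<lambda>x. x [^] q) ` A" by auto
  thus ?thesis using rbracket_Idl[of J "J \<union> A" q] assms idl_sub[OF assms(1)] by auto
qed

lemma full_parameters_length:
  assumes "full_parameters J A" shows "(simple_step ^^ ((p ^ e) ^ card A)) (rbracket J (p ^ e) M) (carrier R)"
proof -
  have a: "ideal J R" "finite A" "A \<subseteq> carrier R" "M = Idl (J \<union> A)"
    and n: "top_monomial (p ^ e) A \<notin> rbracket J (p ^ e) M" using assms by (auto simp: full_parameters_def)
  show ?thesis using monomial_length[OF idl_sub[OF a(1)] a(2,3,4) pe_pos[of e]] n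
    unfolding rbracket_M_gen[OF a(1,3,4) frob_pe] by blast
qed

text \<open>If D'/D is a quotient of R/M, then the corresponding factor of bracket powers is a quotient of
  R/(J + M^{[p]}).\<close>
lemma full_parameters_weak_step:
  assumes g: "full_parameters J A" and st: "weak_step D D'" and JD: "J \<subseteq> D" and len: "(weak_step ^^ k) (rbracket J p M) (carrier R)"
  shows "(weak_step ^^ k) (rbracket J p D) (rbracket J p D')"
proof -
  have J: "J \<subseteq> carrier R" using g idl_sub by (auto simp: full_parameters_def)
  obtain w where D: "ideal D R" and w: "w \<in> carrier R" "\<And>a. a \<in> M \<Longrightarrow> a \<otimes> w \<in> D" "D' = adjoin D w"
    using st by (auto simp: weak_step_def)
  note Dc = idl_sub[OF D]
  have eq: "rbracket J p D' = adjoin (rbracket J p D) (w [^] p)" using rbracket_adjoin[OF J D w(1) frob_p] w by simp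
  have "e \<otimes> w [^] p \<in> rbracket J p D" if e: "e \<in> rbracket J p M" for e
  proof (rule rbracket_mult_in[OF J M_sub rbracket_ideal[OF J Dc] rbracket_base[OF J Dc] _ _ e])
    fix x assume x: "x \<in> M"
    show "x [^] p \<otimes> w [^] p \<in> rbracket J p D"
      using rbracket_pow[OF J Dc w(2)[OF x], of p] M_carr[OF x] w by (simp add: nat_pow_distrib)
  qed (use w in auto)
  thus ?thesis unfolding eq using w len J M_sub Dc
    by (intro weak_steps_adjoin[where E = "rbracket J p M"] rbracket_ideal) auto
qed

text \<open>Refine by Frobenius a chain of simple steps that passes from J + M^{[q]} through I and I + (u) to
  R, where q = p^e. It has q^n steps, and each becomes at most p^n steps. The step from I to I + (u)
  would become fewer if (J + I^{[p]} : u^p) were larger than J + M^{[p]}, and then the length of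
  R/(J + M^{[pq]}) would be less than (pq)^n.\<close>
lemma frob_length_step:
  assumes g: "full_parameters J A" and I: "ideal I R" and sub: "rbracket J (p ^ e) M \<subseteq> I"
    and u: "u \<in> carrier R" "u \<notin> I" "\<And>a. a \<in> M \<Longrightarrow> a \<otimes> u \<in> I"
    and v: "v \<in> carrier R" "v \<otimes> u [^] p \<in> rbracket J p I"
  shows "v \<in> rbracket J p M"
proof (rule ccontr)
  assume nv: "v \<notin> rbracket J p M"
  let ?n = "card A" let ?I' = "adjoin I u" let ?B = "rbracket J (p ^ e) M" let ?V = "adjoin (rbracket J p M) v"
  have Ji: "ideal J R" using g by (auto simp: full_parameters_def)
  note J = idl_sub[OF Ji]
  note Ic = idl_sub[OF I]
  have B: "ideal ?B R" "M_primary ?B" "J \<subseteq> ?B"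
    using rbracket_ideal[OF J M_sub] rbracket_M_primary[OF J] rbracket_base[OF J M_sub] by auto
  have P: "ideal (rbracket J p M) R" "M_primary (rbracket J p M)"
    using rbracket_ideal[OF J M_sub] rbracket_M_primary[OF J, of 1] by auto
  have st: "simple_step I ?I'" using I u by (auto simp: simple_step_def)
  have I': "ideal ?I' R" "I \<subseteq> ?I'" using simple_step_psub[OF st] by auto
  obtain a where a: "(simple_step ^^ a) ?B I" using exists_steps[OF B(1) I sub B(2)] by blast
  obtain b where b: "(simple_step ^^ b) ?I' (carrier R)"
    using exists_steps[OF I'(1) oneideal idl_sub[OF I'(1)]] M_primary_mono[OF B(2)] sub I'(2) by blast
  have "(simple_step ^^ (a + Suc b)) ?B (carrier R)"
    using relpowp_trans[OF a relpowp_Suc_I2[OF st b]] .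
  hence ab: "a + Suc b = (p ^ e) ^ ?n" using Jordan_Hoelder full_parameters_length[OF g] by blast
  define k where "k = p ^ ?n"
  have lenP: "(simple_step ^^ k) (rbracket J p M) (carrier R)" using full_parameters_length[OF g, of 1] by (simp add: k_def)
  have ws: "(weak_step ^^ (c * k)) (rbracket J p D) (rbracket J p D')" if "(simple_step ^^ c) D D'" "J \<subseteq> D" for c D D'
    using that(1)
  proof (induction c arbitrary: D')
    case (Suc c)
    then obtain F where F: "(simple_step ^^ c) D F" "simple_step F D'" by auto
    have "(weak_step ^^ k) (rbracket J p F) (rbracket J p D')"
      using full_parameters_weak_step[OF g simple_step_weak_step[OF F(2)] _ steps_weak_steps[OF lenP]] steps_sub[OF F(1)] that(2) by blast
    from relpowp_trans[OF Suc.IH[OF F(1)] this] show ?case by (simp add: add.commute)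
  qed auto
  have V: "ideal ?V R" "rbracket J p M \<subset> ?V"
    using adjoin_ideal[OF P(1) v(1)] adjoin_sub[OF P(1) v(1)] adjoin_self[OF P(1) v(1)] nv by auto
  obtain j where j: "j < k" "(simple_step ^^ j) ?V (carrier R)" using steps_less[OF lenP P(1) V P(2)] by blast
  \<comment> \<open>This is where length is lost: fewer than k steps suffice here, because v u^p is in the bracket power of I.\<close>
  have mid: "(weak_step ^^ j) (rbracket J p I) (rbracket J p ?I')"
  proof -
    have c: "z \<otimes> u [^] p \<in> rbracket J p I" if z: "z \<in> ?V" for z
    proof -
      have "rbracket J p M \<subseteq> colon R (rbracket J p I) (u [^] p)"
      proof
        fix x assume x: "x \<in> rbracket J p M"
        have "x \<otimes> u [^] p \<in> rbracket J p I"
        proof (rule rbracket_mult_in[OF J M_sub rbracket_ideal[OF J Ic] rbracket_base[OF J Ic] _ _ x])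
          fix y assume y: "y \<in> M"
          show "y [^] p \<otimes> u [^] p \<in> rbracket J p I"
            using rbracket_pow[OF J Ic u(3)[OF y], of p] M_carr[OF y] u by (simp add: nat_pow_distrib)
        qed (use u in auto)
        thus "x \<in> colon R (rbracket J p I) (u [^] p)" using x idl_carr[OF P(1)] by (simp add: colon_def)
      qed
      hence "?V \<subseteq> colon R (rbracket J p I) (u [^] p)"
        using v u J Ic by (intro adjoin_least colon_ideal rbracket_ideal) (auto simp: colon_def)
      thus ?thesis using z colonD by blast
    qed
    have "(weak_step ^^ j) (rbracket J p I) (adjoin (rbracket J p I) (u [^] p))"
      using c u V steps_weak_steps[OF j(2)] J Ic by (intro weak_steps_adjoin[where E = ?V] rbracket_ideal) auto
    thus ?thesis using rbracket_adjoin[OF J I u(1) frob_p] by simp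
  qed
  have "(weak_step ^^ (a * k)) (rbracket J p ?B) (rbracket J p I)" using ws[OF a B(3)] .
  from relpowp_trans[OF this mid]
  have "(weak_step ^^ (a * k + j)) (rbracket J p ?B) (rbracket J p ?I')" .
  moreover have "(weak_step ^^ (b * k)) (rbracket J p ?I') (carrier R)"
    using ws[OF b] B(3) sub I'(2) rbracket_carrier[OF J, of p] by auto
  ultimately have "(weak_step ^^ (a * k + j + b * k)) (rbracket J p ?B) (carrier R)"
    by (rule relpowp_trans)
  then obtain i where i: "i \<le> a * k + j + b * k" "(simple_step ^^ i) (rbracket J p ?B) (carrier R)"
    using steps_collapse by blast
  have "rbracket J p ?B = rbracket J (p ^ Suc e) M" using rbracket_brk[OF Ji M_sub frob_p] by (simp add: mult.commute)
  hence "i = (p ^ Suc e) ^ ?n" using i(2) Jordan_Hoelder full_parameters_length[OF g, of "Suc e"] by simp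
  also have "\<dots> = (a + Suc b) * k" unfolding ab k_def by (simp add: power_mult_distrib)
  also have "\<dots> > a * k + j + b * k" using j by (simp add: algebra_simps)
  finally show False using i by simp
qed

text \<open>Descend along a chain of simple steps from R to (I : u). A step from F' to F = F' + (w) gives the
  simple step from I + F' u to I + F u, to which \<open>frob_length_step\<close> applies.\<close>
lemma colon_frob_primary:
  assumes g: "full_parameters J A" and I: "ideal I R" and sub: "rbracket J (p ^ e) M \<subseteq> I" and u: "u \<in> carrier R"
    and r: "r \<in> carrier R" "r \<otimes> u [^] p \<in> rbracket J p I"
  shows "r \<in> rbracket J p (colon R I u)"
proof -
  have Ji: "ideal J R" using g by (auto simp: full_parameters_def)
  note J = idl_sub[OF Ji] and Ic = idl_sub[OF I]
  have E: "ideal (colon R I u) R" using I u by (rule colon_ideal)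
  have pr: "M_primary I" using M_primary_mono[OF rbracket_M_primary[OF J] sub] .
  \<comment> \<open>Write r = f + c w^p. As r u^p and f u^p are in J + (I + F' u)^{[p]}, so is c (w u)^p, and the length count shows that c is in J + M^{[p]}.\<close>
  have one: "r \<in> rbracket J p F'" if st: "simple_step F' F" and cF: "colon R I u \<subseteq> F'" and rF: "r \<in> rbracket J p F" for F F'
  proof -
    obtain w where F': "ideal F' R" and w: "w \<in> carrier R" "w \<notin> F'" "\<And>a. a \<in> M \<Longrightarrow> a \<otimes> w \<in> F'" "F = adjoin F' w"
      using st by (auto simp: simple_step_def)
    note F'c = idl_sub[OF F']
    let ?S = "scaled_sum I F' u"
    have S: "ideal ?S R" "I \<subseteq> ?S" using scaled_sum_ideal[OF I F' u] scaled_sum_sub[OF I F' u] .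
    note Sc = idl_sub[OF S(1)]
    have bS: "ideal (rbracket J p ?S) R" by (rule rbracket_ideal[OF J Sc])
    have pw: "e [^] p \<otimes> u [^] p \<in> rbracket J p ?S" if "e \<in> F'" for e
      using rbracket_pow[OF J Sc scaled_sum_mult[OF I F' u that], of p] that F'c u by (auto simp: nat_pow_distrib)
    obtain f c where fc: "f \<in> rbracket J p F'" "c \<in> carrier R" "r = f \<oplus> c \<otimes> w [^] p"
      using rF rbracket_adjoin[OF J F' w(1) frob_p] w(4) by (auto elim: adjoinE)
    have fcc: "f \<in> carrier R" using fc idl_carr[OF rbracket_ideal[OF J F'c]] by blast
    have "f \<otimes> u [^] p \<in> rbracket J p ?S"
      by (rule rbracket_mult_in[OF J F'c bS rbracket_base[OF J Sc] _ pw fc(1)]) (use u in auto)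
    moreover have "c \<otimes> (w \<otimes> u) [^] p \<oplus> f \<otimes> u [^] p \<in> rbracket J p ?S"
    proof -
      have "c \<otimes> (w \<otimes> u) [^] p \<oplus> f \<otimes> u [^] p = r \<otimes> u [^] p"
        using fc fcc w u by (simp add: nat_pow_distrib l_distr m_assoc a_comm)
      thus ?thesis using r rbracket_mono[OF J Sc S(2)] by auto
    qed
    ultimately have "c \<otimes> (w \<otimes> u) [^] p \<in> rbracket J p ?S" using idl_addD[OF bS] fc(2) w u by auto
    hence "c \<in> rbracket J p M"
    proof (intro frob_length_step[OF g S(1) _ _ _ _ fc(2), of e "w \<otimes> u"])
      show "w \<otimes> u \<notin> ?S" using colon_scaled_sum_notin[OF I F' u cF w(1,2)] .
      show "a \<otimes> (w \<otimes> u) \<in> ?S" if "a \<in> M" for a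
        using scaled_sum_mult[OF I F' u w(3)[OF that]] M_carr[OF that] w u by (simp add: m_assoc)
    qed (use sub S w u in auto)
    hence "c \<otimes> w [^] p \<in> rbracket J p F'"
    proof (rule rbracket_mult_in[OF J M_sub rbracket_ideal[OF J F'c] rbracket_base[OF J F'c], rotated 2])
      fix x assume x: "x \<in> M"
      show "x [^] p \<otimes> w [^] p \<in> rbracket J p F'"
        using rbracket_pow[OF J F'c w(3)[OF x], of p] M_carr[OF x] w by (simp add: nat_pow_distrib)
    qed (use w in auto)
    thus ?thesis using fc rbracket_ideal[OF J F'c] by (simp add: idl_add)
  qed
  obtain c where c: "(simple_step ^^ c) (colon R I u) (carrier R)"
    using exists_steps[OF E oneideal idl_sub[OF E] M_primary_mono[OF pr colon_sup[OF I u]]] by blast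
  have "(simple_step ^^ c) (colon R I u) F \<Longrightarrow> r \<in> rbracket J p F \<Longrightarrow> r \<in> rbracket J p (colon R I u)" for F
  proof (induction c arbitrary: F)
    case (Suc c)
    then obtain F' where F': "(simple_step ^^ c) (colon R I u) F'" "simple_step F' F" by auto
    show ?case using Suc.IH[OF F'(1) one[OF F'(2) steps_sub[OF F'(1)] Suc.prems(2)]] .
  qed auto
  thus ?thesis using c rbracket_carrier[OF J] r by blast
qed

text \<open>Approximate I by the M-primary ideals I + M^{[q]}. By \<open>weak_Artin_Rees\<close>, (I + M^{[q]} : u) is in
  (I : u) + M^{[Q]} when q is large compared with Q, and the error vanishes by
  \<open>Krull_intersection\<close>.\<close>
lemma colon_frob:
  assumes g: "full_parameters J A" and I: "ideal I R" and JI: "J \<subseteq> I" and u: "u \<in> carrier R"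
  shows "colon R (rbracket J p I) (u [^] p) = rbracket J p (colon R I u)"
proof
  have Ji: "ideal J R" using g by (auto simp: full_parameters_def)
  note J = idl_sub[OF Ji] and Ic = idl_sub[OF I]
  show "rbracket J p (colon R I u) \<subseteq> colon R (rbracket J p I) (u [^] p)" by (rule rbracket_colon_sub[OF J I u])
  let ?C = "colon R I u"
  have C: "ideal ?C R" by (rule colon_ideal[OF I u])
  note Cc = idl_sub[OF C]
  show "colon R (rbracket J p I) (u [^] p) \<subseteq> rbracket J p ?C"
  proof
    fix r assume "r \<in> colon R (rbracket J p I) (u [^] p)"
    hence r: "r \<in> carrier R" "r \<otimes> u [^] p \<in> rbracket J p I" by (auto simp: colon_def)
    have bC: "ideal (rbracket J p ?C) R" by (rule rbracket_ideal[OF J Cc])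
    show "r \<in> rbracket J p ?C"
    proof (rule Krull_intersection[OF bC])
      fix k
      let ?T = "rbracket {\<zero>} (p ^ k) M" and ?D = "rbracket ?C (p ^ k) M"
      have T: "ideal ?T R" by (rule rbracket_ideal) (use M_sub in auto)
      have D: "ideal ?D R" "?C \<subseteq> ?D" by (rule rbracket_ideal[OF Cc M_sub], rule rbracket_base[OF Cc M_sub])
      have TD: "?T \<subseteq> ?D" using rbracket_pow[OF Cc M_sub] idl_zero[OF D(1)] by (intro rbracket_least[OF D(1)]) auto
      obtain L where L: "ideal L R" "I \<subseteq> L"
        "\<And>a n::nat. a \<in> carrier R \<Longrightarrow> a [^] n \<in> ?T \<Longrightarrow> \<exists>j::nat. a [^] j \<in> L"
        "\<And>r. r \<in> carrier R \<Longrightarrow> r \<otimes> u \<in> L \<Longrightarrow> \<exists>t\<in>?T. (r \<ominus> t) \<otimes> u \<in> I"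
        by (rule weak_Artin_Rees[OF I u T]) blast
      have "\<exists>j::nat. a [^] j \<in> L" if "a \<in> M" for a
        using L(3)[of a "p ^ k"] rbracket_pow[OF _ M_sub that, of "{\<zero>}"] M_carr[OF that] by auto
      then obtain e where e: "rbracket I (p ^ e) M \<subseteq> L" using cofinal[OF L(1,2)] by blast
      let ?I = "rbracket I (p ^ e) M"
      have I1: "ideal ?I R" "I \<subseteq> ?I" by (rule rbracket_ideal[OF Ic M_sub], rule rbracket_base[OF Ic M_sub])
      have "rbracket J (p ^ e) M \<subseteq> ?I"
        using rbracket_pow[OF Ic M_sub] I1(2) JI by (intro rbracket_least[OF I1(1)]) auto
      from colon_frob_primary[OF g I1(1) this u r(1)]
      have "r \<in> rbracket J p (colon R ?I u)" using r(2) rbracket_mono[OF J idl_sub[OF I1(1)] I1(2)] by blast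
      also have "\<dots> \<subseteq> rbracket J p ?D"
      proof (rule rbracket_mono[OF J idl_sub[OF D(1)]], rule)
        fix x assume "x \<in> colon R ?I u"
        hence x: "x \<in> carrier R" "x \<otimes> u \<in> L" using e by (auto simp: colon_def)
        then obtain t where t: "t \<in> ?T" "(x \<ominus> t) \<otimes> u \<in> I" using L(4) by blast
        have tc: "t \<in> carrier R" using t idl_carr[OF T] by blast
        have "x \<ominus> t \<in> ?D" using t x tc D(2) by (auto simp: colon_def)
        hence "(x \<ominus> t) \<oplus> t \<in> ?D" using t TD D by (auto intro: idl_add)
        thus "x \<in> ?D" using x tc by (simp add: a_minus_def a_assoc l_neg)
      qed
      also have "rbracket J p ?D = Idl (J \<union> (\<lambda>x. x [^] p) ` (?C \<union> (\<lambda>x. x [^] (p ^ k)) ` M))"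
        unfolding rbracket_def[of ?C] using J Cc M_sub frob_p by (intro rbracket_Idl) auto
      also have "\<dots> \<subseteq> rbracket (rbracket J p ?C) (p ^ k) M"
      proof (rule genideal_minimal[OF rbracket_ideal[OF idl_sub[OF bC] M_sub]])
        have "(x [^] (p ^ k)) [^] p = (x [^] p) [^] (p ^ k)" if "x \<in> M" for x
          using M_carr[OF that] by (simp add: nat_pow_pow mult.commute)
        thus "J \<union> (\<lambda>x. x [^] p) ` (?C \<union> (\<lambda>x. x [^] (p ^ k)) ` M) \<subseteq> rbracket (rbracket J p ?C) (p ^ k) M"
          using rbracket_base[OF idl_sub[OF bC] M_sub, of "p ^ k"] rbracket_base[OF J Cc, of p] rbracket_pow[OF J Cc, of _ p]
            rbracket_pow[OF idl_sub[OF bC] M_sub idl_pow[OF M_ideal], of _ p "p ^ k"] p_gt1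
          by auto
      qed
      finally show "r \<in> rbracket (rbracket J p ?C) (p ^ k) M" .
    qed
  qed
qed

text \<open>For a outside J, the ideal C = (J : a) is in M and is contained in (J : a^p), hence in
  J + C^{[p]}, hence in J + M C. Nakayama's lemma gives C = J.\<close>
lemma colon_imp_prime:
  assumes Ji: "ideal J R" "\<one> \<notin> J"
    and col: "\<And>u. u \<in> carrier R \<Longrightarrow> colon R J (u [^] p) \<subseteq> rbracket J p (colon R J u)"
  shows "primeideal J R"
proof (rule primeidealI[OF Ji(1) is_cring])
  note J = idl_sub[OF Ji(1)]
  show "carrier R \<noteq> J" using Ji by auto
  fix a b assume ab: "a \<in> carrier R" "b \<in> carrier R" "a \<otimes> b \<in> J"
  let ?C = "colon R J a"
  have C: "ideal ?C R" by (rule colon_ideal[OF Ji(1) ab(1)])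
  have "b \<in> J" if a: "a \<notin> J"
  proof -
    have CM: "?C \<subseteq> M" using proper_sub_M[OF C] a ab by (auto simp: colon_def)
    have p: "x [^] p = x [^] (p - 1) \<otimes> x" for x using p_gt1 nat_pow_Suc[of x "p - 1"] by simp
    have "?C \<subseteq> J"
    proof (rule Nakayama[OF C Ji(1)])
      fix K assume K: "ideal K R" "J \<subseteq> K" "\<And>b z. b \<in> M \<Longrightarrow> z \<in> ?C \<Longrightarrow> b \<otimes> z \<in> K"
      have "?C \<subseteq> colon R J (a [^] p)"
      proof
        fix x assume x: "x \<in> ?C"
        hence "x \<otimes> a [^] p = a [^] (p - 1) \<otimes> (x \<otimes> a)" using ab p[of a] by (auto simp: colon_def m_lcomm)
        thus "x \<in> colon R J (a [^] p)" using x ab Ji(1) by (auto simp: colon_def idl_lmult)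
      qed
      also have "\<dots> \<subseteq> rbracket J p ?C" by (rule col[OF ab(1)])
      also have "\<dots> \<subseteq> K"
      proof (rule rbracket_least[OF K(1,2)])
        fix x assume x: "x \<in> ?C"
        have "x [^] (p - 1) \<in> M" using x CM p_gt1 idl_pow[OF M_ideal] by auto
        thus "x [^] p \<in> K" using p K(3) x by simp
      qed
      finally show "?C \<subseteq> K" .
    qed
    thus "b \<in> J" using ab by (auto simp: colon_def m_comm)
  qed
  thus "a \<in> J \<or> b \<in> J" by blast
qed

lemma full_parameters_prime:
  assumes g: "full_parameters J A" shows "primeideal J R"
proof -
  have Ji: "ideal J R" and MI: "M = Idl (J \<union> A)" and Ac: "A \<subseteq> carrier R" using g by (auto simp: full_parameters_def)
  note J = idl_sub[OF Ji]
  have "J \<subseteq> M" unfolding MI using genideal_self[of "J \<union> A"] J Ac by blast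
  moreover have "rbracket J p J = J"
    using rbracket_base[OF J J, of p] rbracket_least[OF Ji order.refl, of J p] idl_pow[OF Ji, of _ p] p_gt1 by auto
  ultimately show ?thesis using colon_imp_prime[OF Ji] colon_frob[OF g Ji order.refl] one_notin_M by auto
qed

text \<open>A relation modulo J + (x) becomes one modulo J + (x^q) on multiplication by x^{q-1}.\<close>
lemma full_parameters_adjoin:
  assumes g: "full_parameters J (insert x A)" "x \<notin> A"
  shows "full_parameters (adjoin J x) A"
proof -
  let ?J = "adjoin J x"
  have a: "ideal J R" "finite A" "insert x A \<subseteq> carrier R" "M = Idl (J \<union> insert x A)"
    and n: "\<And>e. top_monomial (p ^ e) (insert x A) \<notin> rbracket J (p ^ e) M" using g by (auto simp: full_parameters_def)
  have x: "x \<in> carrier R" and Ac: "A \<subseteq> carrier R" using a by auto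
  note J = idl_sub[OF a(1)]
  have J': "ideal ?J R" by (rule adjoin_ideal[OF a(1) x])
  note J'c = idl_sub[OF J']
  have eq: "?J = Idl (insert x J)" using Idl_insert[OF J x] a(1) by (simp add: Idl_ideal)
  have M: "M = Idl (?J \<union> A)"
  proof
    show "M \<subseteq> Idl (?J \<union> A)" unfolding a(4)
      using adjoin_sub[OF a(1) x] adjoin_self[OF a(1) x] J'c Ac by (intro subset_Idl_subset) auto
    have "?J \<subseteq> M"
      using genideal_self[of "J \<union> insert x A"] J a(3) unfolding a(4)
      by (intro adjoin_least genideal_ideal) auto
    moreover have "A \<subseteq> M" unfolding a(4) using genideal_self[of "J \<union> insert x A"] J a(3) by blast
    ultimately show "Idl (?J \<union> A) \<subseteq> M" by (intro genideal_minimal[OF M_ideal]) auto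
  qed
  have "top_monomial (p ^ e) A \<notin> rbracket ?J (p ^ e) M" for e
  proof
    let ?q = "p ^ e"
    let ?H = "J \<union> (\<lambda>x. x [^] ?q) ` insert x A"
    have H: "?H \<subseteq> carrier R" using J a(3) by auto
    have Hi: "ideal (Idl ?H) R" by (rule genideal_ideal[OF H])
    have xq: "x [^] (?q - 1) \<otimes> x = x [^] ?q"
      using pow_pred[OF x pe_pos, of e] m_comm[OF x, of "x [^] (?q - 1)"] x by simp
    assume "top_monomial ?q A \<in> rbracket ?J ?q M"
    hence "top_monomial ?q A \<in> Idl (?J \<union> (\<lambda>x. x [^] ?q) ` A)" by (simp add: rbracket_M_gen[OF J' Ac M frob_pe])
    moreover have "Idl (?J \<union> (\<lambda>x. x [^] ?q) ` A) \<subseteq> colon R (Idl ?H) (x [^] (?q - 1))"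
    proof (rule genideal_minimal[OF colon_ideal[OF Hi]])
      have "?J \<subseteq> colon R (Idl ?H) (x [^] (?q - 1))"
      proof (rule adjoin_least[OF colon_ideal[OF Hi]])
        show "J \<subseteq> colon R (Idl ?H) (x [^] (?q - 1))" "x [^] (?q - 1) \<in> carrier R"
          using genideal_self[OF H] J Hi x by (auto simp: colon_def intro!: idl_rmult)
        show "x \<in> colon R (Idl ?H) (x [^] (?q - 1))"
          using genideal_self[OF H] x xq m_comm[of x "x [^] (?q - 1)"] by (auto simp: colon_def)
      qed
      moreover have "(\<lambda>x. x [^] ?q) ` A \<subseteq> colon R (Idl ?H) (x [^] (?q - 1))"
        using genideal_self[OF H] Ac Hi x by (auto simp: colon_def intro!: idl_rmult)
      ultimately show "?J \<union> (\<lambda>x. x [^] ?q) ` A \<subseteq> colon R (Idl ?H) (x [^] (?q - 1))" by simp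
    qed (use x in auto)
    ultimately have "top_monomial ?q A \<otimes> x [^] (?q - 1) \<in> Idl ?H" using colonD by blast
    hence "top_monomial ?q (insert x A) \<in> Idl ?H"
      using top_monomial_insert[OF a(2) g(2) x Ac] m_comm[OF top_monomial_closed[OF Ac]] x by simp
    thus False using n[of e] rbracket_M_gen[OF a(1,3,4) frob_pe] by simp
  qed
  thus ?thesis unfolding full_parameters_def using J' a(2) Ac M by blast
qed

lemma full_parameters_subset:
  assumes "full_parameters {\<zero>} A" "C \<subseteq> A" shows "full_parameters (Idl C) (A - C)"
proof -
  have A: "finite A" "A \<subseteq> carrier R" using assms by (auto simp: full_parameters_def)
  have "finite C" using assms(2) A finite_subset by blast
  thus ?thesis using assms(2)
  proof (induction C rule: finite_induct)
    case empty thus ?case using assms(1) by (simp add: Idl_empty)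
  next
    case (insert x C)
    have "A - C = insert x (A - insert x C)" using insert by auto
    hence "full_parameters (adjoin (Idl C) x) (A - insert x C)" using insert by (intro full_parameters_adjoin) auto
    moreover have "Idl (insert x C) = adjoin (Idl C) x" using insert A by (intro Idl_insert) auto
    ultimately show ?case by simp
  qed
qed

text \<open>The hypothesis says that the q-th powers of the elements of A are independent in the sense of
  Lech. By induction on B it follows that (M^{[q]} : t) is contained in the ideal generated by B and
  the q-th powers of the elements of A - B, where t is the product of the x^{q-1} with x in B. For
  B = A this ideal is M, so t is not in M^{[q]}.\<close>
lemma independent_imp_full_parameters:
  assumes A: "finite A" "A \<subseteq> carrier R" "M = Idl A"
    and ind: "\<And>x c e. x \<in> A \<Longrightarrow> c \<in> carrier R \<Longrightarrow> c \<otimes> x [^] (p ^ e) \<in> Idl ((\<lambda>y. y [^] (p ^ e)) ` (A - {x})) \<Longrightarrow>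
      c \<in> rbracket {\<zero>} (p ^ e) M"
  shows "full_parameters {\<zero>} A"
proof -
  have AM: "A \<subseteq> M" using A genideal_self by blast
  have MI: "M = Idl ({\<zero>} \<union> A)"
    using AM idl_zero[OF M_ideal] A(2)
    by (metis A(3) Idl_empty M_ideal equalityI genideal_minimal insert_is_Un insert_subset subset_Idl_subset subset_insertI zero_closed)
  have "top_monomial (p ^ e) A \<notin> rbracket {\<zero>} (p ^ e) M" for e
  proof
    let ?q = "p ^ e" and ?pw = "\<lambda>y. y [^] (p ^ e)"
    assume top: "top_monomial ?q A \<in> rbracket {\<zero>} ?q M"
    have bM: "rbracket {\<zero>} ?q M = Idl ({\<zero>} \<union> ?pw ` A)"
      by (rule rbracket_M_gen[OF zeroideal A(2) MI frob_pe])
    have bMi: "ideal (rbracket {\<zero>} ?q M) R" by (rule rbracket_ideal) (use M_sub in auto)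
    have zI: "Idl ({\<zero>} \<union> S) = Idl S" if "S \<subseteq> carrier R" for S
      using that genideal_self[of S] idl_zero[OF genideal_ideal[OF that]]
      by (intro equalityI genideal_minimal genideal_ideal subset_Idl_subset) auto
    have bM': "rbracket {\<zero>} ?q M = Idl (?pw ` A)" unfolding bM using A by (intro zI) auto
    have "\<forall>r\<in>carrier R. r \<otimes> top_monomial ?q B \<in> rbracket {\<zero>} ?q M \<longrightarrow> r \<in> Idl (B \<union> ?pw ` (A - B))" if B: "B \<subseteq> A" for B
      using finite_subset[OF B A(1)] B
    proof (induction B rule: finite_induct)
      case empty
      thus ?case by (simp add: top_monomial_empty bM')
    next
      case (insert x B)
      let ?t = "top_monomial ?q B"
      have Bc: "B \<subseteq> carrier R" "x \<in> carrier R" "x \<in> A" "B \<subseteq> A" using insert A by auto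
      have tc: "?t \<in> carrier R" by (rule top_monomial_closed[OF Bc(1)])
      have t: "top_monomial ?q (insert x B) = x [^] (?q - 1) \<otimes> ?t"
        using insert Bc by (intro top_monomial_insert) auto
      let ?S = "B \<union> ?pw ` (A - insert x B)"
      have Sc: "?S \<subseteq> carrier R" using Bc A by auto
      have Si: "ideal (Idl ?S) R" by (rule genideal_ideal[OF Sc])
      have S1: "Idl (B \<union> ?pw ` (A - B)) = adjoin (Idl ?S) (x [^] ?q)"
      proof -
        have "B \<union> ?pw ` (A - B) = insert (x [^] ?q) ?S" using insert Bc by auto
        thus ?thesis using Idl_insert[OF Sc] Bc by simp
      qed
      have S2: "Idl (insert x B \<union> ?pw ` (A - insert x B)) = adjoin (Idl ?S) x"
        using Idl_insert[OF Sc Bc(2)] by simp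
      have xq: "x [^] ?q = x \<otimes> x [^] (?q - 1)"
        by (rule pow_pred[OF Bc(2) pe_pos])
      show ?case
      proof (intro ballI impI)
        fix r assume r: "r \<in> carrier R" "r \<otimes> top_monomial ?q (insert x B) \<in> rbracket {\<zero>} ?q M"
        have "(r \<otimes> x [^] (?q - 1)) \<otimes> ?t \<in> rbracket {\<zero>} ?q M" using r t tc Bc by (simp add: m_assoc)
        hence "r \<otimes> x [^] (?q - 1) \<in> adjoin (Idl ?S) (x [^] ?q)" using insert.IH r Bc S1 by auto
        then obtain i s where ps: "i \<in> Idl ?S" "s \<in> carrier R" "r \<otimes> x [^] (?q - 1) = i \<oplus> s \<otimes> x [^] ?q"
          by (rule adjoinE)
        have ic: "i \<in> carrier R" using ps idl_carr[OF Si] by blast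
        define w where "w = r \<ominus> s \<otimes> x"
        have wc: "w \<in> carrier R" using r ps Bc by (simp add: w_def)
        have "w \<otimes> x [^] (?q - 1) = r \<otimes> x [^] (?q - 1) \<ominus> s \<otimes> x [^] ?q"
          unfolding w_def using r ps Bc xq by (simp add: a_minus_def l_distr l_minus m_assoc)
        also have "\<dots> = i" using ps ic Bc by (simp add: a_minus_def a_assoc r_neg)
        finally have wi: "w \<otimes> x [^] (?q - 1) = i" .
        have "w \<otimes> ?t \<otimes> x [^] ?q = x \<otimes> (i \<otimes> ?t)"
          unfolding wi[symmetric] using wc tc Bc xq by (simp add: m_ac)
        moreover have "i \<otimes> ?t \<in> Idl (?pw ` (A - insert x B) \<union> ?pw ` B)"
          using ps(1) A Bc pe_pos finite_subset[OF Bc(4) A(1)]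
          by (intro top_monomial_mult) (auto simp: Un_commute)
        moreover have "?pw ` (A - insert x B) \<union> ?pw ` B = ?pw ` (A - {x})" using insert Bc by auto
        moreover have "ideal (Idl (?pw ` (A - {x}))) R" using A by (intro genideal_ideal) auto
        ultimately have "w \<otimes> ?t \<otimes> x [^] ?q \<in> Idl (?pw ` (A - {x}))" using Bc by (simp add: idl_lmult)
        hence "w \<otimes> ?t \<in> rbracket {\<zero>} ?q M" using ind Bc wc tc by simp
        hence "w \<in> adjoin (Idl ?S) (x [^] ?q)" using insert.IH wc Bc S1 by auto
        also have "\<dots> \<subseteq> adjoin (Idl ?S) x"
          using adjoin_ideal[OF Si Bc(2)] adjoin_sub[OF Si Bc(2)] adjoin_mult[OF Si Bc(2), of "x [^] (?q - 1)"] Bc xq m_comm[of x "x [^] (?q - 1)"]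
          by (intro adjoin_least) auto
        finally have "w \<oplus> s \<otimes> x \<in> adjoin (Idl ?S) x"
          using adjoin_mult[OF Si Bc(2) ps(2)] adjoin_ideal[OF Si Bc(2)] by (simp add: idl_add)
        moreover have "w \<oplus> s \<otimes> x = r" unfolding w_def using r ps Bc by (simp add: a_minus_def a_assoc l_neg)
        ultimately show "r \<in> Idl (insert x B \<union> ?pw ` (A - insert x B))" unfolding S2 by simp
      qed
    qed
    from this[of A] top have "\<one> \<in> Idl A" using top_monomial_closed[OF A(2)] by simp
    thus False using one_notin_M A by simp
  qed
  thus ?thesis unfolding full_parameters_def using A(1,2) MI zeroideal by blast
qed

end

section \<open>Krull's principal ideal theorem in a local ring\<close>

context local_noeth begin

lemma prime_sub_M: "primeideal P R \<Longrightarrow> P \<subseteq> M"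
  using proper_sub_M primeideal_ideal prime_one by blast

text \<open>Suppose that M is the only prime ideal containing P and x. Then P + (x^k) is M-primary and
  R/(P + (x^k)) has length k C, where C is its length for k = 1. For y in P' - P, \<open>weak_Artin_Rees\<close>
  provides j with (P + (x^j) : y) \<open>\<subseteq>\<close> P + (x), and inductively
  (P + (x^{j+k}) : y) \<open>\<subseteq>\<close> P + (x^{k+1}). So the length of R/(P + (y) + (x^{j+k})) is at most j C for
  all k. But x is not in P', and therefore the ideals P + (y) + (x^k) decrease strictly.\<close>
theorem local_principal_ideal_theorem:
  assumes P: "primeideal P R" and P': "primeideal P' R" "P \<subset> P'" "P' \<subset> M" and x: "x \<in> M"
  shows "\<exists>Q. primeideal Q R \<and> P \<subseteq> Q \<and> x \<in> Q \<and> Q \<noteq> M"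
proof (rule ccontr)
  assume "\<not> ?thesis"
  hence only: "Q = M" if "primeideal Q R" "P \<subseteq> Q" "x \<in> Q" for Q using that by blast
  have xc: "x \<in> carrier R" using x M_carr by blast
  have Pi: "ideal P R" and P'i: "ideal P' R" using P P' primeideal_ideal by auto
  note Pc = idl_carr[OF Pi]
  have xP': "x \<notin> P'" using only[OF P'(1)] P' by auto
  hence xP: "x \<notin> P" using P' by auto
  hence xk: "x [^] k \<notin> P" for k :: nat using prime_pow[OF P xc] by blast
  define L where "L k = adjoin P (x [^] k)" for k :: nat
  have L: "ideal (L k) R" "P \<subseteq> L k" "x [^] k \<in> L k" for k
    unfolding L_def using adjoin_ideal[OF Pi] adjoin_sub[OF Pi] adjoin_self[OF Pi] xc by auto
  have L0: "L 0 = carrier R" using L(3)[of 0] ideal.one_imp_carrier[OF L(1)] by simp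
  have Lmono: "L (k + i) \<subseteq> L k" for k i
    unfolding L_def[of "k + i"] using L xc by (intro adjoin_least) (auto simp: nat_pow_mult[symmetric] idl_rmult)
  have prim: "M_primary K" if K: "ideal K R" "P \<subseteq> K" "x [^] k \<in> K" for K and k :: nat
    unfolding M_primary_def
  proof (rule ballI, rule ccontr)
    fix a assume a: "a \<in> M" "\<nexists>n::nat. a [^] n \<in> K"
    obtain Q where "primeideal Q R" "K \<subseteq> Q" "a \<notin> Q"
      by (rule exists_prime_avoiding[OF K(1) M_carr[OF a(1)]]) (use a in auto)
    thus False using only[of Q] prime_pow[of Q x k] xc K a by auto
  qed
  obtain C where C: "(simple_step ^^ C) (L 1) (carrier R)"
    using exists_steps[OF L(1) oneideal idl_sub[OF L(1)] prim[OF L]] by blast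
  have col: "colon R (L (Suc k)) (x [^] k) = L 1" for k
  proof
    show "L 1 \<subseteq> colon R (L (Suc k)) (x [^] k)" unfolding L_def[of 1]
      using xc Pi L(1)[of "Suc k"] L(2)[of "Suc k"] L(3)[of "Suc k"] Pc m_comm[of x "x [^] k"]
      by (intro adjoin_least colon_ideal) (auto simp: colon_def intro!: idl_rmult)
    show "colon R (L (Suc k)) (x [^] k) \<subseteq> L 1"
    proof
      fix r assume "r \<in> colon R (L (Suc k)) (x [^] k)"
      hence r: "r \<in> carrier R" "r \<otimes> x [^] k \<in> L (Suc k)" by (auto simp: colon_def)
      then obtain i s where ps: "i \<in> P" "s \<in> carrier R" "r \<otimes> x [^] k = i \<oplus> s \<otimes> x [^] Suc k"
        by (auto simp: L_def simp del: nat_pow_Suc elim: adjoinE)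
      have "(r \<ominus> s \<otimes> x) \<otimes> x [^] k = r \<otimes> x [^] k \<ominus> s \<otimes> x [^] Suc k"
        using r ps xc by (simp add: a_minus_def l_distr l_minus m_assoc m_comm[of x])
      also have "\<dots> = i" using ps xc Pc by (simp add: a_minus_def a_assoc r_neg)
      finally have "r \<ominus> s \<otimes> x \<in> P" using prime_cancel[OF P _ xk, of k "r \<ominus> s \<otimes> x"] ps r xc by simp
      hence "(r \<ominus> s \<otimes> x) \<oplus> s \<otimes> x \<in> L 1" unfolding L_def using xc ps adjoinI by simp
      thus "r \<in> L 1" using r ps xc by (simp add: a_minus_def a_assoc l_neg)
    qed
  qed
  have adj: "adjoin (L (Suc k)) (x [^] k) = L k" for k
  proof
    show "adjoin (L (Suc k)) (x [^] k) \<subseteq> L k" using L Lmono[of k 1] by (intro adjoin_least) auto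
    show "L k \<subseteq> adjoin (L (Suc k)) (x [^] k)" unfolding L_def[of k] by (rule adjoin_mono[OF L(2)])
  qed
  have len: "(simple_step ^^ (k * C)) (L k) (carrier R)" for k
  proof (induction k)
    case (Suc k)
    have "(simple_step ^^ C) (L (Suc k)) (L k)"
      using steps_adjoin[OF L(1), of "x [^] k" C "Suc k"] C xc by (simp add: col adj)
    from relpowp_trans[OF this Suc] show ?case by simp
  qed (simp add: L0)
  obtain y where y: "y \<in> P'" "y \<notin> P" using P' by blast
  have yc: "y \<in> carrier R" using y idl_carr[OF P'i] by blast
  obtain K where K: "ideal K R" "P \<subseteq> K"
    "\<And>a n::nat. a \<in> carrier R \<Longrightarrow> a [^] n \<in> PIdl x \<Longrightarrow> \<exists>j::nat. a [^] j \<in> K"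
    "\<And>r. r \<in> carrier R \<Longrightarrow> r \<otimes> y \<in> K \<Longrightarrow> \<exists>t\<in>PIdl x. (r \<ominus> t) \<otimes> y \<in> P"
    by (rule weak_Artin_Rees[OF Pi yc cgenideal_ideal[OF xc]]) blast
  obtain j :: nat where j: "x [^] j \<in> K" using K(3)[of x 1] xc cgenideal_self[OF xc] by auto
  hence LK: "L j \<subseteq> K" unfolding L_def using K by (intro adjoin_least)
  have base: "r \<in> L 1" if r: "r \<in> carrier R" "r \<otimes> y \<in> L j" for r
  proof -
    obtain t where t: "t \<in> PIdl x" "(r \<ominus> t) \<otimes> y \<in> P" using K(4) LK r by blast
    then obtain s where s: "s \<in> carrier R" "t = s \<otimes> x" by (auto simp: PIdl_iff)
    hence "r \<ominus> t \<in> P" using prime_cancel[OF P yc y(2) _ t(2)] r xc by simp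
    hence "(r \<ominus> t) \<oplus> s \<otimes> x \<in> L 1" unfolding L_def using xc s adjoinI by simp
    thus ?thesis using r s xc by (simp add: a_minus_def a_assoc l_neg)
  qed
  have shift: "r \<in> carrier R \<Longrightarrow> r \<otimes> y \<in> L (j + k) \<Longrightarrow> r \<in> L (Suc k)" for r k
  proof (induction k arbitrary: r)
    case 0 thus ?case using base by simp
  next
    case (Suc k)
    have "r \<in> L (Suc k)" using Suc Lmono[of "j + k" 1] by auto
    then obtain i s where ps: "i \<in> P" "s \<in> carrier R" "r = i \<oplus> s \<otimes> x [^] Suc k"
      by (auto simp: L_def simp del: nat_pow_Suc elim: adjoinE)
    obtain i' s' where ps': "i' \<in> P" "s' \<in> carrier R" "r \<otimes> y = i' \<oplus> s' \<otimes> x [^] (j + Suc k)"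
      using Suc.prems by (auto simp: L_def simp del: nat_pow_Suc elim: adjoinE)
    let ?x = "x [^] Suc k"
    have c: "i \<in> carrier R" "i' \<in> carrier R" "?x \<in> carrier R" using ps ps' Pc xc by auto
    have jx: "x [^] (j + Suc k) = x [^] j \<otimes> ?x" using xc nat_pow_mult[of x j "Suc k"] by simp
    have "(s \<otimes> y \<ominus> s' \<otimes> x [^] j) \<otimes> ?x = (s \<otimes> ?x) \<otimes> y \<ominus> s' \<otimes> (x [^] j \<otimes> ?x)"
    proof -
      have "(s \<otimes> y) \<otimes> ?x = (s \<otimes> ?x) \<otimes> y" "(s' \<otimes> x [^] j) \<otimes> ?x = s' \<otimes> (x [^] j \<otimes> ?x)"
        using ps(2) ps'(2) c yc xc by (simp_all add: m_ac del: nat_pow_Suc)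
      thus ?thesis using ps(2) ps'(2) c yc xc by (simp add: a_minus_def l_distr l_minus del: nat_pow_Suc)
    qed
    also have "(s \<otimes> ?x) \<otimes> y = r \<otimes> y \<ominus> i \<otimes> y"
      unfolding ps(3) using ps(2) c yc add_diff_cancel[of "i \<otimes> y" "(s \<otimes> ?x) \<otimes> y"]
      by (simp add: l_distr del: nat_pow_Suc)
    also have "r \<otimes> y \<ominus> i \<otimes> y \<ominus> s' \<otimes> (x [^] j \<otimes> ?x) = i' \<ominus> i \<otimes> y"
    proof -
      have "r \<otimes> y = s' \<otimes> (x [^] j \<otimes> ?x) \<oplus> i'" using ps'(3) jx ps'(2) c xc by (simp add: a_comm del: nat_pow_Suc)
      moreover have "(B \<oplus> a) \<ominus> b \<ominus> B = a \<ominus> b" if "a \<in> carrier R" "b \<in> carrier R" "B \<in> carrier R" for a b B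
        using that add_diff_cancel[of B "a \<ominus> b"] by (simp add: a_minus_def a_assoc)
      ultimately show ?thesis using ps'(2) c yc xc by (simp del: nat_pow_Suc)
    qed
    also have "\<dots> \<in> P" using ps ps' yc Pi by (simp add: idl_diff idl_rmult)
    finally have "s \<otimes> y \<ominus> s' \<otimes> x [^] j \<in> P"
      using prime_cancel[OF P _ xk, of "Suc k" "s \<otimes> y \<ominus> s' \<otimes> x [^] j"] ps ps' yc xc by simp
    hence "(s \<otimes> y \<ominus> s' \<otimes> x [^] j) \<oplus> s' \<otimes> x [^] j \<in> L j" unfolding L_def using ps' by (intro adjoinI)
    hence "s \<otimes> y \<in> L j" using ps ps' yc xc by (simp add: a_minus_def a_assoc l_neg)
    hence "s \<in> L 1" using base ps by blast
    hence "s \<otimes> ?x \<in> L (Suc (Suc k))" using col[of "Suc k"] by (auto simp: colon_def)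
    thus ?case unfolding ps(3) using ps L(2)[of "Suc (Suc k)"] L(1) by (intro idl_add) auto
  qed
  define Y where "Y k = adjoin (L k) y" for k
  have Y: "ideal (Y k) R" "L k \<subseteq> Y k" for k
    unfolding Y_def using adjoin_ideal[OF L(1) yc] adjoin_sub[OF L(1) yc] by auto
  have Yprim: "M_primary (Y k)" for k using prim[OF Y(1), of k k] Y(2)[of k] L by blast
  have Ystrict: "Y (Suc k) \<subset> Y k" for k
  proof
    show "Y (Suc k) \<subseteq> Y k" unfolding Y_def using Lmono[of k 1] by (simp add: adjoin_mono)
    have "x [^] k \<notin> Y (Suc k)"
    proof
      assume "x [^] k \<in> Y (Suc k)"
      then obtain l r where lr: "l \<in> L (Suc k)" "r \<in> carrier R" "x [^] k = l \<oplus> r \<otimes> y"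
        unfolding Y_def by (rule adjoinE)
      obtain i s where ps: "i \<in> P" "s \<in> carrier R" "l = i \<oplus> s \<otimes> x [^] Suc k"
        using lr(1) unfolding L_def by (rule adjoinE)
      have ic: "i \<in> carrier R" using ps Pc by blast
      have "(\<one> \<ominus> s \<otimes> x) \<otimes> x [^] k = x [^] k \<ominus> s \<otimes> x [^] Suc k"
        using ps xc by (simp add: a_minus_def l_distr l_minus m_assoc m_comm[of x])
      also have "\<dots> = (i \<oplus> s \<otimes> x [^] Suc k \<oplus> r \<otimes> y) \<ominus> s \<otimes> x [^] Suc k" using lr(3) ps(3) by simp
      also have "\<dots> = i \<oplus> r \<otimes> y"
        using ic ps(2) lr(2) yc xc by (simp add: a_minus_def a_ac r_neg1 r_neg del: nat_pow_Suc)
      also have "\<dots> \<in> P'" using ps P' lr y P'i by (auto intro!: idl_add idl_lmult)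
      finally have "x [^] k \<in> P'" using cancel_one_minus[OF idl_lmult[OF M_ideal x ps(2)] P'i] xc by simp
      thus False using prime_pow[OF P'(1) xc] xP' by blast
    qed
    thus "Y (Suc k) \<noteq> Y k" using Y(2)[of k] L(3)[of k] by blast
  qed
  have Ylen: "(simple_step ^^ n) (Y k) (carrier R) \<Longrightarrow> k \<le> n" for n k
  proof (induction k arbitrary: n)
    case (Suc k)
    obtain i where "i < n" "(simple_step ^^ i) (Y k) (carrier R)"
      using steps_less[OF Suc.prems Y(1) Y(1) Ystrict Yprim] by blast
    thus ?case using Suc.IH[of i] by simp
  qed simp
  \<comment> \<open>For this k the lower bound j + k for the length of R/Y (j + k) exceeds the upper bound j C.\<close>
  define k where "k = Suc (j * C)"
  let ?D = "colon R (L (j + k)) y"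
  have D: "ideal ?D R" "L (j + k) \<subseteq> ?D" using colon_ideal[OF L(1) yc] colon_sup[OF L(1) yc] by auto
  have Dprim: "M_primary ?D" using prim[OF D(1), of "j + k"] D(2) L by blast
  obtain c where c: "(simple_step ^^ c) ?D (carrier R)"
    using exists_steps[OF D(1) oneideal idl_sub[OF D(1)] Dprim] by blast
  have "?D \<subseteq> L k" using shift[of _ k] Lmono[of k 1] by (auto simp: colon_def)
  then obtain i where "i \<le> c" "(simple_step ^^ i) (L k) (carrier R)"
    using steps_mono[OF c D(1) oneideal L(1) _ idl_sub[OF L(1)]] by blast
  hence kc: "k * C \<le> c" using Jordan_Hoelder len by blast
  obtain d where d: "(simple_step ^^ d) (Y (j + k)) (carrier R)"
    using exists_steps[OF Y(1) oneideal idl_sub[OF Y(1)] Yprim] by blast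
  have "(simple_step ^^ (c + d)) (L (j + k)) (carrier R)"
    using relpowp_trans[OF steps_adjoin[OF L(1) yc c]] d by (simp add: Y_def)
  hence "c + d = (j + k) * C" using Jordan_Hoelder len by blast
  hence "d \<le> j * C" using kc by (simp add: algebra_simps)
  thus False using Ylen[OF d] by (simp add: k_def)
qed

end

section \<open>Ideals of a localization\<close>

context mult_closed begin

abbreviation "L \<equiv> localization R S"

abbreviation "fr \<equiv> loc_frac R S"

lemma L_one: "\<one>\<^bsub>L\<^esub> = fr \<one> \<one>" and L_zero: "\<zero>\<^bsub>L\<^esub> = fr \<zero> \<one>"
  by (simp_all add: localization_def)

lemma fr_carr: "a \<in> carrier R \<Longrightarrow> s \<in> S \<Longrightarrow> fr a s \<in> carrier L"
  by (auto simp: carrier_localization)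

lemma fr_cases:
  assumes "z \<in> carrier L" obtains a s where "a \<in> carrier R" "s \<in> S" "z = fr a s"
  using assms by (auto simp: carrier_localization)

lemma fr_cancel: "a \<in> carrier R \<Longrightarrow> s \<in> S \<Longrightarrow> u \<in> S \<Longrightarrow> fr (u \<otimes> a) (u \<otimes> s) = fr a s"
  by (subst frac_eq_iff) (use S_one in \<open>auto simp: S_carr S_mult m_ac\<close>)

lemma fr_pow: "a \<in> carrier R \<Longrightarrow> s \<in> S \<Longrightarrow> fr a s [^]\<^bsub>L\<^esub> (n::nat) = fr (a [^] n) (s [^] n) \<and> s [^] n \<in> S"
  by (induction n) (auto simp: L_one nat_pow_def S_one localization_mult S_mult simp flip: nat_pow_def)

definition extend :: "'a set \<Rightarrow> ('a \<times> 'a) set set"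
  where "extend K = {fr a s | a s. a \<in> K \<and> s \<in> S}"

definition contract :: "('a \<times> 'a) set set \<Rightarrow> 'a set"
  where "contract I = {a \<in> carrier R. fr a \<one> \<in> I}"

lemma mem_extend:
  assumes K: "ideal K R" and a: "a \<in> carrier R" and s: "s \<in> S"
  shows "fr a s \<in> extend K \<longleftrightarrow> (\<exists>u\<in>S. u \<otimes> a \<in> K)"
proof
  assume "fr a s \<in> extend K"
  then obtain b t where b: "b \<in> K" "t \<in> S" "fr a s = fr b t" by (auto simp: extend_def)
  have bc: "b \<in> carrier R" using b idl_carr[OF K] by blast
  then obtain u where u: "u \<in> S" "u \<otimes> (a \<otimes> t) = u \<otimes> (b \<otimes> s)" using b a s by (auto simp: frac_eq_iff)
  have "(u \<otimes> t) \<otimes> a = u \<otimes> (a \<otimes> t)" using u b a S_carr by (simp add: m_ac)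
  also have "\<dots> = (u \<otimes> s) \<otimes> b" using u(1) unfolding u(2) using s bc S_carr by (simp add: m_ac)
  also have "\<dots> \<in> K" using K b s u S_carr by (simp add: idl_lmult)
  finally show "\<exists>u\<in>S. u \<otimes> a \<in> K" using S_mult u b by blast
next
  assume "\<exists>u\<in>S. u \<otimes> a \<in> K"
  then obtain u where "u \<in> S" "u \<otimes> a \<in> K" by blast
  thus "fr a s \<in> extend K" using fr_cancel[OF a s] s S_mult unfolding extend_def by blast
qed

lemma extend_ideal:
  assumes K: "ideal K R" shows "ideal (extend K) L"
proof -
  interpret L: cring L by (rule localization_cring)
  note c = idl_carr[OF K]
  show ?thesis
  proof (rule L.ring_idealI)
    show "extend K \<subseteq> carrier L" by (auto simp: extend_def intro: fr_carr c)
    show "\<zero>\<^bsub>L\<^esub> \<in> extend K" unfolding L_zero extend_def using idl_zero[OF K] S_one by blast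
    fix x assume "x \<in> extend K"
    then obtain a s where x: "a \<in> K" "s \<in> S" "x = fr a s" by (auto simp: extend_def)
    { fix y assume "y \<in> extend K"
      then obtain b t where y: "b \<in> K" "t \<in> S" "y = fr b t" by (auto simp: extend_def)
      have "x \<oplus>\<^bsub>L\<^esub> y = fr (a \<otimes> t \<oplus> b \<otimes> s) (s \<otimes> t)" using x y c by (simp add: localization_add)
      moreover have "a \<otimes> t \<oplus> b \<otimes> s \<in> K" using x y K S_carr by (simp add: idl_add idl_rmult)
      ultimately show "x \<oplus>\<^bsub>L\<^esub> y \<in> extend K" unfolding extend_def using x y S_mult by blast }
    fix r assume "r \<in> carrier L"
    then obtain b t where r: "b \<in> carrier R" "t \<in> S" "r = fr b t" by (rule fr_cases)
    have "r \<otimes>\<^bsub>L\<^esub> x = fr (b \<otimes> a) (t \<otimes> s)" using x r c by (simp add: localization_mult)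
    thus "r \<otimes>\<^bsub>L\<^esub> x \<in> extend K" unfolding extend_def using x r S_mult idl_lmult[OF K] by blast
  qed
qed

lemma contract_ideal:
  assumes I: "ideal I L" shows "ideal (contract I) R"
proof (rule ring_idealI)
  interpret L: cring L by (rule localization_cring)
  show "contract I \<subseteq> carrier R" by (auto simp: contract_def)
  show "\<zero> \<in> contract I" using L.idl_zero[OF I] by (simp add: contract_def L_zero)
  fix x y assume x: "x \<in> contract I"
  { assume y: "y \<in> contract I"
    have "fr (x \<oplus> y) \<one> = fr x \<one> \<oplus>\<^bsub>L\<^esub> fr y \<one>" using x y S_one by (simp add: localization_add contract_def)
    thus "x \<oplus> y \<in> contract I" using x y L.idl_add[OF I] by (simp add: contract_def) }
  { fix r assume r: "r \<in> carrier R"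
    have "fr (r \<otimes> x) \<one> = fr r \<one> \<otimes>\<^bsub>L\<^esub> fr x \<one>" using x r S_one by (simp add: localization_mult contract_def)
    thus "r \<otimes> x \<in> contract I" using x r L.idl_lmult[OF I] S_one by (simp add: contract_def fr_carr) }
qed

lemma fr_in_iff:
  assumes I: "ideal I L" and a: "a \<in> carrier R" and s: "s \<in> S"
  shows "fr a s \<in> I \<longleftrightarrow> a \<in> contract I"
proof -
  interpret L: cring L by (rule localization_cring)
  have 1: "fr a \<one> = fr s \<one> \<otimes>\<^bsub>L\<^esub> fr a s"
    using a s S_one S_carr fr_cancel[OF a S_one s] by (simp add: localization_mult)
  have 2: "fr a s = fr \<one> s \<otimes>\<^bsub>L\<^esub> fr a \<one>"
    using a s S_one S_carr by (simp add: localization_mult)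
  show ?thesis
  proof
    assume "fr a s \<in> I"
    thus "a \<in> contract I" using 1 L.idl_lmult[OF I] fr_carr[of s \<one>] s S_one S_carr a by (simp add: contract_def)
  next
    assume "a \<in> contract I"
    thus "fr a s \<in> I" using 2 L.idl_lmult[OF I, of "fr a \<one>" "fr \<one> s"] fr_carr[of \<one> s] s by (simp add: contract_def)
  qed
qed

lemma extend_contract: "ideal I L \<Longrightarrow> extend (contract I) = I"
proof
  assume I: "ideal I L"
  interpret L: cring L by (rule localization_cring)
  show "extend (contract I) \<subseteq> I" using fr_in_iff[OF I] idl_carr[OF contract_ideal[OF I]] by (auto simp: extend_def)
  show "I \<subseteq> extend (contract I)"
  proof
    fix z assume z: "z \<in> I"
    obtain a s where "a \<in> carrier R" "s \<in> S" "z = fr a s" using fr_cases[OF L.idl_carr[OF I z]] .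
    thus "z \<in> extend (contract I)" using fr_in_iff[OF I] z unfolding extend_def by blast
  qed
qed

lemma extend_sub: "ideal K R \<Longrightarrow> ideal I L \<Longrightarrow> K \<subseteq> contract I \<Longrightarrow> extend K \<subseteq> I"
  using fr_in_iff idl_carr by (auto simp: extend_def)

lemma extend_mono: "K \<subseteq> K' \<Longrightarrow> extend K \<subseteq> extend K'" by (auto simp: extend_def)

lemma contract_mono: "I \<subseteq> I' \<Longrightarrow> contract I \<subseteq> contract I'" by (auto simp: contract_def)

lemma sub_contract_extend: "ideal K R \<Longrightarrow> K \<subseteq> contract (extend K)"
  using S_one by (auto simp: contract_def extend_def intro: idl_carr)

lemma localization_noetherian:
  assumes "noetherian_ring R" shows "noetherian_ring L"
proof -
  interpret L: cring L by (rule localization_cring)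
  show ?thesis
  proof (rule L.noetherian_ringI)
    fix I assume I: "ideal I L"
    obtain A where A: "A \<subseteq> carrier R" "finite A" "contract I = Idl A"
      using noetherian_ring.finetely_gen[OF assms contract_ideal[OF I]] by blast
    let ?A = "(\<lambda>a. fr a \<one>) ` A"
    have A': "?A \<subseteq> carrier L" using A S_one by (auto intro: fr_carr)
    have Ai: "ideal (Idl\<^bsub>L\<^esub> ?A) L" by (rule L.genideal_ideal[OF A'])
    have "A \<subseteq> contract (Idl\<^bsub>L\<^esub> ?A)" using A L.genideal_self[OF A'] by (auto simp: contract_def)
    hence "contract I \<subseteq> contract (Idl\<^bsub>L\<^esub> ?A)" unfolding A(3) by (intro genideal_minimal contract_ideal Ai)
    hence "I \<subseteq> Idl\<^bsub>L\<^esub> ?A" using extend_sub[OF contract_ideal[OF I] Ai] extend_contract[OF I] by simp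
    moreover have "Idl\<^bsub>L\<^esub> ?A \<subseteq> I"
      using A genideal_self[OF A(1)] by (intro L.genideal_minimal[OF I]) (auto simp: contract_def)
    ultimately show "\<exists>A\<subseteq>carrier L. finite A \<and> I = Idl\<^bsub>L\<^esub> A"
      using A' A(2) by (intro exI[of _ ?A]) auto
  qed
qed

lemma localization_frob_exp:
  assumes "frob_exp q" shows "cring.frob_exp L q"
proof -
  interpret L: cring L by (rule localization_cring)
  show ?thesis unfolding L.frob_exp_def
  proof (intro conjI ballI)
    show "0 < q" using assms by (rule frob_exp_pos)
    fix x y assume "x \<in> carrier L" "y \<in> carrier L"
    then obtain a s b t where *: "a \<in> carrier R" "s \<in> S" "x = fr a s" "b \<in> carrier R" "t \<in> S" "y = fr b t"
      by (meson fr_cases)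
    have c: "s \<in> carrier R" "t \<in> carrier R" using * S_carr by auto
    have "(x \<oplus>\<^bsub>L\<^esub> y) [^]\<^bsub>L\<^esub> q = fr ((a \<otimes> t \<oplus> b \<otimes> s) [^] q) ((s \<otimes> t) [^] q)"
      using * c by (simp add: localization_add fr_pow S_mult)
    also have "\<dots> = fr (a [^] q) (s [^] q) \<oplus>\<^bsub>L\<^esub> fr (b [^] q) (t [^] q)"
      using * c fr_pow[of a s q] fr_pow[of b t q]
      by (simp add: localization_add frob_exp_add[OF assms] nat_pow_distrib)
    also have "\<dots> = x [^]\<^bsub>L\<^esub> q \<oplus>\<^bsub>L\<^esub> y [^]\<^bsub>L\<^esub> q" using * by (simp add: fr_pow)
    finally show "(x \<oplus>\<^bsub>L\<^esub> y) [^]\<^bsub>L\<^esub> q = x [^]\<^bsub>L\<^esub> q \<oplus>\<^bsub>L\<^esub> y [^]\<^bsub>L\<^esub> q" .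
  qed
qed

lemma prime_contract:
  assumes Q: "primeideal Q L" shows "primeideal (contract Q) R" "contract Q \<inter> S = {}"
proof -
  interpret L: cring L by (rule localization_cring)
  have I: "ideal Q L" using Q by (rule L.primeideal_ideal)
  have 1: "\<one>\<^bsub>L\<^esub> \<notin> Q" by (rule L.prime_one[OF Q])
  show "contract Q \<inter> S = {}"
  proof (rule ccontr)
    assume "\<not> ?thesis"
    then obtain s where s: "s \<in> contract Q" "s \<in> S" by blast
    hence "fr s s \<in> Q" using fr_in_iff[OF I] S_carr by blast
    moreover have "fr s s = \<one>\<^bsub>L\<^esub>" using fr_cancel[of \<one> \<one> s] s S_one S_carr by (simp add: L_one)
    ultimately show False using 1 by simp
  qed
  show "primeideal (contract Q) R"
  proof (rule primeidealI[OF contract_ideal[OF I] is_cring])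
    show "carrier R \<noteq> contract Q" using \<open>contract Q \<inter> S = {}\<close> S_one by auto
    fix a b assume ab: "a \<in> carrier R" "b \<in> carrier R" "a \<otimes> b \<in> contract Q"
    have "fr a \<one> \<otimes>\<^bsub>L\<^esub> fr b \<one> \<in> Q" using ab S_one by (simp add: localization_mult contract_def)
    thus "a \<in> contract Q \<or> b \<in> contract Q"
      using primeideal.I_prime[OF Q, of "fr a \<one>" "fr b \<one>"] ab S_one by (auto simp: contract_def fr_carr)
  qed
qed

lemma contract_extend_prime:
  assumes Q: "primeideal Q R" "Q \<inter> S = {}" shows "contract (extend Q) = Q"
proof -
  have I: "ideal Q R" using Q by (simp add: primeideal_ideal)
  have "contract (extend Q) \<subseteq> Q"
  proof
    fix a assume a: "a \<in> contract (extend Q)"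
    then obtain u where u: "u \<in> S" "u \<otimes> a \<in> Q" using mem_extend[OF I _ S_one] by (auto simp: contract_def)
    have "a \<in> carrier R" using a by (simp add: contract_def)
    thus "a \<in> Q" using primeideal.I_prime[OF Q(1), of u a] u Q S_carr by blast
  qed
  thus ?thesis using sub_contract_extend[OF I] by blast
qed

lemma prime_extend:
  assumes Q: "primeideal Q R" "Q \<inter> S = {}" shows "primeideal (extend Q) L"
proof -
  interpret L: cring L by (rule localization_cring)
  have I: "ideal Q R" using Q by (simp add: primeideal_ideal)
  show ?thesis
  proof (rule primeidealI[OF extend_ideal[OF I] localization_cring])
    have "\<one> \<notin> contract (extend Q)" using contract_extend_prime[OF Q] prime_one[OF Q(1)] by simp
    thus "carrier L \<noteq> extend Q" using fr_carr[OF one_closed S_one] by (auto simp: contract_def)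
    fix x y assume "x \<in> carrier L" "y \<in> carrier L" and m: "x \<otimes>\<^bsub>L\<^esub> y \<in> extend Q"
    then obtain a s b t where *: "a \<in> carrier R" "s \<in> S" "x = fr a s" "b \<in> carrier R" "t \<in> S" "y = fr b t"
      by (meson fr_cases)
    hence "fr (a \<otimes> b) (s \<otimes> t) \<in> extend Q" using m by (simp add: localization_mult)
    hence "a \<otimes> b \<in> Q" using fr_in_iff[OF extend_ideal[OF I]] contract_extend_prime[OF Q] * S_mult by auto
    hence "a \<in> Q \<or> b \<in> Q" using primeideal.I_prime[OF Q(1)] * by blast
    thus "x \<in> extend Q \<or> y \<in> extend Q" using * by (auto simp: extend_def)
  qed
qed

lemma extend_inter:
  assumes I: "ideal I R" and K: "ideal K R" shows "extend (I \<inter> K) = extend I \<inter> extend K"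
proof
  show "extend (I \<inter> K) \<subseteq> extend I \<inter> extend K" by (auto simp: extend_def)
  show "extend I \<inter> extend K \<subseteq> extend (I \<inter> K)"
  proof
    fix z assume z: "z \<in> extend I \<inter> extend K"
    then obtain a s where a: "a \<in> I" "s \<in> S" "z = fr a s" by (auto simp: extend_def)
    have ac: "a \<in> carrier R" using a idl_carr[OF I] by blast
    then obtain u where "u \<in> S" "u \<otimes> a \<in> K" using z a mem_extend[OF K ac a(2)] by auto
    thus "z \<in> extend (I \<inter> K)"
      using mem_extend[OF i_intersect[OF I K] ac a(2)] a idl_lmult[OF I] S_carr by blast
  qed
qed

lemma extend_PIdl:
  assumes x: "x \<in> carrier R" and s: "s \<in> S" shows "PIdl\<^bsub>L\<^esub> (fr x s) = extend (PIdl x)"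
proof
  interpret L: cring L by (rule localization_cring)
  show "PIdl\<^bsub>L\<^esub> (fr x s) \<subseteq> extend (PIdl x)"
    using cgenideal_self[OF x] s by (intro L.cgenideal_minimal extend_ideal cgenideal_ideal x) (auto simp: extend_def)
  show "extend (PIdl x) \<subseteq> PIdl\<^bsub>L\<^esub> (fr x s)"
  proof
    fix z assume "z \<in> extend (PIdl x)"
    then obtain c t where c: "c \<in> carrier R" "t \<in> S" "z = fr (c \<otimes> x) t" by (auto simp: extend_def PIdl_iff)
    have "z = fr (s \<otimes> (c \<otimes> x)) (s \<otimes> t)" using c x s by (simp add: fr_cancel)
    also have "\<dots> = fr (c \<otimes> s) t \<otimes>\<^bsub>L\<^esub> fr x s"
      using c x s S_carr by (simp add: localization_mult m_ac)
    finally show "z \<in> PIdl\<^bsub>L\<^esub> (fr x s)" using c s S_carr fr_carr[of "c \<otimes> s" t] by (auto simp: L.PIdl_iff)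
  qed
qed

lemma extend_colon:
  assumes I: "ideal I R" and u: "u \<in> carrier R" shows "colon L (extend I) (fr u \<one>) = extend (colon R I u)"
proof -
  note C = colon_ideal[OF I u]
  have m: "fr a s \<otimes>\<^bsub>L\<^esub> fr u \<one> = fr (a \<otimes> u) s" if "a \<in> carrier R" "s \<in> S" for a s
    using that u S_one S_carr by (simp add: localization_mult)
  show ?thesis
  proof
    show "colon L (extend I) (fr u \<one>) \<subseteq> extend (colon R I u)"
    proof
      fix z assume z: "z \<in> colon L (extend I) (fr u \<one>)"
      then obtain a s where a: "a \<in> carrier R" "s \<in> S" "z = fr a s" by (auto simp: colon_def elim: fr_cases)
      hence "fr (a \<otimes> u) s \<in> extend I" using z m by (auto simp: colon_def)
      then obtain v where v: "v \<in> S" "v \<otimes> (a \<otimes> u) \<in> I" using mem_extend[OF I _ a(2)] a u by auto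
      hence "v \<otimes> a \<in> colon R I u" using a u S_carr by (simp add: colon_def m_assoc)
      thus "z \<in> extend (colon R I u)" using mem_extend[OF C a(1,2)] v a by blast
    qed
    show "extend (colon R I u) \<subseteq> colon L (extend I) (fr u \<one>)"
      using m by (auto simp: extend_def colon_def fr_carr) blast
  qed
qed

lemma extend_bracket:
  assumes I: "ideal I R" shows "bracket_power L (extend I) q = extend (bracket_power R I q)"
proof
  interpret L: cring L by (rule localization_cring)
  note c = idl_carr[OF I] and eI = extend_ideal[OF I]
  show "bracket_power L (extend I) q \<subseteq> extend (bracket_power R I q)"
  proof (rule L.bracket_least[OF extend_ideal[OF bracket_ideal[OF I]]])
    fix z assume "z \<in> extend I"
    then obtain a s where "a \<in> I" "s \<in> S" "z = fr a s" by (auto simp: extend_def)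
    thus "z [^]\<^bsub>L\<^esub> q \<in> extend (bracket_power R I q)"
      using fr_pow[of a s q] bracket_pow[OF I, of a q] c by (auto simp: extend_def)
  qed
  have "a [^] q \<in> contract (bracket_power L (extend I) q)" if a: "a \<in> I" for a
  proof -
    have "fr a \<one> \<in> extend I" using a S_one by (auto simp: extend_def)
    from L.bracket_pow[OF eI this, of q] show ?thesis
      using fr_pow[OF c[OF a] S_one, of q] c[OF a] by (simp add: contract_def)
  qed
  hence "bracket_power R I q \<subseteq> contract (bracket_power L (extend I) q)"
    by (intro bracket_least contract_ideal L.bracket_ideal eI)
  thus "extend (bracket_power R I q) \<subseteq> bracket_power L (extend I) q"
    by (intro extend_sub bracket_ideal L.bracket_ideal I eI)
qed

end

lemma (in primeideal) localization_local:
  assumes "noetherian_ring R"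
  shows "local_noeth (localization R (carrier R - I)) (mult_closed.extend R (carrier R - I) I)"
proof -
  interpret mc: mult_closed R "carrier R - I" by (rule mult_closed_compl)
  interpret L: cring mc.L by (rule mc.localization_cring)
  interpret nL: noetherian_ring mc.L by (rule mc.localization_noetherian[OF assms])
  have P: "primeideal I R" by (rule primeideal)
  have eP: "primeideal (mc.extend I) mc.L" by (rule mc.prime_extend[OF P]) auto
  have top: "J \<subseteq> mc.extend I" if J: "ideal J mc.L" "\<one>\<^bsub>mc.L\<^esub> \<notin> J" for J
  proof -
    have "mc.contract J \<subseteq> I"
    proof (rule ccontr)
      assume "\<not> mc.contract J \<subseteq> I"
      then obtain s where s: "s \<in> mc.contract J" "s \<in> carrier R - I" by (auto simp: mc.contract_def)
      hence "mc.fr s s \<in> J" using mc.fr_in_iff[OF J(1)] by blast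
      moreover have "mc.fr s s = \<one>\<^bsub>mc.L\<^esub>" using mc.fr_cancel[of \<one> \<one> s] s mc.S_one by (simp add: mc.L_one)
      ultimately show False using J by simp
    qed
    thus ?thesis using mc.extend_mono mc.extend_contract[OF J(1)] by blast
  qed
  have nc: "\<one>\<^bsub>mc.L\<^esub> \<notin> N" if "maximalideal N mc.L" for N
    using that ideal.one_imp_carrier[of N mc.L] by (auto simp: maximalideal_def maximalideal_axioms_def)
  have max: "maximalideal (mc.extend I) mc.L"
  proof (rule maximalidealI)
    show "ideal (mc.extend I) mc.L" "carrier mc.L \<noteq> mc.extend I"
      using L.primeideal_ideal[OF eP] primeideal.I_notcarr[OF eP] by auto
    fix J assume "ideal J mc.L" "mc.extend I \<subseteq> J"
    thus "J = mc.extend I \<or> J = carrier mc.L" using top[of J] ideal.one_imp_carrier[of J mc.L] by blast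
  qed
  show ?thesis
  proof (intro local_noeth.intro noeth_cring.intro local_noeth_axioms.intro L.cring_axioms nL.noetherian_ring_axioms)
    show "maximalideal (mc.extend I) mc.L" by (rule max)
    fix N assume N: "maximalideal N mc.L"
    have "N \<subseteq> mc.extend I" using top nc[OF N] N by (auto simp: maximalideal_def)
    thus "N = mc.extend I"
      using maximalideal.I_maximal[OF N, of "mc.extend I"] L.primeideal_ideal[OF eP] primeideal.I_notcarr[OF eP]
        L.idl_sub by blast
  qed
qed

section \<open>Chains of primes and heights\<close>

context noeth_cring begin

theorem principal_ideal_theorem:
  assumes "primeideal P R" "primeideal P' R" "primeideal N R" "P \<subset> P'" "P' \<subset> N" "x \<in> N"
  shows "\<exists>Q. primeideal Q R \<and> P \<subset> Q \<and> Q \<subset> N \<and> x \<in> Q"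
proof (cases "x \<in> P")
  case True
  thus ?thesis using assms by blast
next
  case False
  interpret N: primeideal N R by fact
  interpret mc: mult_closed R "carrier R - N" by (rule N.mult_closed_compl)
  interpret L: local_noeth mc.L "mc.extend N" by (rule N.localization_local[OF noetherian_ring_axioms])
  have xc: "x \<in> carrier R" using assms N.Icarr by blast
  have d: "P \<inter> (carrier R - N) = {}" "P' \<inter> (carrier R - N) = {}" "N \<inter> (carrier R - N) = {}" using assms by auto
  note ce = mc.contract_extend_prime[OF assms(1) d(1)] mc.contract_extend_prime[OF assms(2) d(2)] mc.contract_extend_prime[OF assms(3) d(3)]
  note pe = mc.prime_extend[OF assms(1) d(1)] mc.prime_extend[OF assms(2) d(2)]
  have "mc.extend P \<subset> mc.extend P'" "mc.extend P' \<subset> mc.extend N"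
    using mc.extend_mono[of P P'] mc.extend_mono[of P' N] assms(4,5) ce by (metis psubset_eq)+
  moreover have "mc.fr x \<one> \<in> mc.extend N" using assms mc.S_one by (auto simp: mc.extend_def)
  ultimately obtain Q where Q: "primeideal Q mc.L" "mc.extend P \<subseteq> Q" "mc.fr x \<one> \<in> Q" "Q \<noteq> mc.extend N"
    using L.local_principal_ideal_theorem[OF pe] by blast
  have Qi: "ideal Q mc.L" using Q L.primeideal_ideal by blast
  note pc = mc.prime_contract[OF Q(1)]
  have "P \<subseteq> mc.contract Q" using mc.contract_mono[OF Q(2)] ce by simp
  moreover have xQ: "x \<in> mc.contract Q" using Q xc by (simp add: mc.contract_def)
  moreover have "mc.contract Q \<subseteq> N" using pc(2) by (auto simp: mc.contract_def)
  moreover have "mc.contract Q \<noteq> N" using mc.extend_contract[OF Qi] Q(4) by auto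
  ultimately show ?thesis using pc(1) False by blast
qed

definition prime_step :: "'a set \<Rightarrow> 'a set \<Rightarrow> bool"
  where "prime_step P Q \<longleftrightarrow> primeideal P R \<and> primeideal Q R \<and> P \<subset> Q"

lemma prime_steps_sub: "(prime_step ^^ n) P Q \<Longrightarrow> P \<subseteq> Q"
  by (induction n arbitrary: Q) (auto simp: prime_step_def, blast)

text \<open>From the top downwards, \<open>principal_ideal_theorem\<close> replaces the members of the chain by primes
  that contain x.\<close>
lemma chain_through:
  assumes "(prime_step ^^ Suc d) P N" "x \<in> N"
  shows "\<exists>Q. primeideal Q R \<and> P \<subseteq> Q \<and> x \<in> Q \<and> (prime_step ^^ d) Q N"
  using assms(1)
proof (induction d arbitrary: P)
  case 0
  thus ?case using assms(2) by (intro exI[of _ N]) (auto simp: eq_OO prime_step_def)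
next
  case (Suc d)
  obtain P1 where P1: "prime_step P P1" "(prime_step ^^ Suc d) P1 N" using relpowp_Suc_D2[OF Suc.prems] by blast
  obtain Q1 where Q1: "primeideal Q1 R" "P1 \<subseteq> Q1" "x \<in> Q1" "(prime_step ^^ d) Q1 N" using Suc.IH[OF P1(2)] by blast
  show ?case
  proof (cases "P1 = Q1")
    case True
    hence "primeideal P1 R \<and> P \<subseteq> P1 \<and> x \<in> P1" using P1(1) Q1 by (auto simp: prime_step_def)
    thus ?thesis using P1(2) by blast
  next
    case False
    then obtain Q where "primeideal Q R" "P \<subset> Q" "Q \<subset> Q1" "x \<in> Q"
      using principal_ideal_theorem[of P P1 Q1 x] P1(1) Q1 by (auto simp: prime_step_def)
    moreover from this have "prime_step Q Q1" using Q1(1) by (simp add: prime_step_def)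
    ultimately show ?thesis using relpowp_Suc_I2[OF _ Q1(4)] by blast
  qed
qed

text \<open>Krull's height theorem: absorbing an element of B into the lowest prime costs at most one
  step of the chain.\<close>
lemma height_le_card:
  assumes "finite B" "B \<subseteq> carrier R" "ideal P R" "N = Idl (P \<union> B)" "(prime_step ^^ k) P N"
  shows "k \<le> card B"
  using assms
proof (induction B arbitrary: P k rule: finite_induct)
  case empty
  hence "N = P" by (simp add: Idl_ideal)
  show ?case
  proof (cases k)
    case (Suc n)
    then obtain P1 where "prime_step P P1" "(prime_step ^^ n) P1 N" using empty relpowp_Suc_D2 by metis
    thus ?thesis using prime_steps_sub[of n P1 N] \<open>N = P\<close> by (auto simp: prime_step_def)
  qed simp
next
  case (insert x B)
  have PB: "P \<union> insert x B \<subseteq> carrier R" using insert.prems idl_sub by auto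
  note N = genideal_ideal[OF PB] genideal_self[OF PB]
  show ?case
  proof (cases k)
    case (Suc n)
    obtain Q where Q: "primeideal Q R" "P \<subseteq> Q" "x \<in> Q" "(prime_step ^^ n) Q N"
      using chain_through[of n P N x] insert.prems N Suc by auto
    have Qi: "ideal Q R" by (rule primeideal_ideal[OF Q(1)])
    have QB: "Q \<union> B \<subseteq> carrier R" using idl_sub[OF Qi] insert.prems by auto
    have "N = Idl (Q \<union> B)"
    proof
      show "N \<subseteq> Idl (Q \<union> B)" unfolding insert.prems(3) using Q QB by (intro subset_Idl_subset) auto
      show "Idl (Q \<union> B) \<subseteq> N"
        using prime_steps_sub[OF Q(4)] N unfolding insert.prems(3) by (intro genideal_minimal) auto
    qed
    hence "n \<le> card B" using insert.IH[of Q n] Q Qi insert.prems by auto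
    thus ?thesis using Suc insert by simp
  qed simp
qed

lemma chain_above:
  assumes "finite C" "C \<subseteq> N" "primeideal P R" "(prime_step ^^ (k + card C)) P N"
  shows "\<exists>Q. primeideal Q R \<and> P \<subseteq> Q \<and> C \<subseteq> Q \<and> (prime_step ^^ k) Q N"
  using assms
proof (induction C arbitrary: P rule: finite_induct)
  case (insert x C)
  have "(prime_step ^^ Suc (k + card C)) P N" using insert by simp
  then obtain Q where Q: "primeideal Q R" "P \<subseteq> Q" "x \<in> Q" "(prime_step ^^ (k + card C)) Q N"
    using chain_through[of "k + card C" P N x] insert.prems by blast
  have "C \<subseteq> N" using insert.prems by blast
  from insert.IH[OF this Q(1,4)] show ?case using Q(2,3) by blast
qed auto

end

section \<open>Regular local rings\<close>

context local_noeth begin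

text \<open>Let Q be the prime from \<open>chain_through\<close> above P and x. The induction hypothesis for J + (x) gives
  J + (x) = Q, so an element of P has the form j + a x. The height theorem excludes x in P,
  so a is in P. Hence P is contained in J + M P, and Nakayama's lemma gives P = J.\<close>
lemma parameters_prime:
  assumes "finite B" "B \<subseteq> carrier R" "ideal J R" "M = Idl (J \<union> B)" "primeideal P R" "J \<subseteq> P"
    "(prime_step ^^ card B) P M"
  shows "J = P"
  using assms
proof (induction B arbitrary: P J rule: finite_induct)
  case empty
  thus ?case using Idl_ideal[of J] by simp
next
  case (insert x B)
  have x: "x \<in> carrier R" "B \<subseteq> carrier R" using insert by auto
  note J = insert.prems(2) and P = insert.prems(4)
  have Pi: "ideal P R" by (rule primeideal_ideal[OF P])
  have JB: "J \<union> insert x B \<subseteq> carrier R" using idl_sub[OF J] x by auto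
  have xM: "x \<in> M" using genideal_self[OF JB] insert.prems(3) by blast
  obtain Q where Q: "primeideal Q R" "P \<subseteq> Q" "x \<in> Q" "(prime_step ^^ card B) Q M"
    using chain_through[of "card B" P M x] insert xM by auto
  let ?J = "adjoin J x"
  have J1: "ideal ?J R" "J \<subseteq> ?J" "x \<in> ?J" using adjoin_ideal[OF J x(1)] adjoin_sub[OF J x(1)] adjoin_self[OF J x(1)] .
  have JQ: "?J \<subseteq> Q" using Q insert.prems by (intro adjoin_least primeideal_ideal) auto
  have M1: "M = Idl (?J \<union> B)"
  proof
    show "M \<subseteq> Idl (?J \<union> B)" unfolding insert.prems(3) using J1 idl_sub[OF J1(1)] x by (intro subset_Idl_subset) auto
    show "Idl (?J \<union> B) \<subseteq> M"
      using JQ prime_steps_sub[OF Q(4)] genideal_self[OF JB] insert.prems(3) by (intro genideal_minimal[OF M_ideal]) auto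
  qed
  have eq: "?J = Q" using insert.IH[OF x(2) J1(1) M1 Q(1) JQ Q(4)] .
  have xP: "x \<notin> P"
  proof
    assume xP: "x \<in> P"
    have "M = Idl (P \<union> B)"
    proof
      show "M \<subseteq> Idl (P \<union> B)" unfolding insert.prems(3) using insert.prems xP idl_sub[OF Pi] x by (intro subset_Idl_subset) auto
      show "Idl (P \<union> B) \<subseteq> M"
        using prime_sub_M[OF P] genideal_self[OF JB] insert.prems(3) by (intro genideal_minimal[OF M_ideal]) auto
    qed
    from height_le_card[OF insert.hyps(1) x(2) Pi this insert.prems(6)] show False using insert.hyps by simp
  qed
  have "P \<subseteq> J"
  proof (rule Nakayama[OF Pi J])
    fix K assume K: "ideal K R" "J \<subseteq> K" "\<And>a z. a \<in> M \<Longrightarrow> z \<in> P \<Longrightarrow> a \<otimes> z \<in> K"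
    show "P \<subseteq> K"
    proof
      fix y assume y: "y \<in> P"
      then obtain j a where ja: "j \<in> J" "a \<in> carrier R" "y = j \<oplus> a \<otimes> x" using Q(2) eq by (metis adjoinE subsetD)
      have c: "j \<in> carrier R" "j \<in> P" using ja insert.prems idl_carr[OF Pi] by auto
      have "a \<otimes> x \<oplus> j \<in> P" using y ja c x by (simp add: a_comm)
      hence "a \<otimes> x \<in> P" using idl_addD[OF Pi] c ja x by auto
      hence "a \<in> P" using prime_cancel[OF P x(1) xP] ja by blast
      hence "a \<otimes> x \<in> K" using K(3)[OF xM] ja x m_comm[of a x] by simp
      thus "y \<in> K" using ja K by (auto intro: idl_add)
    qed
  qed
  thus ?case using insert.prems by auto
qed

lemma parameters_subset_prime:
  assumes A: "finite A" "A \<subseteq> carrier R" "M = Idl A" and P: "primeideal P R" "(prime_step ^^ card A) P M"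
    and C: "C \<subseteq> A"
  shows "primeideal (Idl C) R" "\<And>x. x \<in> A - C \<Longrightarrow> x \<notin> Idl C"
proof -
  have fC: "finite C" and cc: "card A = card (A - C) + card C"
    using finite_subset[OF C A(1)] card_Diff_subset[OF _ C] card_mono[OF A(1) C] by auto
  have AM: "A \<subseteq> M" unfolding A(3) by (rule genideal_self[OF A(2)])
  have Cc: "C \<subseteq> carrier R" using A C by auto
  obtain Q where Q: "primeideal Q R" "C \<subseteq> Q" "(prime_step ^^ card (A - C)) Q M"
    using chain_above[OF fC _ P(1), of M "card (A - C)"] P(2) C AM cc by auto
  have Qi: "ideal Q R" by (rule primeideal_ideal[OF Q(1)])
  have gen: "M = Idl (K \<union> B)" if "ideal K R" "A \<subseteq> K \<union> B" "B \<subseteq> A" "K \<subseteq> M" for K B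
  proof
    have s: "K \<union> B \<subseteq> carrier R" using that idl_sub A by blast
    show "M \<subseteq> Idl (K \<union> B)" unfolding A(3) by (rule subset_Idl_subset[OF s that(2)])
    show "Idl (K \<union> B) \<subseteq> M" using that AM by (intro genideal_minimal[OF M_ideal]) auto
  qed
  have CQ: "Idl C \<subseteq> Q" by (rule genideal_minimal[OF Qi Q(2)])
  have QM: "Q \<subseteq> M" by (rule prime_sub_M[OF Q(1)])
  have "M = Idl (Idl C \<union> (A - C))"
    by (rule gen[OF genideal_ideal[OF Cc]]) (use genideal_self[OF Cc] CQ QM in auto)
  moreover have "A - C \<subseteq> carrier R" using A(2) by blast
  ultimately have eq: "Idl C = Q"
    by (intro parameters_prime[OF finite_Diff[OF A(1)] _ genideal_ideal[OF Cc] _ Q(1) CQ Q(3)])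
  show "primeideal (Idl C) R" using eq Q by simp
  fix x assume x: "x \<in> A - C"
  show "x \<notin> Idl C"
  proof
    assume "x \<in> Idl C"
    hence xQ: "x \<in> Q" using eq by simp
    have "M = Idl (Q \<union> (A - C - {x}))" by (rule gen[OF Qi]) (use xQ QM Q(2) in auto)
    moreover have "A - C - {x} \<subseteq> carrier R" "finite (A - C - {x})" using A by auto
    ultimately have "card (A - C) \<le> card (A - C - {x})" by (intro height_le_card[OF _ _ Qi _ Q(3)])
    thus False using card_Diff1_less[OF finite_Diff[OF A(1)] x] by simp
  qed
qed

lemma krull_dim_ge:
  assumes "(prime_step ^^ n) P M" shows "enat n \<le> krull_dim R"
proof -
  obtain f where f: "f 0 = P" "f n = M" "\<And>i. i < n \<Longrightarrow> prime_step (f i) (f (Suc i))"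
    using assms by (auto simp: relpowp_fun_conv)
  have "\<forall>i\<le>n. primeideal (f i) R"
    using f M_prime by (metis le_neq_implies_less prime_step_def)
  moreover have "\<forall>i<n. f i \<subset> f (Suc i)" using f(3) by (auto simp: prime_step_def)
  ultimately show ?thesis unfolding krull_dim_def by (intro Sup_upper) blast
qed

lemma chain_to_M:
  assumes "\<forall>i\<le>n. primeideal (f i) R" "\<forall>i<n. f i \<subset> f (Suc i)"
  shows "\<exists>k\<ge>n. \<exists>P. primeideal P R \<and> (prime_step ^^ k) P M"
proof -
  have 1: "(prime_step ^^ n) (f 0) (f n)"
    unfolding relpowp_fun_conv using assms by (intro exI[of _ f]) (auto simp: prime_step_def)
  have p: "primeideal (f 0) R" "primeideal (f n) R" using assms by auto
  show ?thesis
  proof (cases "f n = M")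
    case True thus ?thesis using 1 p by auto
  next
    case False
    hence "prime_step (f n) M" using p prime_sub_M M_prime by (auto simp: prime_step_def)
    hence "(prime_step ^^ Suc n) (f 0) M" using 1 by auto
    thus ?thesis using p by (intro exI[of _ "Suc n"]) auto
  qed
qed

lemma height_le_gens:
  assumes A: "finite A" "A \<subseteq> carrier R" "M = Idl A" and P: "primeideal P R" "(prime_step ^^ k) P M"
  shows "k \<le> card A"
proof (rule height_le_card[OF A(1,2) primeideal_ideal[OF P(1)] _ P(2)])
  show "M = Idl (P \<union> A)"
  proof
    show "M \<subseteq> Idl (P \<union> A)" unfolding A(3) using A idl_sub[OF primeideal_ideal[OF P(1)]] by (intro subset_Idl_subset) auto
    show "Idl (P \<union> A) \<subseteq> M"
      using prime_sub_M[OF P(1)] genideal_self[OF A(2)] A(3) by (intro genideal_minimal[OF M_ideal]) auto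
  qed
qed

lemma krull_dim_le:
  assumes A: "finite A" "A \<subseteq> carrier R" "M = Idl A" shows "krull_dim R \<le> enat (card A)"
  unfolding krull_dim_def
proof (rule Sup_least)
  fix d assume "d \<in> {enat n |n. \<exists>P. (\<forall>i\<le>n. primeideal (P i) R) \<and> (\<forall>i<n. P i \<subset> P (Suc i))}"
  then obtain n f where n: "d = enat n" "\<forall>i\<le>n. primeideal (f i) R" "\<forall>i<n. f i \<subset> f (Suc i)" by blast
  obtain k P where "k \<ge> n" "primeideal P R" "(prime_step ^^ k) P M" using chain_to_M[OF n(2,3)] by blast
  thus "d \<le> enat (card A)" using height_le_gens[OF A] n by force
qed

lemma maximal_chain:
  assumes "krull_dim R = enat n"
  shows "\<exists>k\<ge>n. \<exists>P. primeideal P R \<and> (prime_step ^^ k) P M"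
proof (cases n)
  case 0
  thus ?thesis using M_prime by (intro exI[of _ 0]) auto
next
  case (Suc m)
  show ?thesis
  proof (rule ccontr)
    assume no: "\<not> ?thesis"
    have "krull_dim R \<le> enat m"
      unfolding krull_dim_def
    proof (rule Sup_least)
      fix d assume "d \<in> {enat n |n. \<exists>P. (\<forall>i\<le>n. primeideal (P i) R) \<and> (\<forall>i<n. P i \<subset> P (Suc i))}"
      then obtain l f where l: "d = enat l" "\<forall>i\<le>l. primeideal (f i) R" "\<forall>i<l. f i \<subset> f (Suc i)" by blast
      obtain k P where k: "k \<ge> l" "primeideal P R" "(prime_step ^^ k) P M" using chain_to_M[OF l(2,3)] by blast
      hence "k < n" using no by (meson not_le)
      thus "d \<le> enat m" using l k Suc by simp
    qed
    thus False using assms Suc by simp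
  qed
qed

lemma is_local_ring: "local_ring R"
  unfolding local_ring_def using is_cring max uniq by blast

lemma regular_chain:
  assumes "regular_local_ring R"
  obtains A P where "finite A" "A \<subseteq> carrier R" "M = Idl A" "primeideal P R" "(prime_step ^^ card A) P M"
proof -
  obtain N A where N: "maximalideal N R" "A \<subseteq> carrier R" "finite A" "N = Idl A" "enat (card A) = krull_dim R"
    using assms by (auto simp: regular_local_ring_def)
  have A: "finite A" "A \<subseteq> carrier R" "M = Idl A" using N uniq by auto
  obtain k P where k: "k \<ge> card A" "primeideal P R" "(prime_step ^^ k) P M"
    using maximal_chain[of "card A"] N by auto
  hence "k = card A" using height_le_gens[OF A k(2,3)] by simp
  thus thesis using that A k by blast
qed

end

context local_frob begin

text \<open>By \<open>parameters_subset_prime\<close> the elements of A form a regular sequence in any order. By \<open>regular_mod_adjoin_power\<close>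
  they may be replaced by their q-th powers one at a time.\<close>
lemma parameters_full_parameters:
  assumes A: "finite A" "A \<subseteq> carrier R" "M = Idl A" and P: "primeideal P R" "(prime_step ^^ card A) P M"
  shows "full_parameters {\<zero>} A"
proof (rule independent_imp_full_parameters[OF A])
  fix z c e assume z: "z \<in> A" "c \<in> carrier R" "c \<otimes> z [^] (p ^ e) \<in> Idl ((\<lambda>y. y [^] (p ^ e)) ` (A - {z}))"
  let ?pw = "\<lambda>y. y [^] (p ^ e)"
  have reg: "regular_mod (Idl (B \<union> ?pw ` C)) x" if "C \<subseteq> A" "B \<subseteq> A" "B \<inter> C = {}" "x \<in> A" "x \<notin> B" "x \<notin> C" for B C x
    using finite_subset[OF that(1) A(1)] that
  proof (induction C arbitrary: B x rule: finite_induct)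
    case empty
    have "primeideal (Idl B) R" "x \<notin> Idl B" using parameters_subset_prime[OF A P, of B] empty by auto
    thus ?case using prime_cancel[of "Idl B" x] empty A by (auto simp: regular_mod_def)
  next
    case (insert y C)
    let ?J = "Idl (B \<union> ?pw ` C)"
    have s: "B \<union> ?pw ` C \<subseteq> carrier R" "y \<in> carrier R" "x \<in> carrier R" using insert.prems A by auto
    have J: "ideal ?J R" by (rule genideal_ideal[OF s(1)])
    have e1: "Idl (B \<union> ?pw ` insert y C) = adjoin ?J (y [^] (p ^ e))"
      using Idl_insert[OF s(1), of "y [^] (p ^ e)"] s(2) by simp
    have "Idl (insert y B \<union> ?pw ` C) = adjoin ?J y" using Idl_insert[OF s(1,2)] by simp
    hence "regular_mod (adjoin ?J y) x" using insert.IH[of "insert y B" x] insert.prems insert.hyps by auto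
    moreover have "regular_mod ?J y" using insert.IH[of B y] insert.prems insert.hyps by auto
    ultimately show ?case unfolding e1 using regular_mod_adjoin_power[OF J s(3,2)] by blast
  qed
  have zc: "z \<in> carrier R" using z A by auto
  have "regular_mod (Idl ({} \<union> ?pw ` (A - {z}))) z" using z by (intro reg) auto
  hence "c \<in> Idl (?pw ` (A - {z}))" using regular_mod_power[OF zc _ z(2,3)] by simp
  also have "\<dots> \<subseteq> rbracket {\<zero>} (p ^ e) M"
  proof (rule genideal_minimal[OF rbracket_ideal])
    show "?pw ` (A - {z}) \<subseteq> rbracket {\<zero>} (p ^ e) M"
      using rbracket_pow[OF _ M_sub, of "{\<zero>}"] genideal_self[OF A(2)] A(3) by auto
  qed (use M_sub in auto)
  finally show "c \<in> rbracket {\<zero>} (p ^ e) M" .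
qed

theorem regular_imp_colon:
  assumes "regular_local_ring R" "ideal I R" "u \<in> carrier R"
  shows "colon R (bracket_power R I p) (u [^] p) = bracket_power R (colon R I u) p"
proof -
  obtain A P where A: "finite A" "A \<subseteq> carrier R" "M = Idl A" "primeideal P R" "(prime_step ^^ card A) P M"
    by (rule regular_chain[OF assms(1)])
  have "{\<zero>} \<subseteq> I" using idl_zero[OF assms(2)] by simp
  from colon_frob[OF parameters_full_parameters[OF A] assms(2) this assms(3)] show ?thesis
    by (simp add: rbracket_zero assms colon_ideal)
qed

end

context cring begin

lemma colon_power:
  assumes fr: "frob_exp p" and col: "\<And>I u. ideal I R \<Longrightarrow> u \<in> carrier R \<Longrightarrow>
      colon R (bracket_power R I p) (u [^] p) \<subseteq> bracket_power R (colon R I u) p"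
  shows "ideal I R \<Longrightarrow> u \<in> carrier R \<Longrightarrow>
      colon R (bracket_power R I (p ^ e)) (u [^] (p ^ e)) \<subseteq> bracket_power R (colon R I u) (p ^ e)"
proof (induction e)
  case 0
  have b1: "bracket_power R K 1 = K" if "ideal K R" for K
  proof -
    have "(\<lambda>x. x [^] (1::nat)) ` K = K" using idl_carr[OF that] by (auto simp: image_def)
    thus ?thesis by (simp only: bracket_power_def Idl_ideal[OF that])
  qed
  show ?case using b1[OF 0(1)] b1[OF colon_ideal[OF 0]] 0(2) by simp
next
  case (Suc e)
  let ?q = "p ^ e"
  have e1: "u [^] (p ^ Suc e) = (u [^] ?q) [^] p" using Suc.prems by (simp add: nat_pow_pow mult.commute)
  have b: "bracket_power R K (p ^ Suc e) = bracket_power R (bracket_power R K ?q) p" if "ideal K R" for K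
    using bracket_bracket[OF that fr, of ?q] by (simp add: mult.commute)
  have "colon R (bracket_power R I (p ^ Suc e)) (u [^] (p ^ Suc e))
     \<subseteq> bracket_power R (colon R (bracket_power R I ?q) (u [^] ?q)) p"
    unfolding e1 b[OF Suc.prems(1)] using Suc.prems by (intro col bracket_ideal) auto
  also have "\<dots> \<subseteq> bracket_power R (bracket_power R (colon R I u) ?q) p"
  proof -
    have "ideal (bracket_power R (colon R I u) ?q) R" using Suc.prems by (intro bracket_ideal colon_ideal)
    hence "(\<lambda>x. x [^] p) ` bracket_power R (colon R I u) ?q \<subseteq> carrier R" using idl_carr by auto
    thus ?thesis unfolding bracket_power_def[of R _ p] using Suc by (intro subset_Idl_subset) auto
  qed
  finally show ?case using b[OF colon_ideal[OF Suc.prems]] by simp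
qed

end

context local_frob begin

text \<open>A minimal set A of generators satisfies the independence condition: if c x^q is in the ideal
  generated by the q-th powers of the other generators, then c is in the bracket power of a colon
  ideal that is proper because A is minimal. By \<open>full_parameters_prime\<close> the subsets of A then generate
  prime ideals, which are distinct, again by minimality.\<close>
theorem colon_imp_regular:
  assumes col: "\<And>I u. ideal I R \<Longrightarrow> u \<in> carrier R \<Longrightarrow>
      colon R (bracket_power R I p) (u [^] p) \<subseteq> bracket_power R (colon R I u) p"
  shows "regular_local_ring R"
proof -
  let ?gen = "\<lambda>n. \<exists>A\<subseteq>carrier R. finite A \<and> M = Idl A \<and> card A = n"
  have ex: "\<exists>n. ?gen n" using finetely_gen[OF M_ideal] by blast
  define n where "n = (LEAST n. ?gen n)"
  obtain A where A: "A \<subseteq> carrier R" "finite A" "M = Idl A" "card A = n"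
    using LeastI_ex[OF ex] unfolding n_def by blast
  have min: "x \<notin> Idl (A - {x})" if x: "x \<in> A" for x
  proof
    assume "x \<in> Idl (A - {x})"
    have s: "A - {x} \<subseteq> carrier R" using A by auto
    have "A \<subseteq> Idl (A - {x})" using genideal_self[OF s] \<open>x \<in> Idl (A - {x})\<close> by blast
    hence "M = Idl (A - {x})"
      unfolding A(3) using A s by (intro equalityI genideal_minimal genideal_ideal subset_Idl_subset) auto
    hence "?gen (card (A - {x}))" using A s by blast
    hence "n \<le> card (A - {x})" unfolding n_def by (rule Least_le)
    thus False using card_Diff1_less[OF A(2) x] A(4) by simp
  qed
  have AM: "A \<subseteq> M" unfolding A(3) by (rule genideal_self[OF A(1)])
  have zc: "{\<zero>} \<subseteq> carrier R" by simp
  have full_parameters: "full_parameters {\<zero>} A"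
  proof (rule independent_imp_full_parameters[OF A(2,1,3)])
    fix x c e assume x: "x \<in> A" and c: "c \<in> carrier R" "c \<otimes> x [^] (p ^ e) \<in> Idl ((\<lambda>y. y [^] (p ^ e)) ` (A - {x}))"
    have s: "A - {x} \<subseteq> carrier R" "x \<in> carrier R" using A x by auto
    let ?I = "Idl (A - {x})"
    have I: "ideal ?I R" by (rule genideal_ideal[OF s(1)])
    note Ic = idl_sub[OF I]
    have "Idl ((\<lambda>y. y [^] (p ^ e)) ` (A - {x})) \<subseteq> bracket_power R ?I (p ^ e)"
      unfolding bracket_power_def using Ic genideal_self[OF s(1)] by (intro subset_Idl_subset) auto
    hence "c \<in> colon R (bracket_power R ?I (p ^ e)) (x [^] (p ^ e))" using c by (auto simp: colon_def)
    hence "c \<in> bracket_power R (colon R ?I x) (p ^ e)" using colon_power[OF frob_p col I s(2)] by blast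
    hence "c \<in> rbracket {\<zero>} (p ^ e) (colon R ?I x)" by (simp add: rbracket_zero colon_ideal[OF I s(2)])
    moreover have "colon R ?I x \<subseteq> M"
      using proper_sub_M[OF colon_ideal[OF I s(2)]] min[OF x] s by (auto simp: colon_def)
    ultimately show "c \<in> rbracket {\<zero>} (p ^ e) M" using rbracket_mono[OF zc M_sub] by blast
  qed
  have pr: "primeideal (Idl C) R" if "C \<subseteq> A" for C using full_parameters_prime[OF full_parameters_subset[OF full_parameters that]] .
  have "(prime_step ^^ card C) (Idl {}) (Idl C)" if "C \<subseteq> A" for C
    using finite_subset[OF that A(2)] that
  proof (induction C rule: finite_induct)
    case (insert x C)
    have s: "A - {x} \<subseteq> carrier R" "insert x C \<subseteq> carrier R" "C \<subseteq> A - {x}" using A insert by auto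
    have "x \<notin> Idl C" using min[of x] subset_Idl_subset[OF s(1,3)] insert.prems by auto
    moreover have "x \<in> Idl (insert x C)" "Idl C \<subseteq> Idl (insert x C)"
      using genideal_self[OF s(2)] subset_Idl_subset[OF s(2), of C] by auto
    ultimately have "prime_step (Idl C) (Idl (insert x C))" using pr[of C] pr[of "insert x C"] insert.prems by (auto simp: prime_step_def)
    thus ?case using insert by auto
  qed simp
  hence "(prime_step ^^ card A) (Idl {}) M" using A by auto
  hence "krull_dim R = enat (card A)" using krull_dim_ge krull_dim_le[OF A(2,1,3)] by (simp add: antisym)
  thus ?thesis unfolding regular_local_ring_def using A max is_local_ring noetherian_ring_axioms by metis
qed

end

section \<open>From colon ideals to intersections\<close>

context cring begin

text \<open>Let I = I' + (u), and let z = w + r u^q lie in both bracket powers, with w in I'^{[q]}. Then r is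
  in ((I' + J)^{[q]} : u^q), which is the bracket power of (I' + J : u). An element v of the
  latter ideal satisfies v u = i + c with i in I' and c in the intersection of I and J.
  So z differs from an element of the wanted bracket power by an element of I'^{[q]}, to which the
  induction hypothesis applies.\<close>
lemma colon_imp_inter_fg:
  assumes fr: "frob_exp q" and col: "\<And>I u. ideal I R \<Longrightarrow> u \<in> carrier R \<Longrightarrow>
      colon R (bracket_power R I q) (u [^] q) \<subseteq> bracket_power R (colon R I u) q"
    and J: "ideal J R" and G: "finite G" "G \<subseteq> carrier R"
  shows "bracket_power R (Idl G) q \<inter> bracket_power R J q \<subseteq> bracket_power R (Idl G \<inter> J) q"
  using G
proof (induction G rule: finite_induct)
  case empty
  have z: "Idl {} \<inter> J = Idl {}" using idl_zero[OF J] by (auto simp: Idl_empty)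
  show ?case unfolding z by simp
next
  case (insert u G)
  let ?I' = "Idl G" and ?I = "Idl (insert u G)" and ?b = "\<lambda>K. bracket_power R K q"
  have u: "u \<in> carrier R" "G \<subseteq> carrier R" using insert by auto
  have I': "ideal ?I' R" by (rule genideal_ideal[OF u(2)])
  have I: "ideal ?I R" by (rule genideal_ideal[OF insert.prems])
  have eq: "?I = adjoin ?I' u" by (rule Idl_insert[OF u(2,1)])
  have I'I: "?I' \<subseteq> ?I" "u \<in> ?I" unfolding eq using adjoin_sub[OF I' u(1)] adjoin_self[OF I' u(1)] .
  have IJ: "ideal (?I \<inter> J) R" by (rule i_intersect[OF I J])
  let ?K = "?I' <+>\<^bsub>R\<^esub> J" and ?Y = "?b ?I' <+>\<^bsub>R\<^esub> ?b (?I \<inter> J)"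
  have K: "ideal ?K R" by (rule add_ideals[OF I' J])
  have Kin: "?I' \<subseteq> ?K" "J \<subseteq> ?K"
    unfolding union_genideal[OF I' J, symmetric] using genideal_self[of "?I' \<union> J"] idl_sub[OF I'] idl_sub[OF J] by auto
  have b: "ideal (?b ?I') R" "ideal (?b (?I \<inter> J)) R" "ideal (?b J) R" "ideal (?b ?K) R"
    using I' IJ J K by (simp_all add: bracket_ideal)
  have Y: "ideal ?Y R" by (rule add_ideals[OF b(1,2)])
  have Yin: "?b ?I' \<subseteq> ?Y" "?b (?I \<inter> J) \<subseteq> ?Y"
    unfolding union_genideal[OF b(1,2), symmetric]
    using genideal_self[of "?b ?I' \<union> ?b (?I \<inter> J)"] idl_sub[OF b(1)] idl_sub[OF b(2)] by auto
  have up: "u [^] q \<in> carrier R" using u by simp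
  show ?case
  proof
    fix z assume z: "z \<in> ?b ?I \<inter> ?b J"
    then obtain w r where wr: "w \<in> ?b ?I'" "r \<in> carrier R" "z = w \<oplus> r \<otimes> u [^] q"
      using bracket_adjoin[OF I' u(1) fr] eq by (auto elim: adjoinE)
    have "z \<in> ?b ?K" "w \<in> ?b ?K" using z wr bracket_mono[OF K Kin(1)] bracket_mono[OF K Kin(2)] by auto
    moreover have wc: "w \<in> carrier R" using wr idl_carr[OF b(1)] by blast
    ultimately have "r \<otimes> u [^] q \<in> ?b ?K"
      using idl_addD[OF b(4), of "r \<otimes> u [^] q" w] wr up a_comm[of w "r \<otimes> u [^] q"] by auto
    hence r: "r \<in> ?b (colon R ?K u)" using col[OF K u(1)] wr(2) by (auto simp: colon_def)
    have "r \<otimes> u [^] q \<in> ?Y"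
    proof (rule bracket_mult_in[OF colon_ideal[OF K u(1)] Y up _ r])
      fix v assume "v \<in> colon R ?K u"
      hence v: "v \<in> carrier R" "v \<otimes> u \<in> ?K" by (auto simp: colon_def)
      then obtain i c where ic: "i \<in> ?I'" "c \<in> J" "v \<otimes> u = i \<oplus> c" by (auto simp: set_add_def')
      have icc: "i \<in> carrier R" "c \<in> carrier R" using ic idl_carr I' J by blast+
      have "c = v \<otimes> u \<ominus> i" unfolding ic(3) using icc add_diff_cancel by simp
      hence "c \<in> ?I" using I I'I ic(1) v(1) by (auto intro!: idl_diff idl_lmult)
      hence "c [^] q \<in> ?b (?I \<inter> J)" using bracket_pow[OF IJ] ic(2) by blast
      moreover have "i [^] q \<in> ?b ?I'" using bracket_pow[OF I' ic(1)] .
      moreover have "v [^] q \<otimes> u [^] q = i [^] q \<oplus> c [^] q"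
        using v u ic(3) icc fr by (simp add: nat_pow_distrib[symmetric] frob_exp_add)
      ultimately show "v [^] q \<otimes> u [^] q \<in> ?Y" using Yin Y by (auto intro: idl_add)
    qed
    hence "z \<in> ?Y" using wr Yin Y by (auto intro: idl_add)
    then obtain w' z' where wz: "w' \<in> ?b ?I'" "z' \<in> ?b (?I \<inter> J)" "z = w' \<oplus> z'" by (auto simp: set_add_def')
    have "z' \<in> ?b J" using wz bracket_mono[OF J, of "?I \<inter> J"] by auto
    hence "w' \<in> ?b J" using idl_addD[OF b(3), of w' z'] wz z idl_carr[OF b(1)] by auto
    hence "w' \<in> ?b (?I' \<inter> J)" using insert.IH[OF u(2)] wz by auto
    moreover have "?b (?I' \<inter> J) \<subseteq> ?b (?I \<inter> J)" using I'I by (intro bracket_mono[OF IJ]) auto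
    ultimately show "z \<in> ?b (?I \<inter> J)" using wz b by (auto intro: idl_add)
  qed
qed

end

context noeth_cring begin

lemma colon_imp_inter:
  assumes fr: "frob_exp q" and col: "\<And>I u. ideal I R \<Longrightarrow> u \<in> carrier R \<Longrightarrow>
      colon R (bracket_power R I q) (u [^] q) \<subseteq> bracket_power R (colon R I u) q"
    and I: "ideal I R" and J: "ideal J R"
  shows "bracket_power R I q \<inter> bracket_power R J q = bracket_power R (I \<inter> J) q"
proof
  obtain G where "G \<subseteq> carrier R" "finite G" "I = Idl G" using finetely_gen[OF I] by blast
  thus "bracket_power R I q \<inter> bracket_power R J q \<subseteq> bracket_power R (I \<inter> J) q"
    using colon_imp_inter_fg[OF fr col J] by blast
  show "bracket_power R (I \<inter> J) q \<subseteq> bracket_power R I q \<inter> bracket_power R J q"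
    using bracket_mono[OF I, of "I \<inter> J"] bracket_mono[OF J, of "I \<inter> J"] by auto
qed

lemma colon_imp_finite_inter:
  assumes fr: "frob_exp q" and col: "\<And>I u. ideal I R \<Longrightarrow> u \<in> carrier R \<Longrightarrow>
      colon R (bracket_power R I q) (u [^] q) \<subseteq> bracket_power R (colon R I u) q"
    and I: "\<forall>j\<in>{1..k::nat}. ideal (I j) R" and k: "1 \<le> k"
  shows "ideal (\<Inter>j\<in>{1..k}. I j) R \<and>
    (\<Inter>j\<in>{1..k}. bracket_power R (I j) q) = bracket_power R (\<Inter>j\<in>{1..k}. I j) q"
  using k I
proof (induction k rule: dec_induct)
  case (step k)
  have s: "{1..Suc k} = insert (Suc k) {1..k}" by auto
  have IH: "ideal (\<Inter>j\<in>{1..k}. I j) R"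
    "(\<Inter>j\<in>{1..k}. bracket_power R (I j) q) = bracket_power R (\<Inter>j\<in>{1..k}. I j) q"
    using step by auto
  have "ideal (I (Suc k)) R" using step by auto
  thus ?case unfolding s using colon_imp_inter[OF fr col _ IH(1), of "I (Suc k)"] IH i_intersect[of "I (Suc k)"]
    by simp
qed simp

end

section \<open>From principal intersections to colon ideals\<close>

context local_frob begin

text \<open>First, there are no zero divisors. Let x y = 0 with y nonzero, and K = (0 : y). In a reduced ring the
  intersection of (x + y) and (x) is contained in x K, and the bracket power of (x + y) contains x^p K. So the hypothesis
  gives x^p K \<open>\<subseteq>\<close> x^p K^{[p]} \<open>\<subseteq>\<close> M x^p K, hence x^p K = 0 by Nakayama's lemma. As x is in K, some
  power of x vanishes. Second, r u^p in I^{[p]} gives r u^p \<open>\<in>\<close> u^p (I : u)^{[p]}, and u^p can be cancelled.\<close>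
lemma principal_inter_imp_colon:
  assumes red: "\<And>x n::nat. x \<in> carrier R \<Longrightarrow> x [^] n = \<zero> \<Longrightarrow> x = \<zero>"
    and inter: "\<And>I x. ideal I R \<Longrightarrow> x \<in> carrier R \<Longrightarrow>
      bracket_power R I p \<inter> PIdl (x [^] p) \<subseteq> bracket_power R (I \<inter> PIdl x) p"
    and I: "ideal I R" and u: "u \<in> carrier R"
  shows "colon R (bracket_power R I p) (u [^] p) \<subseteq> bracket_power R (colon R I u) p"
proof -
  have dom: "x = \<zero>" if x: "x \<in> carrier R" and y: "y \<in> carrier R" "y \<noteq> \<zero>" and xy: "x \<otimes> y = \<zero>" for x y
  proof -
    let ?K = "colon R {\<zero>} y"
    have K: "ideal ?K R" using colon_ideal[OF zeroideal y(1)] .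
    have KM: "?K \<subseteq> M" using proper_sub_M[OF K] y by (auto simp: colon_def)
    have Kc: "b \<in> carrier R \<and> b \<otimes> y = \<zero>" if "b \<in> ?K" for b using that by (auto simp: colon_def)
    have xp: "x [^] p \<in> carrier R" using x by simp
    let ?N = "scaled_sum {\<zero>} ?K (x [^] p)"
    have N: "ideal ?N R" by (rule scaled_sum_ideal[OF zeroideal K xp])
    have "?N \<subseteq> {\<zero>}"
    proof (rule Nakayama[OF N zeroideal])
      fix K2 assume K2: "ideal K2 R" "\<And>a z. a \<in> M \<Longrightarrow> z \<in> ?N \<Longrightarrow> a \<otimes> z \<in> K2"
      show "?N \<subseteq> K2"
      proof
        fix z assume "z \<in> ?N"
        then obtain i a where "i \<in> {\<zero>}" "a \<in> ?K" "z = i \<oplus> a \<otimes> x [^] p" by (rule scaled_sumE)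
        hence a: "a \<in> carrier R" "a \<otimes> y = \<zero>" "z = a \<otimes> x [^] p" using Kc xp by auto
        let ?s = "x \<oplus> y"
        have sc: "?s \<in> carrier R" using x y by simp
        have "a \<otimes> y [^] p = \<zero>"
          unfolding pow_pred[OF y(1) frob_exp_pos[OF frob_p]] using a y by (simp add: m_assoc[symmetric])
        hence "z = a \<otimes> ?s [^] p" using a x y by (simp add: frob_exp_add[OF frob_p] r_distr)
        hence "z \<in> bracket_power R (PIdl ?s) p"
          using bracket_PIdl[OF sc, of p] a by (auto simp: PIdl_iff)
        moreover have "z \<in> PIdl (x [^] p)" using a by (auto simp: PIdl_iff)
        ultimately have "z \<in> bracket_power R (PIdl ?s \<inter> PIdl x) p"
          using inter[OF cgenideal_ideal[OF sc] x] by blast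
        also have "\<dots> \<subseteq> K2"
        proof (rule bracket_least[OF K2(1)])
          fix g assume "g \<in> PIdl ?s \<inter> PIdl x"
          then obtain b c where b: "b \<in> carrier R" "g = b \<otimes> ?s" and c: "c \<in> carrier R" "g = c \<otimes> x"
            by (auto simp: PIdl_iff)
          have "(b \<otimes> y) \<otimes> y = (b \<otimes> ?s) \<otimes> y"
          proof -
            have "(b \<otimes> ?s) \<otimes> y = b \<otimes> (x \<otimes> y) \<oplus> (b \<otimes> y) \<otimes> y"
              using b(1) x y by (simp add: r_distr l_distr m_assoc)
            thus ?thesis using xy b(1) y by simp
          qed
          also have "\<dots> = c \<otimes> (x \<otimes> y)" unfolding b(2)[symmetric] c(2) using c(1) x y by (simp add: m_assoc)
          finally have byy: "(b \<otimes> y) \<otimes> y = \<zero>" using xy c by simp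
          have "(b \<otimes> y) [^] (2::nat) = b \<otimes> ((b \<otimes> y) \<otimes> y)"
            using b(1) y by (simp add: numeral_2_eq_2 m_ac)
          hence "(b \<otimes> y) [^] (2::nat) = \<zero>" using byy b by simp
          hence b0: "b \<otimes> y = \<zero>" using red[of "b \<otimes> y" 2] b y by simp
          hence bK: "b \<in> ?K" using b by (simp add: colon_def)
          have "g = b \<otimes> x" using b x y by (simp add: r_distr b0)
          hence "g [^] p = b [^] p \<otimes> x [^] p" using b x by (simp add: nat_pow_distrib)
          also have "\<dots> = b [^] (p - 1) \<otimes> (b \<otimes> x [^] p)"
            unfolding pow_pred[OF b(1) frob_exp_pos[OF frob_p]] using b(1) xp by (simp add: m_ac)
          also have "\<dots> \<in> K2"
          proof (rule K2(2))
            show "b [^] (p - 1) \<in> M" using bK KM p_gt1 idl_pow[OF M_ideal] by auto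
            show "b \<otimes> x [^] p \<in> ?N" by (rule scaled_sum_mult[OF zeroideal K xp bK])
          qed
          finally show "g [^] p \<in> K2" .
        qed
        finally show "z \<in> K2" .
      qed
    qed
    moreover have "x \<otimes> x [^] p \<in> ?N" using x xy by (intro scaled_sum_mult[OF zeroideal K xp]) (simp add: colon_def)
    ultimately have "x [^] Suc p = \<zero>" using x m_comm[OF x xp] by auto
    thus "x = \<zero>" using red[OF x, of "Suc p"] by blast
  qed
  show ?thesis
  proof (cases "u = \<zero>")
    case True
    have "colon R I u = carrier R" using True idl_zero[OF I] by (auto simp: colon_def)
    hence "bracket_power R (colon R I u) p = carrier R"
      using rbracket_carrier[of "{\<zero>}" p] rbracket_zero[OF oneideal, of p] by simp
    thus ?thesis by (auto simp: colon_def)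
  next
    case False
    hence un: "u [^] p \<noteq> \<zero>" using red[OF u] by blast
    let ?C = "colon R I u"
    have C: "ideal ?C R" by (rule colon_ideal[OF I u])
    have bC: "ideal (bracket_power R ?C p) R" by (rule bracket_ideal[OF C])
    have up: "u [^] p \<in> carrier R" using u by simp
    show ?thesis
    proof
      fix r assume "r \<in> colon R (bracket_power R I p) (u [^] p)"
      hence r: "r \<in> carrier R" "r \<otimes> u [^] p \<in> bracket_power R I p" by (auto simp: colon_def)
      moreover have "r \<otimes> u [^] p \<in> PIdl (u [^] p)" using r by (auto simp: PIdl_iff)
      ultimately have "r \<otimes> u [^] p \<in> bracket_power R (I \<inter> PIdl u) p" using inter[OF I u] by blast
      also have "\<dots> \<subseteq> scaled_sum {\<zero>} (bracket_power R ?C p) (u [^] p)"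
      proof (rule bracket_least[OF scaled_sum_ideal[OF zeroideal bC up]])
        fix g assume "g \<in> I \<inter> PIdl u"
        then obtain c where c: "c \<in> carrier R" "g = c \<otimes> u" "c \<in> ?C" by (auto simp: PIdl_iff colon_def)
        hence "g [^] p = c [^] p \<otimes> u [^] p" using u by (simp add: nat_pow_distrib)
        thus "g [^] p \<in> scaled_sum {\<zero>} (bracket_power R ?C p) (u [^] p)"
          using scaled_sum_mult[OF zeroideal bC up bracket_pow[OF C c(3)]] by simp
      qed
      finally obtain i e where "i \<in> {\<zero>}" "e \<in> bracket_power R ?C p" "r \<otimes> u [^] p = i \<oplus> e \<otimes> u [^] p" by (rule scaled_sumE)
      hence e: "e \<in> bracket_power R ?C p" "e \<in> carrier R" "r \<otimes> u [^] p = e \<otimes> u [^] p" using idl_carr[OF bC] up by auto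
      have "(r \<ominus> e) \<otimes> u [^] p = \<zero>" using e r(1) up by (simp add: a_minus_def l_distr l_minus r_neg)
      hence "r \<ominus> e = \<zero>" using dom[OF _ up un] r(1) e(2) by simp
      hence "r = e" using r(1) e(2) by simp
      thus "r \<in> bracket_power R ?C p" using e by simp
    qed
  qed
qed

end

section \<open>Passage between a ring and its local rings\<close>

locale frob_noeth = noeth_cring R for R (structure) +
  fixes p :: nat
  assumes p_gt1: "1 < p" and frob_p: "frob_exp p"
begin

lemma localization_local_frob:
  assumes M: "maximalideal M R"
  shows "local_frob (localization R (carrier R - M)) (mult_closed.extend R (carrier R - M) M) p"
proof -
  interpret M: primeideal M R by (rule maximalideal_prime[OF M])
  interpret mc: mult_closed R "carrier R - M" by (rule M.mult_closed_compl)
  show ?thesis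
    by (intro local_frob.intro local_frob_axioms.intro M.localization_local noetherian_ring_axioms p_gt1
        mc.localization_frob_exp frob_p)
qed

text \<open>If r were outside the bracket power B of (I : u), then some maximal ideal would contain (B : r); in
  the localization there the colon identity holds, and clearing denominators gives an element of
  (B : r) outside this maximal ideal.\<close>
theorem regular_imp_colon_global:
  assumes reg: "regular_ring R" and I: "ideal I R" and u: "u \<in> carrier R"
  shows "colon R (bracket_power R I p) (u [^] p) \<subseteq> bracket_power R (colon R I u) p"
proof (rule, rule ccontr)
  let ?C = "colon R I u" and ?b = "\<lambda>K. bracket_power R K p"
  fix r assume "r \<in> colon R (?b I) (u [^] p)" and nr: "r \<notin> ?b ?C"
  hence r: "r \<in> carrier R" "r \<otimes> u [^] p \<in> ?b I" by (auto simp: colon_def)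
  have C: "ideal ?C R" by (rule colon_ideal[OF I u])
  note B = bracket_ideal[OF C, of p]
  obtain M where M: "maximalideal M R" "colon R (?b ?C) r \<subseteq> M"
    by (rule exists_maximal[OF colon_ideal[OF B r(1)]]) (use nr r in \<open>auto simp: colon_def\<close>)
  interpret M: primeideal M R by (rule maximalideal_prime[OF M(1)])
  interpret mc: mult_closed R "carrier R - M" by (rule M.mult_closed_compl)
  interpret L: local_frob mc.L "mc.extend M" p by (rule localization_local_frob[OF M(1)])
  have regL: "regular_local_ring mc.L" using reg M(1) by (auto simp: regular_ring_def)
  note S1 = mc.S_one
  let ?u = "mc.fr u \<one>" and ?r = "mc.fr r \<one>"
  have uc: "?u \<in> carrier mc.L" "?r \<in> carrier mc.L" using u r S1 mc.fr_carr by auto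
  have "?r \<otimes>\<^bsub>mc.L\<^esub> ?u [^]\<^bsub>mc.L\<^esub> p = mc.fr (r \<otimes> u [^] p) \<one>"
    using mc.fr_pow[OF u S1, of p] mc.localization_mult[OF r(1) S1, of "u [^] p" \<one>] u S1 by simp
  also have "\<dots> \<in> bracket_power mc.L (mc.extend I) p"
    unfolding mc.extend_bracket[OF I] using r(2) S1 by (auto simp: mc.extend_def)
  finally have "?r \<in> bracket_power mc.L (colon mc.L (mc.extend I) ?u) p"
    using L.regular_imp_colon[OF regL mc.extend_ideal[OF I] uc(1)] uc by (auto simp: colon_def)
  hence "?r \<in> mc.extend (?b ?C)" by (simp add: mc.extend_colon[OF I u] mc.extend_bracket[OF C])
  then obtain v where v: "v \<in> carrier R - M" "v \<otimes> r \<in> ?b ?C" using mc.mem_extend[OF B r(1) S1] by blast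
  thus False using M(2) by (auto simp: colon_def)
qed

theorem inter_imp_regular:
  assumes red: "reduced_ring R"
    and inter: "\<And>I x. ideal I R \<Longrightarrow> x \<in> carrier R \<Longrightarrow>
      bracket_power R I p \<inter> PIdl (x [^] p) \<subseteq> bracket_power R (I \<inter> PIdl x) p"
  shows "regular_ring R"
  unfolding regular_ring_def
proof (intro conjI allI impI is_cring noetherian_ring_axioms)
  fix M assume M: "maximalideal M R"
  interpret M: primeideal M R by (rule maximalideal_prime[OF M])
  interpret mc: mult_closed R "carrier R - M" by (rule M.mult_closed_compl)
  interpret L: local_frob mc.L "mc.extend M" p by (rule localization_local_frob[OF M])
  have S1: "\<one> \<in> carrier R - M" by (rule mc.S_one)
  have redL: "x = \<zero>\<^bsub>mc.L\<^esub>" if x: "x \<in> carrier mc.L" "x [^]\<^bsub>mc.L\<^esub> n = \<zero>\<^bsub>mc.L\<^esub>" for x and n :: nat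
  proof -
    obtain a s where a: "a \<in> carrier R" "s \<in> carrier R - M" "x = mc.fr a s" using mc.fr_cases[OF x(1)] .
    have sn: "s [^] n \<in> carrier R - M" using mc.fr_pow[OF a(1,2)] by blast
    have "mc.fr (a [^] n) (s [^] n) = mc.fr \<zero> \<one>" using x(2) a mc.fr_pow[OF a(1,2), of n] by (simp add: mc.L_zero)
    then obtain v where v: "v \<in> carrier R - M" "v \<otimes> a [^] n = \<zero>"
      using mc.frac_eq_iff[OF _ sn _ S1, of "a [^] n" \<zero>] a sn by auto
    have "(v \<otimes> a) [^] Suc n = (v [^] n \<otimes> a) \<otimes> (v \<otimes> a [^] n)"
      using v(1) a by (simp add: nat_pow_distrib m_ac)
    also have "\<dots> = \<zero>" using v a by simp
    finally have "v \<otimes> a = \<zero>" using red v(1) a unfolding reduced_ring_def by (metis DiffD1 m_closed)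
    thus ?thesis using v a by (subst mc.L_zero, subst a(3), subst mc.frac_eq_iff[OF a(1,2) zero_closed S1]) auto
  qed
  have interL: "bracket_power mc.L J p \<inter> PIdl\<^bsub>mc.L\<^esub> (z [^]\<^bsub>mc.L\<^esub> p) \<subseteq> bracket_power mc.L (J \<inter> PIdl\<^bsub>mc.L\<^esub> z) p"
    if J: "ideal J mc.L" and z: "z \<in> carrier mc.L" for J z
  proof -
    let ?I = "mc.contract J"
    have I: "ideal ?I R" by (rule mc.contract_ideal[OF J])
    obtain x s where x: "x \<in> carrier R" "s \<in> carrier R - M" "z = mc.fr x s" using mc.fr_cases[OF z] .
    have sp: "s [^] p \<in> carrier R - M" using mc.fr_pow[OF x(1,2)] by blast
    have P: "ideal (PIdl x) R" "ideal (PIdl (x [^] p)) R" using x by (simp_all add: cgenideal_ideal)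
    note IP = i_intersect[OF I P(1)]
    have "bracket_power mc.L J p \<inter> PIdl\<^bsub>mc.L\<^esub> (z [^]\<^bsub>mc.L\<^esub> p)
        = mc.extend (bracket_power R ?I p) \<inter> mc.extend (PIdl (x [^] p))"
      using mc.extend_bracket[OF I, of p] mc.extend_contract[OF J] mc.fr_pow[OF x(1,2), of p] mc.extend_PIdl[OF _ sp, of "x [^] p"] x
      by simp
    also have "\<dots> = mc.extend (bracket_power R ?I p \<inter> PIdl (x [^] p))"
      using mc.extend_inter[OF bracket_ideal[OF I] P(2)] by simp
    also have "\<dots> \<subseteq> mc.extend (bracket_power R (?I \<inter> PIdl x) p)" by (rule mc.extend_mono[OF inter[OF I x(1)]])
    also have "\<dots> = bracket_power mc.L (J \<inter> PIdl\<^bsub>mc.L\<^esub> z) p"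
      using mc.extend_bracket[OF IP, of p] mc.extend_inter[OF I P(1)] mc.extend_contract[OF J] mc.extend_PIdl[OF x(1,2)] x(3) by simp
    finally show ?thesis .
  qed
  show "regular_local_ring mc.L"
    by (rule L.colon_imp_regular[OF L.principal_inter_imp_colon[OF redL interL]])
qed

end

section \<open>Regularity, intersections and colon ideals\<close>

theorem mainTheorem1:
  fixes R :: "('a, 'b) ring_scheme" (structure) and p :: nat
  assumes "cring R" and "noetherian_ring R" and "reduced_ring R"
    and "Factorial_Ring.prime p" and "ring_char R = p"
  shows "(regular_ring R \<longleftrightarrow>
            (\<forall>(k::nat) (I :: nat \<Rightarrow> 'a set) (n::nat). k \<ge> 1 \<longrightarrow> (\<forall>j \<in> {1..k}. ideal (I j) R) \<longrightarrow>
               (\<Inter>j \<in> {1..k}. bracket_power R (I j) (p ^ n))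
                 = bracket_power R (\<Inter>j \<in> {1..k}. I j) (p ^ n)))
       \<and> (regular_ring R \<longleftrightarrow>
            (\<forall>I x. ideal I R \<longrightarrow> x \<in> carrier R \<longrightarrow>
               bracket_power R I p \<inter> PIdl (x [^] p) = bracket_power R (I \<inter> PIdl x) p))
       \<and> (regular_ring R \<longleftrightarrow>
            (\<forall>I x. ideal I R \<longrightarrow> x \<in> carrier R \<longrightarrow>
               bracket_power R (colon R I x) p = colon R (bracket_power R I p) (x [^] p)))"
    (is "(?one \<longleftrightarrow> ?two) \<and> (?one \<longleftrightarrow> ?three) \<and> (?one \<longleftrightarrow> ?four)")
proof -
  interpret cring R by fact
  interpret noetherian_ring R by fact
  have fr: "frob_exp p" by (rule char_frob_exp[OF assms(4,5)])
  interpret frob_noeth R p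
    by unfold_locales (use assms(4) prime_gt_1_nat fr in auto)
  have a: "?four" if "?one"
  proof (intro allI impI equalityI)
    fix I x assume I: "ideal I R" and x: "x \<in> carrier R"
    show "bracket_power R (colon R I x) p \<subseteq> colon R (bracket_power R I p) (x [^] p)"
      using rbracket_colon_sub[of "{\<zero>}" I x p] I x by (simp add: rbracket_zero colon_ideal)
    show "colon R (bracket_power R I p) (x [^] p) \<subseteq> bracket_power R (colon R I x) p"
      by (rule regular_imp_colon_global[OF that I x])
  qed
  have b: "?two" if "?four"
  proof (intro allI impI)
    fix k :: nat and I :: "nat \<Rightarrow> 'a set" and n :: nat
    assume k: "k \<ge> 1" and I: "\<forall>j \<in> {1..k}. ideal (I j) R"
    have col: "colon R (bracket_power R I p) (u [^] p) \<subseteq> bracket_power R (colon R I u) p"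
      if "ideal I R" "u \<in> carrier R" for I u using \<open>?four\<close> that by blast
    show "(\<Inter>j \<in> {1..k}. bracket_power R (I j) (p ^ n)) = bracket_power R (\<Inter>j \<in> {1..k}. I j) (p ^ n)"
      using colon_imp_finite_inter[OF frob_exp_power[OF fr] colon_power[OF fr col] I k] by blast
  qed
  have c: "?three" if two: "?two"
  proof (intro allI impI)
    fix I x assume I: "ideal I R" and x: "x \<in> carrier R"
    \<comment> \<open>The pair I, (x) as an indexed family, with the exponent p = p^1.\<close>
    define F where "F j = (if j = (1::nat) then I else PIdl x)" for j
    have "\<forall>j\<in>{1..2}. ideal (F j) R" using I x by (auto simp: F_def cgenideal_ideal)
    hence "(\<Inter>j\<in>{1..2}. bracket_power R (F j) (p ^ 1)) = bracket_power R (\<Inter>j\<in>{1..2}. F j) (p ^ 1)"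
      using two[rule_format, of 2 F 1] by simp
    moreover have "{1..2::nat} = {1, 2}" by auto
    ultimately show "bracket_power R I p \<inter> PIdl (x [^] p) = bracket_power R (I \<inter> PIdl x) p"
      using bracket_PIdl[OF x, of p] by (simp add: F_def)
  qed
  have d: "?one" if "?three"
    by (rule inter_imp_regular[OF assms(3)]) (use that in blast)
  show ?thesis
  proof (intro conjI)
    show "?one \<longleftrightarrow> ?two" by (rule iffI, rule b, erule a, rule d, erule c)
    show "?one \<longleftrightarrow> ?three" by (rule iffI, rule c, rule b, erule a, erule d)
    show "?one \<longleftrightarrow> ?four" by (rule iffI, erule a, rule d, rule c, erule b)
  qed
qed

end
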